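(* Let $x,y,z$ be non-negative integers and let $\mathbf a=(a_1,\dots,a_m)$, $\mathbf b=(b_1,\dots,b_n)$ be two sequences of non-negative integers. Put $\mu=2\lfloor\frac{m+1}{2}\rfloor$, $\mu'=2\lceil\frac{m-1}{2}\rceil$, $\nu=2\lfloor\frac{n+1}{2}\rfloor$, $\nu'=2\lceil\frac{n-1}{2}\rceil$, and $$\mathbf t^{+}=(0,a_1+1,a_2,\dots,a_{\mu-1},\,a_{\mu}+x+y+b_{\nu},\,b_{\nu-1},\dots,b_1),\qquad \mathbf t^{-}=(a_1,\dots,a_{\mu'},\,a_{\mu'+1}+x+y+b_{\nu'+1},\,b_{\nu'},\dots,b_1,z).$$ Then $$M(N^{(1)}_{x,y,z}(\mathbf a;\mathbf b))=\frac{M(N^{(1)}_{x+y,0,z}(\mathbf a;\mathbf b))\,M(N^{(1)}_{0,y,z}(\mathbf a;\mathbf b))}{M(N^{(1)}_{y,0,z}(\mathbf a;\mathbf b))}\cdot\frac{T(x+1,2a+b+2y+z,y)\,T(x+a+1,b+2y+z,y)}{T(1,2a+b+2y+z,y)\,T(a+1,b+2y+z,y)}$$ $$=2^{a_1-y}\,K'(\mathbf t^{+})\,Q(\mathbf t^{-})\cdot\frac{(a+y)!}{a!}\cdot\frac{H_2(2o_a+2o_b+2)\,H_2(2e_a+2e_b+2z+1)}{H_2(2o_a+2o_b+2y+2)\,H_2(2e_a+2e_b+2y+2z+1)}\cdot\frac{H(2a+b+2y+z+1)\,H(b+y+z)}{H(2a+b+y+z+1)\,H(b+z)}$$ $$\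cdot\frac{T(x+1,2a+b+2y+z,y)\,T(x+a+1,b+2y+z,y)}{T(1,2a+b+2y+z,y)\,T(a+1,b+2y+z,y)}.$$
   Context: Lattice and tilings. For real $u,k$ let $[u;k]$ be the point of the plane with Cartesian coordinates $(u,\frac{\sqrt3}{2}k)$. The triangular lattice has as vertices all $[u;k]$ with $k\in\mathbb Z$, $u-k/2\in\mathbb Z$; its faces are unit equilateral triangles, up-pointing or down-pointing. A region is a finite union of unit triangles. A lozenge is the union of two unit triangles sharing an edge; it is vertical if that edge is horizontal. A tiling of a region is a covering of it by lozenges contained in it, without gaps or overlaps. $M(R)$ is the sum of the weights of all tilings of $R$, the weight of a tiling being the product of the weights of its lozenges; lozenges have weight $1$ unless stated otherwise; $M(\emptyset)=1$. Sequences. $a=\sum a_i$, $b=\sum b_j$; $o_a,e_a$ are the sums of the $a_i$ with $i$ odd, resp. even; $o_b,e_b$ likewise. $a_i=0$ for $i>m$, $b_j=0$ for $j>n$; an empty sequence is treated as the one-term sequence $(0)$. Functions. $H(n)=\prod_{i=0}^{n-1}i!$; $H_2(n)=\prod_{i=1}^{\lfloor n/2\rfloor}(n-2i)!$; for $n\ge0$, $(x)_n=x(x+1)\cdots(x+n-1)$ ($1$ for $n=0$); $T(x,n,m)=\prod_{i=0}^{m-1}(x+i)_{n-2i}$. Empty products are $1$. Quartered hexagons. For a sequence $\mathbf t=(t_1,\dots,t_{2l})$ of non-negative integers let $s_k=t_1+\dots+t_k$, $o_t=\sum_{i\text{ odd}}t_i$, $e_t=\sum_{i\text{ even}}t_i$.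 $Q(\mathbf t)$: take the region bounded by the base from $[0;0]$ to $[o_t+e_t;0]$, the segment from $[o_t+e_t;0]$ to $[o_t;2e_t]$, the north side from $[o_t;2e_t]$ to $[0;2e_t]$, and the west zigzag through $[0;0],[-\frac12;1],[0;2],[-\frac12;3],\dots,[0;2e_t]$; remove from it, for each $1\le i\le l$, the up-pointing triangle with base from $[s_{2i-1};0]$ to $[s_{2i};0]$. $Q(\mathbf t)$ is the number of tilings of the resulting region. $K'(\mathbf t)$ (for $e_t\ge1$): take the region bounded by the base from $[0;0]$ to $[o_t+e_t;0]$, the segment from $[o_t+e_t;0]$ to $[o_t+\frac12;2e_t-1]$, the north side from there to $[\frac12;2e_t-1]$, and the west zigzag through $[0;0],[\frac12;1],[0;2],[\frac12;3],\dots,[\frac12;2e_t-1]$; remove the same up-pointing triangles; give weight $\frac12$ to each vertical lozenge whose two western (left) sides both lie on the west zigzag. $K'(\mathbf t)$ is $M$ of this weighted region. The region $N^{(1)}_{x,y,z}(\mathbf a;\mathbf b)$. Let $L=x+y+a+b$, $A=2(y+o_a+o_b)+1$, $B=2(y+z+e_a+e_b)$, and let $\ell$ be the line $k=0$. Upper part: bounded by $\ell$ between $[-1;0]$ and $[L;0]$, the segment from $[L;0]$ to $[L-\frac A2;A]$, the horizontal north side at height $k=A$, and the west zigzag through the points $[\alpha(k);k]$, $0\le k\le A$, with $\alpha(k)=-1$ for $k$ even and $-\frac12$ for $k$ odd. Lower part: bounded by $\ell$ between $[0;0]$ and $[L;0]$, the segments from $[L;0]$ to $[L+\frac z2;-z]$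 and from there to $[L+z-\frac B2;-B]$, the horizontal south side at $k=-B$, and the west zigzag through $[\beta(k);-k]$, $0\le k\le B$, with $\beta(k)=0$ for $k$ even and $-\frac12$ for $k$ odd. The region is the union of the two parts (lozenges may cross $\ell$) after removing: (i) from the upper part, everything at points $[u;k]$ with $u<a_1-k/2$ (the up-pointing half triangle); (ii) for $2\le i\le m$, the triangle of side $a_i$ having a side on $\ell$ from $[a_1+\dots+a_{i-1};0]$ to $[a_1+\dots+a_i;0]$, down-pointing (below $\ell$) if $i$ is even, up-pointing (above $\ell$) if $i$ is odd; (iii) for $1\le j\le n$, the triangle of side $b_j$ having a side on $\ell$ from $[L-b_1-\dots-b_j;0]$ to $[L-b_1-\dots-b_{j-1};0]$, up-pointing (above $\ell$) if $j$ is odd, down-pointing (below $\ell$) if $j$ is even. Each vertical lozenge whose two western (left) sides both lie on the upper west zigzag has weight $\frac12$; all others have weight $1$. *)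

theory Defs
  imports Complex_Main "HOL-Library.Disjoint_Sets"
begin

text \<open>
  The pair \<open>(i, k)\<close> of integers stands for the lattice vertex \<open>[i + k/2; k]\<close>, where
  \<open>[u; k]\<close> is the point of the plane with Cartesian coordinates \<open>(u, k * sqrt 3 / 2)\<close>.
  The function \<open>ucoord\<close> recovers \<open>u\<close>; all boundaries below are written in the
  coordinates \<open>[u; k]\<close>.  A unit triangle is represented by the set of its three vertices.
\<close>

type_synonym vertex = "int \<times> int"
type_synonym face = "vertex set"

definition ucoord :: "vertex \<Rightarrow> real" where
  "ucoord v = real_of_int (fst v) + real_of_int (snd v) / 2"

text \<open>The up-pointing and the down-pointing unit triangle on the horizontal edge
  from \<open>(i, k)\<close> to \<open>(i + 1, k)\<close>.\<close>

definition up_face :: "int \<Rightarrow> int \<Rightarrow> face" where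
  "up_face i k = {(i, k), (i + 1, k), (i, k + 1)}"

definition down_face :: "int \<Rightarrow> int \<Rightarrow> face" where
  "down_face i k = {(i, k), (i + 1, k), (i + 1, k - 1)}"

definition unit_triangle :: "face \<Rightarrow> bool" where
  "unit_triangle f \<longleftrightarrow> (\<exists>i k. f = up_face i k \<or> f = down_face i k)"

text \<open>
  A region (a union of unit triangles) is represented by the set of its unit triangles.
  \<open>faces_in P\<close> is the set of unit triangles contained in the part of the plane described
  by \<open>P\<close>, where \<open>P u k\<close> is a condition on the point \<open>[u; k]\<close>.  It suffices to test the
  vertices, since a unit triangle has its vertices on two consecutive horizontal lattice
  lines, and in the closed strip between them each part of the plane used below is convex
  (the zigzags and the lines bounding it are straight there).
\<close>

definition faces_in :: "(real \<Rightarrow> int \<Rightarrow> bool) \<Rightarrow> face set" where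
  "faces_in P = {f. unit_triangle f \<and> (\<forall>v\<in>f. P (ucoord v) (snd v))}"

text \<open>A lozenge is represented by the set of its two unit triangles; sharing an edge means
  having two vertices in common.\<close>

definition lozenge :: "face set \<Rightarrow> bool" where
  "lozenge l \<longleftrightarrow> (\<exists>f g. unit_triangle f \<and> unit_triangle g \<and> f \<noteq> g \<and> card (f \<inter> g) = 2 \<and> l = {f, g})"

definition tilings :: "face set \<Rightarrow> face set set set" where
  "tilings R = {P. partition_on R P \<and> (\<forall>l\<in>P. lozenge l)}"

definition M :: "(face set \<Rightarrow> real) \<Rightarrow> face set \<Rightarrow> real" where
  "M w R = (\<Sum>P\<in>tilings R. \<Prod>l\<in>P. w l)"

definition vertical_lozenge :: "int \<Rightarrow> int \<Rightarrow> face set" where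
  "vertical_lozenge i k = {up_face i k, down_face i k}"

text \<open>
  The two western sides of \<open>vertical_lozenge i k\<close> join its westernmost vertex \<open>(i, k)\<close> to
  the top vertex \<open>(i, k + 1)\<close> and to the bottom vertex \<open>(i + 1, k - 1)\<close>.  The zigzag is
  given by the set \<open>Z\<close> of its vertices, one for each height, so a side lies on the zigzag
  iff both its endpoints belong to \<open>Z\<close>.
\<close>

definition zigzag_weight :: "vertex set \<Rightarrow> face set \<Rightarrow> real" where
  "zigzag_weight Z l =
     (if \<exists>i k. l = vertical_lozenge i k \<and> {(i, k), (i, k + 1), (i + 1, k - 1)} \<subseteq> Z
      then 1 / 2 else 1)"

definition zigzag :: "(int \<Rightarrow> real) \<Rightarrow> int \<Rightarrow> vertex set" where
  "zigzag \<alpha> h = {v. 0 \<le> snd v \<and> snd v \<le> h \<and> ucoord v = \<alpha> (snd v)}"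

text \<open>Unit triangles of the up-pointing, resp. down-pointing, triangle of side \<open>c\<close> with a
  side from \<open>[p; 0]\<close> to \<open>[p + c; 0]\<close>; none if \<open>c = 0\<close>.\<close>

definition up_triangle :: "nat \<Rightarrow> nat \<Rightarrow> face set" where
  "up_triangle p c = faces_in (\<lambda>u k. 0 \<le> k \<and> real p + k / 2 \<le> u \<and> u \<le> real p + real c - k / 2)"

definition down_triangle :: "nat \<Rightarrow> nat \<Rightarrow> face set" where
  "down_triangle p c = faces_in (\<lambda>u k. k \<le> 0 \<and> real p - k / 2 \<le> u \<and> u \<le> real p + real c + k / 2)"

text \<open>Sequences are lists, indexed from 1 and continued by zeros.\<close>

definition entry :: "nat list \<Rightarrow> nat \<Rightarrow> nat" where
  "entry t i = (if 1 \<le> i \<and> i \<le> length t then t ! (i - 1) else 0)"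

definition odd_sum :: "nat list \<Rightarrow> nat" where
  "odd_sum t = (\<Sum>i | i \<in> {1..length t} \<and> odd i. entry t i)"

definition even_sum :: "nat list \<Rightarrow> nat" where
  "even_sum t = (\<Sum>i | i \<in> {1..length t} \<and> even i. entry t i)"

definition psum :: "nat list \<Rightarrow> nat \<Rightarrow> nat" where
  "psum t k = (\<Sum>i=1..k. entry t i)"

definition dents :: "nat list \<Rightarrow> face set" where
  "dents t = (\<Union>i\<in>{1..length t div 2}. up_triangle (psum t (2 * i - 1)) (entry t (2 * i)))"

definition Q_west :: "int \<Rightarrow> real" where
  "Q_west k = (if even k then 0 else - (1 / 2))"

definition Q_region :: "nat list \<Rightarrow> face set" where
  "Q_region t =
     faces_in (\<lambda>u k. 0 \<le> k \<and> k \<le> 2 * int (even_sum t) \<and> Q_west k \<le> u \<and>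
                     u \<le> real (odd_sum t + even_sum t) - k / 2)
     - dents t"

definition Q :: "nat list \<Rightarrow> nat" where
  "Q t = card (tilings (Q_region t))"

definition K_west :: "int \<Rightarrow> real" where
  "K_west k = (if even k then 0 else 1 / 2)"

definition K'_region :: "nat list \<Rightarrow> face set" where
  "K'_region t =
     faces_in (\<lambda>u k. 0 \<le> k \<and> k \<le> 2 * int (even_sum t) - 1 \<and> K_west k \<le> u \<and>
                     u \<le> real (odd_sum t + even_sum t) - k / 2)
     - dents t"

text \<open>Only meaningful for \<open>even_sum t \<ge> 1\<close>.\<close>

definition K' :: "nat list \<Rightarrow> real" where
  "K' t = M (zigzag_weight (zigzag K_west (2 * int (even_sum t) - 1))) (K'_region t)"

definition N_len :: "nat \<Rightarrow> nat \<Rightarrow> nat list \<Rightarrow> nat list \<Rightarrow> nat" where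
  "N_len x y a b = x + y + sum_list a + sum_list b"

definition N_up :: "nat \<Rightarrow> nat list \<Rightarrow> nat list \<Rightarrow> nat" where
  "N_up y a b = 2 * (y + odd_sum a + odd_sum b) + 1"

definition N_down :: "nat \<Rightarrow> nat \<Rightarrow> nat list \<Rightarrow> nat list \<Rightarrow> nat" where
  "N_down y z a b = 2 * (y + z + even_sum a + even_sum b)"

definition N_west_up :: "int \<Rightarrow> real" where
  "N_west_up k = (if even k then - 1 else - (1 / 2))"

definition N_west_down :: "int \<Rightarrow> real" where
  "N_west_down k = (if even k then 0 else - (1 / 2))"

text \<open>The half triangle at the western boundary is cut off by a lattice line, so the unit
  triangles whose interior lies in the open half plane \<open>u < a\<^sub>1 - k/2\<close> are those
  contained in the closed one.\<close>

definition N_upper :: "nat \<Rightarrow> nat \<Rightarrow> nat list \<Rightarrow> nat list \<Rightarrow> face set" where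
  "N_upper x y a b =
     faces_in (\<lambda>u k. 0 \<le> k \<and> k \<le> int (N_up y a b) \<and> N_west_up k \<le> u \<and>
                     u \<le> real (N_len x y a b) - k / 2)
     - faces_in (\<lambda>u k. 0 \<le> k \<and> u \<le> real (entry a 1) - k / 2)"

text \<open>The eastern boundary has slope changing at height \<open>k = - z\<close>: it is \<open>u = L - k/2\<close>
  for \<open>- z \<le> k\<close> and \<open>u = L + z + k/2\<close> for \<open>k \<le> - z\<close>, i.e. the minimum of
  \<open>L - k/2\<close> and \<open>L + z + k/2\<close>.\<close>

definition N_lower :: "nat \<Rightarrow> nat \<Rightarrow> nat \<Rightarrow> nat list \<Rightarrow> nat list \<Rightarrow> face set" where
  "N_lower x y z a b =
     faces_in (\<lambda>u k. - int (N_down y z a b) \<le> k \<and> k \<le> 0 \<and> N_west_down k \<le> u \<and>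
                     u \<le> real (N_len x y a b) - k / 2 \<and>
                     u \<le> real (N_len x y a b) + real z + k / 2)"

definition N_removed_a :: "nat list \<Rightarrow> face set" where
  "N_removed_a a =
     (\<Union>i\<in>{2..length a}.
        (if even i then down_triangle else up_triangle) (psum a (i - 1)) (entry a i))"

definition N_removed_b :: "nat \<Rightarrow> nat list \<Rightarrow> face set" where
  "N_removed_b L b =
     (\<Union>j\<in>{1..length b}.
        (if odd j then up_triangle else down_triangle) (L - psum b j) (entry b j))"

definition N_region :: "nat \<Rightarrow> nat \<Rightarrow> nat \<Rightarrow> nat list \<Rightarrow> nat list \<Rightarrow> face set" where
  "N_region x y z a b =
     (N_upper x y a b \<union> N_lower x y z a b) - N_removed_a a - N_removed_b (N_len x y a b) b"

definition MN :: "nat \<Rightarrow> nat \<Rightarrow> nat \<Rightarrow> nat list \<Rightarrow> nat list \<Rightarrow> real" where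
  "MN x y z a b =
     M (zigzag_weight (zigzag N_west_up (int (N_up y a b)))) (N_region x y z a b)"

definition H :: "nat \<Rightarrow> real" where
  "H n = (\<Prod>i<n. fact i)"

definition H2 :: "nat \<Rightarrow> real" where
  "H2 n = (\<Prod>i=1..n div 2. fact (n - 2 * i))"

text \<open>Intended for \<open>2 * (m - 1) \<le> n\<close>, where the subtraction is not truncated.\<close>

definition T :: "nat \<Rightarrow> nat \<Rightarrow> nat \<Rightarrow> real" where
  "T x n m = (\<Prod>i<m. pochhammer (real (x + i)) (n - 2 * i))"

text \<open>The empty sequence counts as the one-term sequence \<open>(0)\<close>.\<close>

definition seq_len :: "nat list \<Rightarrow> nat" where
  "seq_len a = max 1 (length a)"

text \<open>With \<open>m = seq_len a\<close>, \<open>\<mu> = 2 * \<lfloor>(m + 1) / 2\<rfloor>\<close> and \<open>\<mu>' = 2 * \<lceil>(m - 1) / 2\<rceil> = 2 * \<lfloor>m / 2\<rfloor>\<close>.\<close>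

definition mu :: "nat list \<Rightarrow> nat" where
  "mu a = 2 * ((seq_len a + 1) div 2)"

definition mu' :: "nat list \<Rightarrow> nat" where
  "mu' a = 2 * (seq_len a div 2)"

definition t_plus :: "nat \<Rightarrow> nat \<Rightarrow> nat list \<Rightarrow> nat list \<Rightarrow> nat list" where
  "t_plus x y a b =
     [0, entry a 1 + 1] @ map (entry a) [2..<mu a]
     @ [entry a (mu a) + x + y + entry b (mu b)]
     @ rev (map (entry b) [1..<mu b])"

definition t_minus :: "nat \<Rightarrow> nat \<Rightarrow> nat \<Rightarrow> nat list \<Rightarrow> nat list \<Rightarrow> nat list" where
  "t_minus x y z a b =
     map (entry a) [1..<mu' a + 1]
     @ [entry a (mu' a + 1) + x + y + entry b (mu' b + 1)]
     @ rev (map (entry b) [1..<mu' b + 1]) @ [z]"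

end

theory Submission
  imports Defs "Jordan_Normal_Form.Determinant" "HOL-Library.FuncSet"
begin

text \<open>
  Cutting along \<open>\<ell>\<close> turns \<open>M(N)\<close> into a sum over the sets \<open>S\<close> of the \<open>y\<close> vertical lozenges
  crossing \<open>\<ell>\<close> in the gap between the two ferns; each summand is a product of the tiling
  generating functions of two quartered hexagons with dents.  With \<open>x\<^sub>i\<close> the distance of
  the \<open>i\<close>-th dent from the axis of the zigzag, these are \<open>\<Prod>(x\<^sub>j\<^sup>2 - x\<^sub>i\<^sup>2)\<close> (upper part) and \<open>\<Prod>x\<^sub>i \<Prod>(x\<^sub>j\<^sup>2 - x\<^sub>i\<^sup>2)\<close> (lower part)
  up to constants: a tiling is a chain of interlacing rows, and summing a determinant over a row
  amounts to taking discrete antiderivatives of its entries.  The positions in the ferns together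
  fill two intervals, so the summand depends on \<open>S\<close> through \<open>\<Prod>(x\<^sub>j\<^sup>2 - x\<^sub>i\<^sup>2)\<^sup>2\<close> and a weight that
  only sees these intervals.  This discrete Selberg sum is a determinant whose entries are
  summable in closed form (Racah weight), and in the entries the dependence on the parameter \<open>x\<close> splits off as
  row and column factors.  Hence the remaining determinant never has to be evaluated: it cancels
  against the case \<open>x = 0\<close>, where the sum has a single term.
\<close>

section \<open>Determinants\<close>

text \<open>Why the two halves fit: both zigzags have the axis \<open>u = - 1 / 2\<close>, so a dent
  whose base starts at \<open>p\<close> is at distance \<open>p + 1\<close> from the axis above and
  below \<ell>. This lets the Vandermonde products of the same \<open>S\<close> meet as a square,
  and it puts the part of the half triangle's base west of 0 at distance 0, as one more dent. The
  weight 1/2 belongs to the vertical lozenges centred on the axis; it makes the antiderivatives of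
  the upper half odd functions, so that no boundary term survives. The factors independent of
  \<open>S\<close> are never evaluated. Apart from normalising factorials, which see only the fern
  sums, \<open>z\<close> and \<open>y\<close>, they depend on the gap through \<open>x + y\<close>
  alone. Hence they agree for \<open>(x, y)\<close> and \<open>(x + y, 0)\<close>, and for
  \<open>(0, y)\<close> and \<open>(y, 0)\<close>: this is why precisely these four regions occur in
  the first formula. At \<open>y = 0\<close> nothing crosses \<ell>, and the same factors are a
  product of two weighted tiling counts; this is where \<open>K'\<close> and \<open>Q\<close> come
  from.\<close>

definition fdet :: "nat \<Rightarrow> (nat \<Rightarrow> nat \<Rightarrow> 'a :: comm_ring_1) \<Rightarrow> 'a" where
  "fdet n f = det (mat n n (\<lambda>(i, j). f i j))"

lemma fdet_0 [simp]: "fdet 0 f = 1"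
  by (simp add: fdet_def)

lemma fdet_cong:
  assumes "\<And>i j. i < n \<Longrightarrow> j < n \<Longrightarrow> f i j = g i j"
  shows "fdet n f = fdet n g"
  unfolding fdet_def using assms by (intro arg_cong[where f = det] eq_matI) auto

lemma fdet_leibniz:
  "fdet n f = (\<Sum>p | p permutes {..<n}. signof p * (\<Prod>i<n. f i (p i)))"
proof -
  have "fdet n f = (\<Sum>p | p permutes {0..<n}. signof p * (\<Prod>i = 0..<n. mat n n (\<lambda>(i, j). f i j) $$ (i, p i)))"
    unfolding fdet_def by (subst det_def'[of _ n]) simp_all
  also have "\<dots> = (\<Sum>p | p permutes {0..<n}. signof p * (\<Prod>i = 0..<n. f i (p i)))"
    by (intro sum.cong prod.cong arg_cong2[where f = "(*)"] refl)
       (auto dest: permutes_in_image)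
  finally show ?thesis by (simp add: lessThan_atLeast0)
qed

lemma fdet_transpose: "fdet n (\<lambda>i j. f j i) = fdet n f"
proof -
  have "fdet n (\<lambda>i j. f j i) = det (transpose_mat (mat n n (\<lambda>(i, j). f i j)))"
    unfolding fdet_def by (intro arg_cong[where f = det] eq_matI) auto
  also have "\<dots> = fdet n f"
    unfolding fdet_def by (rule det_transpose[of _ n]) simp
  finally show ?thesis .
qed

lemma fdet_scale: "fdet n (\<lambda>i j. r i * c j * f i j) = (\<Prod>i<n. r i) * (\<Prod>j<n. c j) * fdet n f"
proof -
  have "(\<Prod>i<n. c (p i)) = (\<Prod>j<n. c j)" if "p permutes {..<n}" for p
    using that by (metis permutes_imp_bij prod.reindex_bij_betw)
  then show ?thesis
    by (auto simp: fdet_leibniz sum_distrib_left prod.distrib intro!: sum.cong)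
qed

lemma fdet_mult: "fdet n (\<lambda>i j. \<Sum>k<n. f i k * g k j) = fdet n f * fdet n g"
proof -
  have "mat n n (\<lambda>(i, j). \<Sum>k<n. f i k * g k j)
      = mat n n (\<lambda>(i, j). f i j) * mat n n (\<lambda>(i, j). g i j)"
    by (intro eq_matI) (auto simp: scalar_prod_def lessThan_atLeast0 intro!: sum.cong)
  then show ?thesis
    unfolding fdet_def by (simp add: det_mult[of _ n])
qed

lemma fdet_lower:
  assumes "\<And>i j. i < j \<Longrightarrow> j < n \<Longrightarrow> f i j = 0"
  shows "fdet n f = (\<Prod>i<n. f i i)"
proof -
  have "fdet n f = prod_list (diag_mat (mat n n (\<lambda>(i, j). f i j)))"
    unfolding fdet_def by (rule det_lower_triangular[of n]) (simp_all add: assms)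
  also have "\<dots> = (\<Prod>i = 0..<n. f i i)"
    by (simp add: prod_list_diag_prod)
  finally show ?thesis by (simp add: lessThan_atLeast0)
qed

lemma fdet_upper:
  assumes "\<And>i j. j < i \<Longrightarrow> i < n \<Longrightarrow> f i j = 0"
  shows "fdet n f = (\<Prod>i<n. f i i)"
  unfolding fdet_transpose[of n f, symmetric] by (rule fdet_lower) (simp add: assms)

lemma fdet_permute_rows:
  assumes "p permutes {..<n}"
  shows "fdet n (\<lambda>i j. f (p i) j) = signof p * fdet n f"
proof -
  have "mat n n (\<lambda>(i, j). f (p i) j) = mat n n (\<lambda>(i, j). mat n n (\<lambda>(i, j). f i j) $$ (p i, j))"
    using permutes_in_image[OF assms] by (intro eq_matI) auto
  then show ?thesis
    unfolding fdet_def using det_permute_rows[of "mat n n (\<lambda>(i, j). f i j)" n p] assms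
    by (simp add: lessThan_atLeast0)
qed

lemma fdet_identical_rows:
  assumes "i < n" "i' < n" "i \<noteq> i'" "\<And>j. j < n \<Longrightarrow> f i j = f i' j"
  shows "fdet n f = 0"
  unfolding fdet_def
  by (rule det_identical_rows[of _ n i i']) (use assms in auto)

text \<open>Multilinearity in all rows at once: the choice \<open>q i\<close> enters row
  \<open>i\<close> only. In this way a determinant is summed over all rows of dents that interlace
  with a given one.\<close>

lemma fdet_sum_rows:
  assumes "\<And>i. i < n \<Longrightarrow> finite (I i)"
  shows "(\<Sum>q\<in>PiE {..<n} I. fdet n (\<lambda>i j. f i j (q i))) = fdet n (\<lambda>i j. \<Sum>x\<in>I i. f i j x)"
proof -
  have "(\<Sum>q\<in>PiE {..<n} I. fdet n (\<lambda>i j. f i j (q i)))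
      = (\<Sum>p | p permutes {..<n}. signof p * (\<Sum>q\<in>PiE {..<n} I. \<Prod>i<n. f i (p i) (q i)))"
    by (simp add: fdet_leibniz sum_distrib_left sum.swap[of _ _ "PiE {..<n} I"])
  also have "\<dots> = fdet n (\<lambda>i j. \<Sum>x\<in>I i. f i j x)"
    unfolding fdet_leibniz using assms
    by (intro sum.cong refl arg_cong2[where f = "(*)"] prod_sum_PiE[symmetric]) auto
  finally show ?thesis .
qed

text \<open>Both sides of the Newton-basis evaluation are independent of the nodes \<open>\<xi>\<close>, so one may take
  \<open>\<xi> = y\<close>, which makes the matrix triangular.\<close>

lemma newton_basis_change:
  fixes \<xi> \<eta> :: "nat \<Rightarrow> 'a :: comm_ring_1"
  shows "\<exists>C. (\<forall>k>j. C k = 0) \<and> C j = 1 \<and>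
    (\<forall>Y. (\<Prod>m<j. Y - \<xi> m) = (\<Sum>k\<le>j. (\<Prod>m<k. Y - \<eta> m) * C k))"
proof (induction j)
  case 0
  show ?case by (rule exI[of _ "\<lambda>k. if k = 0 then 1 else 0"]) simp
next
  case (Suc j)
  then obtain C where C: "\<And>k. k > j \<Longrightarrow> C k = 0" "C j = 1"
    and eq: "\<And>Y. (\<Prod>m<j. Y - \<xi> m) = (\<Sum>k\<le>j. (\<Prod>m<k. Y - \<eta> m) * C k)" by blast
  \<comment> \<open>From \<open>Y - \<xi> j = (Y - \<eta> k) + (\<eta> k - \<xi> j)\<close>: the
    first summand lengthens the Newton product, the second rescales it.\<close>
  define C' where "C' k = (if k = 0 then 0 else C (k - 1)) + (\<eta> k - \<xi> j) * C k" for k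
  have "(\<Prod>m<Suc j. Y - \<xi> m) = (\<Sum>k\<le>Suc j. (\<Prod>m<k. Y - \<eta> m) * C' k)" for Y
  proof -
    have "(\<Prod>m<Suc j. Y - \<xi> m) = (\<Sum>k\<le>j. (\<Prod>m<k. Y - \<eta> m) * C k * (Y - \<xi> j))"
      by (simp add: eq sum_distrib_right)
    also have "\<dots> = (\<Sum>k\<le>j. (\<Prod>m<Suc k. Y - \<eta> m) * C k)
                   + (\<Sum>k\<le>j. (\<Prod>m<k. Y - \<eta> m) * ((\<eta> k - \<xi> j) * C k))"
      unfolding sum.distrib[symmetric] by (intro sum.cong refl) (simp add: algebra_simps)
    also have "(\<Sum>k\<le>j. (\<Prod>m<Suc k. Y - \<eta> m) * C k)
             = (\<Sum>k\<le>Suc j. (\<Prod>m<k. Y - \<eta> m) * (if k = 0 then 0 else C (k - 1)))"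
      by (subst sum.atMost_Suc_shift) simp
    also have "(\<Sum>k\<le>j. (\<Prod>m<k. Y - \<eta> m) * ((\<eta> k - \<xi> j) * C k))
             = (\<Sum>k\<le>Suc j. (\<Prod>m<k. Y - \<eta> m) * ((\<eta> k - \<xi> j) * C k))"
      using C(1) by simp
    finally show ?thesis
      by (simp only: C'_def distrib_left sum.distrib)
  qed
  moreover have "\<forall>k>Suc j. C' k = 0" "C' (Suc j) = 1"
    using C by (auto simp: C'_def)
  ultimately show ?case by blast
qed

lemma fdet_newton:
  fixes y \<xi> :: "nat \<Rightarrow> 'a :: comm_ring_1"
  shows "fdet n (\<lambda>i j. \<Prod>m<j. y i - \<xi> m) = (\<Prod>j<n. \<Prod>i<j. y j - y i)"
proof -
  have "\<forall>j. \<exists>C. (\<forall>k>j. C k = 0) \<and> C j = 1 \<and>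
      (\<forall>Y. (\<Prod>m<j. Y - \<xi> m) = (\<Sum>k\<le>j. (\<Prod>m<k. Y - y m) * C k))"
    by (intro allI newton_basis_change)
  from choice[OF this] obtain C where *: "\<forall>j. (\<forall>k>j. C j k = 0) \<and> C j j = 1 \<and>
      (\<forall>Y. (\<Prod>m<j. Y - \<xi> m) = (\<Sum>k\<le>j. (\<Prod>m<k. Y - y m) * C j k))"
    ..
  have C: "\<And>j k. k > j \<Longrightarrow> C j k = 0" "\<And>j. C j j = 1"
    and eq: "\<And>j Y. (\<Prod>m<j. Y - \<xi> m) = (\<Sum>k\<le>j. (\<Prod>m<k. Y - y m) * C j k)"
    using * by blast+
  have "fdet n (\<lambda>i j. \<Prod>m<j. y i - \<xi> m) = fdet n (\<lambda>i j. \<Sum>k<n. (\<Prod>m<k. y i - y m) * C j k)"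
  proof (rule fdet_cong)
    fix i j assume "i < n" "j < n"
    then show "(\<Prod>m<j. y i - \<xi> m) = (\<Sum>k<n. (\<Prod>m<k. y i - y m) * C j k)"
      unfolding eq by (intro sum.mono_neutral_left) (auto simp: C)
  qed
  also have "\<dots> = fdet n (\<lambda>i k. \<Prod>m<k. y i - y m) * fdet n (\<lambda>k j. C j k)"
    by (rule fdet_mult)
  also have "fdet n (\<lambda>k j. C j k) = 1"
    by (subst fdet_upper) (auto simp: C)
  also have "fdet n (\<lambda>i k. \<Prod>m<k. y i - y m) = (\<Prod>j<n. \<Prod>i<j. y j - y i)"
    by (rule fdet_lower, rule prod_zero) auto
  finally show ?thesis by simp
qed

text \<open>Such row differences arise when the first interval starts at the axis, where the
  antiderivative is 0, and every later one at the preceding dent. The matrix \<open>L\<close> below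
  is unitriangular.\<close>

lemma fdet_row_diff:
  "fdet n (\<lambda>i j. f i j - (if i = 0 then 0 else f (i - 1) j)) = fdet n f"
proof -
  define L :: "nat \<Rightarrow> nat \<Rightarrow> 'a" where
    "L i k = (if k = i then 1 else if Suc k = i then - 1 else 0)" for i k
  have "fdet n (\<lambda>i j. f i j - (if i = 0 then 0 else f (i - 1) j)) = fdet n (\<lambda>i j. \<Sum>k<n. L i k * f k j)"
  proof (rule fdet_cong)
    fix i j assume i: "i < n"
    have "(\<Sum>k<n. L i k * f k j) = (\<Sum>k\<in>{k. k = i \<or> Suc k = i}. L i k * f k j)"
      using i by (intro sum.mono_neutral_right) (auto simp: L_def)
    also have "{k. k = i \<or> Suc k = i} = (if i = 0 then {i} else {i, i - 1})" by auto
    finally show "f i j - (if i = 0 then 0 else f (i - 1) j) = (\<Sum>k<n. L i k * f k j)"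
      by (cases i) (simp_all add: L_def)
  qed
  also have "\<dots> = fdet n L * fdet n f" by (rule fdet_mult)
  also have "fdet n L = 1" by (subst fdet_lower) (auto simp: L_def)
  finally show ?thesis by simp
qed

text \<open>Row differences clear the column of ones, at the cost of one row and one column. Read
  from right to left, this turns the \<open>n\<close> differences between \<open>n + 1\<close> dents
  into a determinant in the dents themselves.\<close>

lemma fdet_first_column_one:
  assumes "\<And>i. i \<le> n \<Longrightarrow> f i 0 = 1"
  shows "fdet (Suc n) f = fdet n (\<lambda>i j. f (Suc i) (Suc j) - f i (Suc j))"
proof -
  let ?g = "\<lambda>i j. f i j - (if i = 0 then 0 else f (i - 1) j)"
  have "fdet (Suc n) f = fdet (Suc n) ?g" by (rule fdet_row_diff[symmetric])
  also have "\<dots> = det (four_block_mat (mat 1 1 (\<lambda>_. 1)) (mat 1 n (\<lambda>(i, j). f 0 (Suc j)))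
      (0\<^sub>m n 1) (mat n n (\<lambda>(i, j). ?g (Suc i) (Suc j))))"
    unfolding fdet_def
    by (intro arg_cong[where f = det] eq_matI) (auto simp: assms Let_def)
  also have "\<dots> = det (mat 1 1 (\<lambda>_. 1 :: 'a)) * det (mat n n (\<lambda>(i, j). ?g (Suc i) (Suc j)))"
    by (rule det_four_block_mat_lower_left_zero_col) auto
  also have "det (mat 1 1 (\<lambda>_. 1 :: 'a)) = 1"
    by (simp add: det_single)
  finally show ?thesis by (simp add: fdet_def)
qed

definition nth_elem :: "'b :: linorder set \<Rightarrow> nat \<Rightarrow> 'b" where
  "nth_elem S i = sorted_list_of_set S ! i"

lemma nth_elem_bij:
  assumes "finite S"
  shows "bij_betw (nth_elem S) {..<card S} S"
  unfolding nth_elem_def using assms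
  by (intro bij_betw_nth) auto

lemma nth_elem_strict_mono:
  assumes "finite S" "i < j" "j < card S"
  shows "nth_elem S i < nth_elem S j"
  unfolding nth_elem_def using assms
  by (intro sorted_wrt_nth_less[OF strict_sorted_list_of_set]) auto

text \<open>A Cauchy-Binet identity for sums over subsets. Expanding the right side by rows gives a
  sum over all maps \<open>q\<close> from the rows to \<open>G\<close>. A map that repeats a value
  produces two equal rows; an injective one is a subset together with an ordering of it, and summing
  over the orderings rebuilds the determinant in \<open>f\<close>.\<close>

lemma andreief:
  fixes w :: "'b :: linorder \<Rightarrow> 'a :: comm_ring_1"
  assumes G: "finite G"
  shows "(\<Sum>S | S \<subseteq> G \<and> card S = n. (\<Prod>x\<in>S. w x)
           * (fdet n (\<lambda>i j. f j (nth_elem S i)) * fdet n (\<lambda>i j. g j (nth_elem S i))))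
       = fdet n (\<lambda>i j. \<Sum>x\<in>G. w x * f i x * g j x)"
proof -
  let ?F = "\<lambda>q. (\<Prod>i<n. w (q i) * f i (q i)) * fdet n (\<lambda>i j. g j (q i))"
  let ?Q = "PiE {..<n} (\<lambda>_. G)"
  let ?X = "{S. S \<subseteq> G \<and> card S = n} \<times> {p. p permutes {..<n}}"
  \<comment> \<open>An injective \<open>q\<close> is the increasing enumeration of its image after a
    permutation of the rows; \<open>restrict\<close> supplies the value that members of
    \<open>PiE\<close> take outside the rows.\<close>
  let ?h = "\<lambda>(S, p). restrict (nth_elem S \<circ> p) {..<n}"
  have bS: "bij_betw (nth_elem S) {..<n} S" if "S \<subseteq> G" "card S = n" for S
    using nth_elem_bij[of S] that finite_subset[OF _ G] by blast
  have "fdet n (\<lambda>i j. \<Sum>x\<in>G. w x * f i x * g j x)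
      = (\<Sum>q\<in>?Q. fdet n (\<lambda>i j. w (q i) * f i (q i) * g j (q i)))"
    by (rule fdet_sum_rows[symmetric]) (rule G)
  also have "\<dots> = (\<Sum>q\<in>?Q. ?F q)"
    using fdet_scale[of n _ "\<lambda>_. 1"] by (intro sum.cong) auto
  also have "\<dots> = (\<Sum>q\<in>{q\<in>?Q. inj_on q {..<n}}. ?F q)"
  proof (rule sum.mono_neutral_right)
    show "finite ?Q" using G by (intro finite_PiE) auto
    show "\<forall>q\<in>?Q - {q\<in>?Q. inj_on q {..<n}}. ?F q = 0"
    proof
      fix q assume "q \<in> ?Q - {q\<in>?Q. inj_on q {..<n}}"
      then obtain i i' where "i < n" "i' < n" "i \<noteq> i'" "q i = q i'"
        by (auto simp: inj_on_def)
      then have "fdet n (\<lambda>i j. g j (q i)) = 0"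
        by (intro fdet_identical_rows[of i n i']) auto
      then show "?F q = 0" by simp
    qed
  qed auto
  also have "\<dots> = (\<Sum>x\<in>?X. ?F (?h x))"
  proof (rule sum.reindex_bij_betw[symmetric])
    show "bij_betw ?h ?X {q\<in>?Q. inj_on q {..<n}}"
      unfolding bij_betw_def
    proof
      show "inj_on ?h ?X"
      proof (rule inj_onI, clarify)
        fix S p S' p'
        assume S: "S \<subseteq> G" "card S' = card S" "n = card S" "S' \<subseteq> G"
          and p: "p permutes {..<card S}" "p' permutes {..<card S}"
          and eq: "restrict (nth_elem S \<circ> p) {..<card S} = restrict (nth_elem S' \<circ> p') {..<card S}"
        have eq': "nth_elem S (p i) = nth_elem S' (p' i)" if "i < card S" for i
          using fun_cong[OF eq, of i] that by simp
        have b: "bij_betw (nth_elem S) {..<card S} S" "bij_betw (nth_elem S') {..<card S} S'"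
          using bS[of S] bS[of S'] S by auto
        have "S = (nth_elem S \<circ> p) ` {..<card S}"
          using bij_betw_trans[OF permutes_imp_bij[OF p(1)] b(1)] by (simp add: bij_betw_def)
        also have "\<dots> = (nth_elem S' \<circ> p') ` {..<card S}"
          using eq' by (intro image_cong) auto
        also have "\<dots> = S'"
          using bij_betw_trans[OF permutes_imp_bij[OF p(2)] b(2)] by (simp add: bij_betw_def)
        finally have SS: "S = S'" .
        have "p i = p' i" for i
        proof (cases "i < card S")
          case True
          then show ?thesis
            using eq'[OF True] b(1) permutes_in_image[OF p(1), of i] permutes_in_image[OF p(2), of i]
            unfolding SS[symmetric] bij_betw_def by (auto dest: inj_onD)
        next
          case False
          then show ?thesis using p by (simp add: permutes_def)
        qed
        then show "S = S' \<and> p = p'" using SS by auto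
      qed
      show "?h ` ?X = {q\<in>?Q. inj_on q {..<n}}"
      proof (intro equalityI subsetI)
        fix q assume "q \<in> ?h ` ?X"
        then obtain S p where S: "S \<subseteq> G" "card S = n" "p permutes {..<n}"
          and q: "q = restrict (nth_elem S \<circ> p) {..<n}" by auto
        have b: "bij_betw (nth_elem S \<circ> p) {..<n} S"
          using bij_betw_trans[OF permutes_imp_bij[OF S(3)] bS[OF S(1,2)]] .
        then have "nth_elem S (p i) \<in> S" if "i < n" for i
          using bij_betwE[OF b] that by simp
        then show "q \<in> {q\<in>?Q. inj_on q {..<n}}"
          using S(1) bij_betw_imp_inj_on[OF b] by (auto simp: q inj_on_def)
      next
        fix q assume "q \<in> {q\<in>?Q. inj_on q {..<n}}"
        then have q: "q \<in> ?Q" "inj_on q {..<n}" by auto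
        define S where "S = q ` {..<n}"
        have S: "S \<subseteq> G" "card S = n"
          using q by (auto simp: S_def card_image)
        define p where "p i = (if i < n then inv_into {..<n} (nth_elem S) (q i) else i)" for i
        have b: "bij_betw (nth_elem S) {..<n} S" by (rule bS[OF S])
        have "bij_betw (inv_into {..<n} (nth_elem S) \<circ> q) {..<n} {..<n}"
          using bij_betw_trans[OF _ bij_betw_inv_into[OF b], of q "{..<n}"] q(2)
          by (simp add: bij_betw_def S_def)
        then have "bij_betw p {..<n} {..<n}"
          by (rule iffD1[OF bij_betw_cong, rotated]) (simp add: p_def)
        then have "p permutes {..<n}"
          by (rule bij_imp_permutes) (simp add: p_def)
        moreover have "q = ?h (S, p)"
        proof
          fix i show "q i = ?h (S, p) i"
          proof (cases "i < n")
            case True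
            then have "q i \<in> S" by (simp add: S_def)
            then have "q i \<in> nth_elem S ` {..<n}" using b by (simp add: bij_betw_def)
            then show ?thesis using True by (simp add: p_def f_inv_into_f)
          next
            case False
            then show ?thesis by (simp add: PiE_arb[OF q(1)])
          qed
        qed
        ultimately show "q \<in> ?h ` ?X"
          using S by (intro image_eqI[of _ _ "(S, p)"]) simp_all
      qed
    qed
  qed
  also have "\<dots> = (\<Sum>S | S \<subseteq> G \<and> card S = n. \<Sum>p | p permutes {..<n}. ?F (?h (S, p)))"
    unfolding sum.cartesian_product by (rule sum.cong[OF refl]) clarify
  also have "\<dots> = (\<Sum>S | S \<subseteq> G \<and> card S = n. (\<Prod>x\<in>S. w x)
           * (fdet n (\<lambda>i j. f j (nth_elem S i)) * fdet n (\<lambda>i j. g j (nth_elem S i))))"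
  proof (rule sum.cong[OF refl])
    fix S assume "S \<in> {S. S \<subseteq> G \<and> card S = n}"
    then have S: "S \<subseteq> G" "card S = n" by auto
    have "?F (?h (S, p)) = (\<Prod>x\<in>S. w x) * fdet n (\<lambda>i j. g j (nth_elem S i))
        * (signof p * (\<Prod>i<n. f i (nth_elem S (p i))))" if p: "p permutes {..<n}" for p
    proof -
      have "(\<Prod>i<n. w (nth_elem S (p i))) = (\<Prod>x\<in>S. w x)"
        using prod.reindex_bij_betw[OF bij_betw_trans[OF permutes_imp_bij[OF p] bS], of S w] S
        by simp
      moreover have "fdet n (\<lambda>i j. g j (?h (S, p) i)) = signof p * fdet n (\<lambda>i j. g j (nth_elem S i))"
        by (subst fdet_permute_rows[OF p, of "\<lambda>i j. g j (nth_elem S i)", symmetric])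
           (rule fdet_cong, simp)
      ultimately show ?thesis by (simp add: prod.distrib mult_ac)
    qed
    then have "(\<Sum>p | p permutes {..<n}. ?F (?h (S, p)))
        = (\<Prod>x\<in>S. w x) * fdet n (\<lambda>i j. g j (nth_elem S i)) * fdet n (\<lambda>i j. f i (nth_elem S j))"
      by (simp add: fdet_leibniz[of n "\<lambda>i j. f i (nth_elem S j)"] sum_distrib_left)
    then show "(\<Sum>p | p permutes {..<n}. ?F (?h (S, p)))
      = (\<Prod>x\<in>S. w x) * (fdet n (\<lambda>i j. f j (nth_elem S i)) * fdet n (\<lambda>i j. g j (nth_elem S i)))"
      unfolding fdet_transpose[of n "\<lambda>i j. f j (nth_elem S i)"] by (simp only: mult_ac)
  qed
  finally show ?thesis by (rule sym)
qed

section \<open>Tilings\<close>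

text \<open>The sum of the first coordinates is 1 modulo 3 for an up-pointing and 2 for a
  down-pointing triangle, and the two sums determine the base vertex. So triangles are told apart
  without comparing vertex sets.\<close>

lemma fst_sum_faces:
  "(\<Sum>v\<in>up_face i k. fst v) = 3 * i + 1" "(\<Sum>v\<in>up_face i k. snd v) = 3 * k + 1"
  "(\<Sum>v\<in>down_face i k. fst v) = 3 * i + 2" "(\<Sum>v\<in>down_face i k. snd v) = 3 * k - 1"
  by (simp_all add: up_face_def down_face_def)

lemma up_face_eq_iff [simp]: "up_face i k = up_face j l \<longleftrightarrow> i = j \<and> k = l"
  using fst_sum_faces(1,2)[of i k] fst_sum_faces(1,2)[of j l] by auto

lemma down_face_eq_iff [simp]: "down_face i k = down_face j l \<longleftrightarrow> i = j \<and> k = l"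
  using fst_sum_faces(3,4)[of i k] fst_sum_faces(3,4)[of j l] by auto

lemma up_face_neq_down_face [simp]:
  "up_face i k \<noteq> down_face j l" "down_face j l \<noteq> up_face i k"
proof -
  have "3 * i + 1 \<noteq> 3 * j + 2" by presburger
  then show "up_face i k \<noteq> down_face j l"
    using fst_sum_faces(1)[of i k] fst_sum_faces(3)[of j l] by metis
  then show "down_face j l \<noteq> up_face i k" by simp
qed

lemma card_Int_triple:
  assumes "a \<noteq> b" "a \<noteq> c" "b \<noteq> c"
  shows "card ({a, b, c} \<inter> g) = of_bool (a \<in> g) + of_bool (b \<in> g) + of_bool (c \<in> g)"
  using assms by (auto simp: Int_insert_left)

lemma card_up_up: "card (up_face i k \<inter> up_face j l) = 2 \<longleftrightarrow> False"
  unfolding up_face_def by (subst card_Int_triple) (auto simp: of_bool_def)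

lemma card_down_down: "card (down_face i k \<inter> down_face j l) = 2 \<longleftrightarrow> False"
  unfolding down_face_def by (subst card_Int_triple) (auto simp: of_bool_def)

lemma card_up_down:
  "card (up_face i k \<inter> down_face j l) = 2 \<longleftrightarrow>
     (j = i \<and> l = k) \<or> (j = i \<and> l = k + 1) \<or> (j = i - 1 \<and> l = k + 1)"
  unfolding up_face_def down_face_def by (subst card_Int_triple) (auto simp: of_bool_def)

lemma unit_triangle_faces [simp]: "unit_triangle (up_face i k)" "unit_triangle (down_face i k)"
  unfolding unit_triangle_def by blast+

lemma unit_triangle_cases:
  assumes "unit_triangle f"
  obtains i k where "f = up_face i k" | i k where "f = down_face i k"
  using assms unfolding unit_triangle_def by blast

lemma lozenge_pair_iff:
  "lozenge {f, g} \<longleftrightarrow> unit_triangle f \<and> unit_triangle g \<and> f \<noteq> g \<and> card (f \<inter> g) = 2"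
proof
  assume "lozenge {f, g}"
  then obtain f' g' where *: "unit_triangle f'" "unit_triangle g'" "f' \<noteq> g'" "card (f' \<inter> g') = 2"
    and "{f, g} = {f', g'}"
    unfolding lozenge_def by (elim exE conjE) (rule that)
  then have "(f = f' \<and> g = g') \<or> (f = g' \<and> g = f')" by (auto simp: doubleton_eq_iff)
  then show "unit_triangle f \<and> unit_triangle g \<and> f \<noteq> g \<and> card (f \<inter> g) = 2"
    using * by (auto simp: Int_commute)
qed (auto simp: lozenge_def)

lemma lozenge_pairE:
  assumes "lozenge l"
  obtains f g where "l = {f, g}"
  using assms unfolding lozenge_def by (elim exE conjE) (rule that)

lemma lozenge_up_down:
  "lozenge {up_face i k, down_face j l} \<longleftrightarrow>
     (j = i \<and> l = k) \<or> (j = i \<and> l = k + 1) \<or> (j = i - 1 \<and> l = k + 1)"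
  by (simp add: lozenge_pair_iff card_up_down)

lemma lozenge_down_up:
  "lozenge {down_face j l, up_face i k} \<longleftrightarrow>
     (j = i \<and> l = k) \<or> (j = i \<and> l = k + 1) \<or> (j = i - 1 \<and> l = k + 1)"
  using lozenge_up_down[of i k j l] by (simp only: insert_commute)

lemma not_lozenge_same [simp]:
  "\<not> lozenge {up_face i k, up_face j l}" "\<not> lozenge {down_face i k, down_face j l}"
  by (simp_all add: lozenge_pair_iff card_up_up card_down_down)

lemma lozenge_cases:
  assumes "lozenge l"
  obtains i k j m where "l = {up_face i k, down_face j m}"
    "(j = i \<and> m = k) \<or> (j = i \<and> m = k + 1) \<or> (j = i - 1 \<and> m = k + 1)"
proof -
  obtain f g where l: "unit_triangle f" "unit_triangle g" "l = {f, g}"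
    using assms unfolding lozenge_def by (elim exE conjE) (rule that)
  then have l4: "lozenge {f, g}" using assms by simp
  show thesis
  proof (rule unit_triangle_cases[OF l(1)]; rule unit_triangle_cases[OF l(2)])
    fix i k j m assume "f = up_face i k" "g = down_face j m"
    then show thesis using that[of i k j m] l l4 lozenge_up_down by auto
  next
    fix i k j m assume "f = down_face i k" "g = up_face j m"
    then show thesis using that[of j m i k] l l4 lozenge_down_up by (auto simp: insert_commute)
  qed (use l4 in auto)
qed

lemma lozenge_obtain:
  assumes "lozenge l" "f \<in> l"
  obtains g where "l = {f, g}" "lozenge {f, g}" "f \<noteq> g"
  using assms unfolding lozenge_def
  by (smt (verit) insertE insert_commute lozenge_pair_iff Int_commute singletonD)

lemma lozenge_nonempty [simp]: "\<not> lozenge {}"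
  by (auto simp: lozenge_def)

section \<open>Decomposing tilings: images, cuts, expansion at a triangle, balance\<close>

lemma tilings_iff: "P \<in> tilings R \<longleftrightarrow> \<Union>P = R \<and> disjoint P \<and> (\<forall>l\<in>P. lozenge l)"
  unfolding tilings_def partition_on_def by (auto dest: bspec[of _ _ "{}"])

lemma finite_tilings: "finite R \<Longrightarrow> finite (tilings R)"
  by (rule finite_subset[of _ "Pow (Pow R)"]) (auto simp: tilings_iff)

lemma finite_tiling: "finite R \<Longrightarrow> P \<in> tilings R \<Longrightarrow> finite P"
  by (rule finite_subset[of _ "Pow R"]) (auto simp: tilings_iff)

lemma tilings_empty [simp]: "tilings {} = {{}}"
  unfolding tilings_def partition_on_empty by auto

lemma M_empty [simp]: "M w {} = 1"
  by (simp add: M_def)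

lemma tilings_Un:
  assumes "P \<in> tilings A" "P' \<in> tilings B" "A \<inter> B = {}"
  shows "P \<union> P' \<in> tilings (A \<union> B)"
  using assms unfolding tilings_iff by (auto intro: disjoint_union)

lemma tilings_subset:
  assumes "P \<in> tilings R" "P' \<subseteq> P"
  shows "P' \<in> tilings (\<Union>P')"
  using assms unfolding tilings_iff by (auto intro: pairwise_subset)

lemma tilings_Diff:
  assumes "P \<in> tilings R" "P' \<subseteq> P"
  shows "P - P' \<in> tilings (R - \<Union>P')"
proof -
  have "l = m" if "l \<in> P" "m \<in> P" "f \<in> l" "f \<in> m" for l m f
    using assms(1) that unfolding tilings_iff disjoint_def by blast
  then have "\<Union>(P - P') = R - \<Union>P'"
    using assms by (fastforce simp: tilings_iff)
  then show ?thesis using tilings_subset[OF assms(1), of "P - P'"] by auto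
qed

lemma tilings_singleton: "lozenge l \<Longrightarrow> {l} \<in> tilings l"
  by (simp add: tilings_iff)

lemma tilings_disjoint_blocks:
  assumes "P \<in> tilings A" "P' \<in> tilings B" "A \<inter> B = {}"
  shows "P \<inter> P' = {}"
proof (rule ccontr)
  assume "P \<inter> P' \<noteq> {}"
  then obtain l where "l \<in> P" "l \<in> P'" by blast
  then have "l \<subseteq> A" "l \<subseteq> B" "lozenge l" using assms by (auto simp: tilings_iff)
  then show False using assms(3) by (metis Int_greatest lozenge_nonempty subset_empty)
qed

text \<open>Transport along a bijection of triangles that respects lozenges. It serves for the
  reflection in \<ell>, which turns the lower half of the region into a trapezoid standing on
  \<ell>.\<close>

lemma M_image:
  assumes inj: "inj_on \<phi> R"
    and loz: "\<And>l. l \<subseteq> R \<Longrightarrow> lozenge (\<phi> ` l) \<longleftrightarrow> lozenge l"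
    and w: "\<And>l. lozenge l \<Longrightarrow> l \<subseteq> R \<Longrightarrow> w (\<phi> ` l) = w' l"
  shows "M w (\<phi> ` R) = M w' R"
proof -
  have inj2: "inj_on ((`) \<phi>) (Pow R)" using inj by (rule inj_on_image_Pow)
  have inj3: "inj_on ((`) ((`) \<phi>)) (Pow (Pow R))" using inj2 by (rule inj_on_image_Pow)
  have sub: "tilings R \<subseteq> Pow (Pow R)" by (auto simp: tilings_iff)
  have disj: "disjoint ((`) \<phi> ` P) \<longleftrightarrow> disjoint P" if "P \<subseteq> Pow R" for P
  proof
    assume "disjoint P"
    then show "disjoint ((`) \<phi> ` P)"
      using inj_on_subset[OF inj, of "\<Union>P"] that by (intro disjoint_image) auto
  next
    assume d: "disjoint ((`) \<phi> ` P)"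
    show "disjoint P"
    proof (rule disjointI)
      fix a b assume ab: "a \<in> P" "b \<in> P" "a \<noteq> b"
      then have "\<phi> ` a \<noteq> \<phi> ` b" using inj2 that by (auto dest: inj_onD)
      then have "\<phi> ` a \<inter> \<phi> ` b = {}" using d ab by (auto simp: disjoint_def)
      then show "a \<inter> b = {}" by blast
    qed
  qed
  have "tilings (\<phi> ` R) = (`) ((`) \<phi>) ` tilings R"
  proof (intro equalityI subsetI)
    fix P assume P: "P \<in> tilings (\<phi> ` R)"
    then have PR: "P \<subseteq> Pow (\<phi> ` R)" by (auto simp: tilings_iff)
    define P' where "P' = {l. l \<subseteq> R \<and> \<phi> ` l \<in> P}"
    have eq: "P = (`) \<phi> ` P'"
    proof (intro equalityI subsetI)
      fix l assume "l \<in> P"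
      then obtain l' where "l' \<subseteq> R" "l = \<phi> ` l'" using PR by (meson PowD subsetD subset_imageE)
      with \<open>l \<in> P\<close> show "l \<in> (`) \<phi> ` P'" by (auto simp: P'_def)
    qed (auto simp: P'_def)
    have sub': "P' \<subseteq> Pow R" by (auto simp: P'_def)
    have "\<phi> ` \<Union>P' = \<phi> ` R" using P eq by (auto simp: tilings_iff image_Union)
    then have "\<Union>P' = R" using inj sub' by (metis Sup_le_iff inj_on_image_eq_iff order_refl subsetD PowD)
    moreover have "disjoint P'" using disj[OF sub'] P eq by (auto simp: tilings_iff)
    moreover have "\<forall>l\<in>P'. lozenge l" using P loz by (auto simp: tilings_iff P'_def)
    ultimately have "P' \<in> tilings R" by (simp add: tilings_iff)
    then show "P \<in> (`) ((`) \<phi>) ` tilings R" using eq by blast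
  next
    fix P assume "P \<in> (`) ((`) \<phi>) ` tilings R"
    then obtain P' where P': "P' \<in> tilings R" "P = (`) \<phi> ` P'" by blast
    then have "P' \<subseteq> Pow R" by (auto simp: tilings_iff)
    then show "P \<in> tilings (\<phi> ` R)"
      using P' disj[of P'] loz by (auto simp: tilings_iff)
  qed
  then have "M w (\<phi> ` R) = (\<Sum>P\<in>tilings R. \<Prod>l\<in>(`) \<phi> ` P. w l)"
    unfolding M_def using inj_on_subset[OF inj3 sub] by (simp add: sum.reindex)
  also have "\<dots> = M w' R"
    unfolding M_def
  proof (rule sum.cong[OF refl])
    fix P assume P: "P \<in> tilings R"
    then have "P \<subseteq> Pow R" by (auto simp: tilings_iff)
    then have "inj_on ((`) \<phi>) P" using inj2 inj_on_subset by blast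
    then show "(\<Prod>l\<in>(`) \<phi> ` P. w l) = (\<Prod>l\<in>P. w' l)"
      using P w by (auto simp: prod.reindex tilings_iff intro!: prod.cong)
  qed
  finally show ?thesis .
qed

text \<open>Splitting a tiling along a curve: the lozenges crossing it are the \<open>{u e, d e}\<close> with \<open>e \<in> S\<close>.\<close>

lemma M_cut:
  assumes fin: "finite A" "finite B" and AB: "A \<inter> B = {}" and E: "finite E"
    and u: "inj_on u E" "u ` E \<subseteq> A" and d: "inj_on d E" "d ` E \<subseteq> B"
    and loz: "\<And>e. e \<in> E \<Longrightarrow> lozenge {u e, d e}"
    and cross: "\<And>f g. f \<in> A \<Longrightarrow> g \<in> B \<Longrightarrow> lozenge {f, g} \<Longrightarrow> \<exists>e\<in>E. f = u e \<and> g = d e"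
  shows "M w (A \<union> B) = (\<Sum>S\<in>Pow E. (\<Prod>e\<in>S. w {u e, d e}) * M w (A - u ` S) * M w (B - d ` S))"
proof -
  define c where "c e = {u e, d e}" for e
  have uA: "u e \<in> A" "u e \<notin> B" and dB: "d e \<in> B" "d e \<notin> A" if "e \<in> E" for e
    using that u(2) d(2) AB by auto
  have c_inj: "inj_on c E"
    by (rule inj_onI) (metis c_def doubleton_eq_iff dB(2) inj_onD uA(1) u(1))
  have c_tile: "c ` S \<in> tilings (u ` S \<union> d ` S)" if "S \<subseteq> E" for S
  proof -
    have "disjoint (c ` S)"
    proof (rule disjointI)
      fix a b assume "a \<in> c ` S" "b \<in> c ` S" "a \<noteq> b"
      then obtain e e' where "e \<in> E" "e' \<in> E" "e \<noteq> e'" "a = c e" "b = c e'"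
        using \<open>S \<subseteq> E\<close> by blast
      moreover have "u e \<noteq> u e'" "d e \<noteq> d e'" "u e \<noteq> d e'" "d e \<noteq> u e'"
        using calculation inj_onD[OF u(1), of e e'] inj_onD[OF d(1), of e e']
          uA[of e] uA[of e'] dB[of e] dB[of e'] by metis+
      ultimately show "a \<inter> b = {}" by (simp add: c_def)
    qed
    moreover have "\<Union>(c ` S) = u ` S \<union> d ` S" by (auto simp: c_def)
    moreover have "\<forall>l\<in>c ` S. lozenge l" using that loz by (auto simp: c_def)
    ultimately show ?thesis by (simp only: tilings_iff)
  qed
  let ?I = "SIGMA S:Pow E. tilings (A - u ` S) \<times> tilings (B - d ` S)"
  let ?W = "\<lambda>(S, P1, P2). (\<Prod>e\<in>S. w (c e)) * (\<Prod>l\<in>P1. w l) * (\<Prod>l\<in>P2. w l)"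
  \<comment> \<open>The three pieces can be read off from their union: a crossing lozenge lies
    neither in \<open>A\<close> nor in \<open>B\<close>, and no lozenge is empty.\<close>
  have sides: "{e\<in>E. c e \<in> P1 \<union> P2 \<union> c ` S} = S" "{l \<in> P1 \<union> P2 \<union> c ` S. l \<subseteq> A} = P1"
    "{l \<in> P1 \<union> P2 \<union> c ` S. l \<subseteq> B} = P2"
    if "S \<subseteq> E" "P1 \<in> tilings (A - u ` S)" "P2 \<in> tilings (B - d ` S)" for S P1 P2
  proof -
    have 1: "l \<subseteq> A \<and> l \<noteq> {}" if "l \<in> P1" for l
      using that \<open>P1 \<in> _\<close> by (auto simp: tilings_iff)
    have 2: "l \<subseteq> B \<and> l \<noteq> {}" if "l \<in> P2" for l
      using that \<open>P2 \<in> _\<close> by (auto simp: tilings_iff)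
    have 3: "\<not> c e \<subseteq> A" "\<not> c e \<subseteq> B" if "e \<in> E" for e
      using uA dB that by (auto simp: c_def)
    have 4: "e \<in> S" if "e \<in> E" "c e \<in> c ` S" for e
      using that c_inj \<open>S \<subseteq> E\<close> by (auto dest: inj_onD)
    show "{e\<in>E. c e \<in> P1 \<union> P2 \<union> c ` S} = S"
      using 1 2 3 4 \<open>S \<subseteq> E\<close> by blast
    show "{l \<in> P1 \<union> P2 \<union> c ` S. l \<subseteq> A} = P1"
      using 1 2 3 \<open>S \<subseteq> E\<close> AB by blast
    show "{l \<in> P1 \<union> P2 \<union> c ` S. l \<subseteq> B} = P2"
      using 1 2 3 \<open>S \<subseteq> E\<close> AB by blast
  qed
  have all: "l \<subseteq> A \<or> l \<subseteq> B \<or> (\<exists>e\<in>E. l = c e)" if P: "P \<in> tilings (A \<union> B)" and "l \<in> P" for P l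
  proof -
    have l: "lozenge l" "l \<subseteq> A \<union> B" using that by (auto simp: tilings_iff)
    obtain f g where fg: "l = {f, g}" by (rule lozenge_pairE[OF l(1)])
    then have "lozenge {f, g}" using l(1) by simp
    show ?thesis
      using cross[of f g] cross[of g f] fg l(2) \<open>lozenge {f, g}\<close>
      by (auto simp: c_def insert_commute)
  qed
  have "M w (A \<union> B) = (\<Sum>x\<in>?I. ?W x)"
    unfolding M_def
  proof (rule sum.reindex_bij_witness[symmetric, where
        j = "\<lambda>(S, P1, P2). P1 \<union> P2 \<union> c ` S" and
        i = "\<lambda>P. ({e\<in>E. c e \<in> P}, {l\<in>P. l \<subseteq> A}, {l\<in>P. l \<subseteq> B})"], goal_cases)
    case (1 x)
    then obtain S P1 P2 where x: "x = (S, P1, P2)" "S \<subseteq> E" "P1 \<in> tilings (A - u ` S)" "P2 \<in> tilings (B - d ` S)"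
      by auto
    then show ?case by (simp only: prod.case sides[OF x(2-4)])
  next
    case (2 x)
    then obtain S P1 P2 where x: "x = (S, P1, P2)" "S \<subseteq> E" "P1 \<in> tilings (A - u ` S)" "P2 \<in> tilings (B - d ` S)"
      by auto
    have "P1 \<union> P2 \<union> c ` S \<in> tilings ((A - u ` S) \<union> (B - d ` S) \<union> (u ` S \<union> d ` S))"
      using x uA dB AB by (intro tilings_Un c_tile) auto
    also have "(A - u ` S) \<union> (B - d ` S) \<union> (u ` S \<union> d ` S) = A \<union> B"
      using u d x(2) by blast
    finally show ?case using x by simp
  next
    case (3 P)
    then show ?case using all[OF 3] by auto
  next
    case (4 P)
    let ?S = "{e\<in>E. c e \<in> P}"
    have UP: "\<Union>P = A \<union> B" and dP: "disjoint P" using 4 by (auto simp: tilings_iff)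
    have nA: "u e \<notin> l" "d e \<notin> l" if "l \<in> P" "e \<in> ?S" "l \<subseteq> A \<or> l \<subseteq> B" for l e
    proof -
      have "l \<noteq> c e" using that uA dB by (auto simp: c_def)
      then have "l \<inter> c e = {}" using dP that by (auto simp: disjoint_def)
      then show "u e \<notin> l" "d e \<notin> l" by (auto simp: c_def)
    qed
    have "\<Union>{l\<in>P. l \<subseteq> A} = A - u ` ?S"
    proof (intro equalityI subsetI)
      fix f assume f: "f \<in> A - u ` ?S"
      then obtain l where l: "l \<in> P" "f \<in> l" using UP by blast
      have "\<not> l \<subseteq> B" using f l AB by blast
      moreover have "l \<noteq> c e" if "e \<in> E" for e
        using that f l dB[of e] by (auto simp: c_def)
      ultimately show "f \<in> \<Union>{l\<in>P. l \<subseteq> A}" using all[OF 4 l(1)] l by blast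
    qed (use nA in blast)
    moreover have "\<Union>{l\<in>P. l \<subseteq> B} = B - d ` ?S"
    proof (intro equalityI subsetI)
      fix f assume f: "f \<in> B - d ` ?S"
      then obtain l where l: "l \<in> P" "f \<in> l" using UP by blast
      have "\<not> l \<subseteq> A" using f l AB by blast
      moreover have "l \<noteq> c e" if "e \<in> E" for e
        using that f l uA[of e] by (auto simp: c_def)
      ultimately show "f \<in> \<Union>{l\<in>P. l \<subseteq> B}" using all[OF 4 l(1)] l by blast
    qed (use nA in blast)
    ultimately show ?case
      using tilings_subset[OF 4, of "{l\<in>P. l \<subseteq> A}"] tilings_subset[OF 4, of "{l\<in>P. l \<subseteq> B}"]
      by auto
  next
    case (5 x)
    then obtain S P1 P2 where x: "x = (S, P1, P2)" "S \<subseteq> E" "P1 \<in> tilings (A - u ` S)" "P2 \<in> tilings (B - d ` S)"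
      by auto
    have f: "finite P1" "finite P2" "finite S"
      using x fin E by (auto intro: finite_tiling[of "A - u ` S"] finite_tiling[of "B - d ` S"] finite_subset)
    have "P1 \<inter> P2 = {}" using x AB by (intro tilings_disjoint_blocks[of _ "A - u ` S" _ "B - d ` S"]) auto
    moreover have "(P1 \<union> P2) \<inter> c ` S = {}"
    proof -
      have "P1 \<union> P2 \<in> tilings ((A - u ` S) \<union> (B - d ` S))" using x AB by (intro tilings_Un) auto
      then show ?thesis
        using x(2) uA dB by (intro tilings_disjoint_blocks[OF _ c_tile]) auto
    qed
    moreover have "(\<Prod>l\<in>c ` S. w l) = (\<Prod>e\<in>S. w (c e))"
      using inj_on_subset[OF c_inj x(2)] by (simp add: prod.reindex)
    ultimately show ?case using f x(1) by (simp add: prod.union_disjoint mult_ac)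
  qed
  also have "\<dots> = (\<Sum>S\<in>Pow E. \<Sum>y\<in>tilings (A - u ` S) \<times> tilings (B - d ` S). ?W (S, y))"
    using E fin by (subst sum.Sigma) (auto intro: finite_tilings)
  also have "\<dots> = (\<Sum>S\<in>Pow E. (\<Prod>e\<in>S. w {u e, d e}) * M w (A - u ` S) * M w (B - d ` S))"
  proof (intro sum.cong refl)
    have "(\<Sum>(P1, P2)\<in>X \<times> Y. r * F P1 * G P2) = r * sum F X * sum G Y"
      for r :: real and F G :: "face set set \<Rightarrow> real" and X Y
      by (simp add: sum.cartesian_product[symmetric] sum_distrib_left[symmetric] sum_distrib_right[symmetric])
    then show "(\<Sum>y\<in>tilings (A - u ` S) \<times> tilings (B - d ` S). ?W (S, y))
        = (\<Prod>e\<in>S. w {u e, d e}) * M w (A - u ` S) * M w (B - d ` S)" for S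
      unfolding M_def c_def by (simp add: case_prod_unfold)
  qed
  finally show ?thesis .
qed

text \<open>Tilings are sorted by the partner \<open>g\<close> of the triangle \<open>f\<close>;
  deleting their lozenge leaves an arbitrary tiling of the rest.\<close>

lemma M_expand:
  assumes R: "finite R" and f: "f \<in> R"
  shows "M w R = (\<Sum>g | g \<in> R \<and> lozenge {f, g}. w {f, g} * M w (R - {f, g}))"
proof -
  let ?N = "{g. g \<in> R \<and> lozenge {f, g}}"
  let ?I = "SIGMA g:?N. tilings (R - {f, g})"
  have fresh: "{f, g} \<notin> P" if "P \<in> tilings (R - {f, g})" for g P
  proof
    assume "{f, g} \<in> P"
    then have "f \<in> \<Union>P" by blast
    moreover have "\<Union>P = R - {f, g}" using that by (simp add: tilings_iff)
    ultimately show False by blast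
  qed
  have bij: "bij_betw (\<lambda>(g, P). insert {f, g} P) ?I (tilings R)"
      unfolding bij_betw_def
    proof
      show "inj_on (\<lambda>(g, P). insert {f, g} P) ?I"
      proof (rule inj_onI, clarify)
        fix g P g' P'
        assume P: "P \<in> tilings (R - {f, g})" "P' \<in> tilings (R - {f, g'})"
          and loz: "lozenge {f, g}" "lozenge {f, g'}"
          and eq: "insert {f, g} P = insert {f, g'} P'"
        have "f \<notin> \<Union>P'" using P by (simp add: tilings_iff)
        then have "{f, g} = {f, g'}" using eq by (metis UnionI insertE insertI1)
        then have gg: "g = g'" by (metis doubleton_eq_iff)
        have "{f, g} \<notin> P" "{f, g} \<notin> P'" using fresh P gg by simp_all
        then have "P = P'" using eq gg by (metis insert_ident)
        then show "g = g' \<and> P = P'" using gg by simp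
      qed
      show "(\<lambda>(g, P). insert {f, g} P) ` ?I = tilings R"
      proof (intro equalityI subsetI)
        fix P assume "P \<in> (\<lambda>(g, P). insert {f, g} P) ` ?I"
        then obtain g P' where P: "g \<in> R" "lozenge {f, g}" "P' \<in> tilings (R - {f, g})" "P = insert {f, g} P'"
          by auto
        have "{{f, g}} \<union> P' \<in> tilings ({f, g} \<union> (R - {f, g}))"
          using P by (intro tilings_Un tilings_singleton) auto
        moreover have "{f, g} \<union> (R - {f, g}) = R" using f P(1) by auto
        ultimately show "P \<in> tilings R" using P(4) by simp
      next
        fix P assume P: "P \<in> tilings R"
        then obtain l where l: "l \<in> P" "f \<in> l" using f by (auto simp: tilings_iff)
        then obtain g where g: "l = {f, g}" "lozenge {f, g}"
          using P lozenge_obtain[of l f] by (auto simp: tilings_iff)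
        have "g \<in> R" using P l g by (auto simp: tilings_iff)
        moreover have "P - {l} \<in> tilings (R - {f, g})"
          using tilings_Diff[OF P, of "{l}"] l g by simp
        moreover have "P = insert {f, g} (P - {l})" using l(1) g(1) by (simp add: insert_absorb)
        ultimately show "P \<in> (\<lambda>(g, P). insert {f, g} P) ` ?I"
          using g(2) by (intro image_eqI[of _ _ "(g, P - {l})"]) simp_all
      qed
    qed
  have "M w R = (\<Sum>x\<in>?I. \<Prod>l\<in>(case x of (g, P) \<Rightarrow> insert {f, g} P). w l)"
    unfolding M_def by (rule sum.reindex_bij_betw[OF bij, symmetric])
  also have "\<dots> = (\<Sum>(g, P)\<in>?I. w {f, g} * (\<Prod>l\<in>P. w l))"
  proof (rule sum.cong[OF refl])
    fix x assume "x \<in> ?I"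
    then obtain g P where "x = (g, P)" "P \<in> tilings (R - {f, g})" by auto
    then show "(\<Prod>l\<in>(case x of (g, P) \<Rightarrow> insert {f, g} P). w l) = (case x of (g, P) \<Rightarrow> w {f, g} * (\<Prod>l\<in>P. w l))"
      using fresh[of P g] finite_tiling[of "R - {f, g}" P] R by simp
  qed
  also have "\<dots> = (\<Sum>g\<in>?N. \<Sum>P\<in>tilings (R - {f, g}). w {f, g} * (\<Prod>l\<in>P. w l))"
    using R by (subst sum.Sigma) (auto intro: finite_tilings)
  also have "\<dots> = (\<Sum>g\<in>?N. w {f, g} * M w (R - {f, g}))"
    by (simp add: M_def sum_distrib_left)
  finally show ?thesis .
qed

lemma M_forced:
  assumes "finite R" "f \<in> R" "g \<in> R" "lozenge {f, g}"
    and "\<And>h. h \<in> R \<Longrightarrow> lozenge {f, h} \<Longrightarrow> h = g"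
  shows "M w R = w {f, g} * M w (R - {f, g})"
proof -
  have "{h. h \<in> R \<and> lozenge {f, h}} = {g}" using assms by blast
  then show ?thesis using M_expand[OF assms(1,2), of w] by simp
qed

text \<open>Every lozenge covers one triangle of each orientation. The use is contrapositive: an
  unbalanced region has \<open>M\<close> equal to 0, which fixes how many lozenges cross
  \<ell>.\<close>

lemma M_balanced:
  assumes R: "finite R" and M: "M w R \<noteq> 0"
  shows "card {f \<in> R. \<exists>i k. f = up_face i k} = card {f \<in> R. \<exists>i k. f = down_face i k}"
proof -
  obtain P where P: "P \<in> tilings R"
    using M unfolding M_def by (metis (no_types, lifting) sum.empty equals0I)
  have fP: "finite P" using finite_tiling[OF R P] .
  have pick: "{f \<in> {x, y}. Q f} = {x}" if "Q x" "\<not> Q y" for Q and x y :: face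
    using that by auto
  have *: "card {f \<in> R. Q f} = card P" if one: "\<And>l. lozenge l \<Longrightarrow> card {f \<in> l. Q f} = 1" for Q
  proof -
    have eq: "{f \<in> R. Q f} = (\<Union>l\<in>P. {f \<in> l. Q f})" using P by (auto simp: tilings_iff)
    have "card {f \<in> R. Q f} = (\<Sum>l\<in>P. card {f \<in> l. Q f})"
      unfolding eq
    proof (rule card_UN_disjoint[OF fP])
      show "\<forall>l\<in>P. finite {f \<in> l. Q f}"
        using P R by (auto simp: tilings_iff intro!: finite_subset[OF _ R])
      show "\<forall>l\<in>P. \<forall>l'\<in>P. l \<noteq> l' \<longrightarrow> {f \<in> l. Q f} \<inter> {f \<in> l'. Q f} = {}"
        using P by (auto simp: tilings_iff disjoint_def)
    qed
    also have "\<dots> = card P" using P one by (simp add: tilings_iff)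
    finally show ?thesis .
  qed
  have "card {f \<in> l. \<exists>i k. f = up_face i k} = 1" if "lozenge l" for l
    using that
  proof (rule lozenge_cases)
    fix i k j m assume "l = {up_face i k, down_face j m}"
    then have "{f \<in> l. \<exists>i k. f = up_face i k} = {up_face i k}"
      using pick[of "\<lambda>f. \<exists>i k. f = up_face i k" "up_face i k" "down_face j m"] by simp
    then show ?thesis by simp
  qed
  moreover have "card {f \<in> l. \<exists>i k. f = down_face i k} = 1" if "lozenge l" for l
    using that
  proof (rule lozenge_cases)
    fix i k j m assume "l = {up_face i k, down_face j m}"
    then have "{f \<in> l. \<exists>i k. f = down_face i k} = {down_face j m}"
      using pick[of "\<lambda>f. \<exists>i k. f = down_face i k" "down_face j m" "up_face i k"]
      by (simp add: insert_commute)
    then show ?thesis by simp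
  qed
  ultimately show ?thesis using * by simp
qed

section \<open>Strips\<close>

text \<open>The pairs here lie within one horizontal strip. Thus only vertical lozenges, which join
  two strips, may carry a weight.\<close>

definition flat_weight :: "(face set \<Rightarrow> real) \<Rightarrow> bool" where
  "flat_weight w \<longleftrightarrow> (\<forall>i j k. w {up_face i k, down_face j (k + 1)} = 1)"

lemma flatD: "flat_weight w \<Longrightarrow> w {up_face i k, down_face j (k + 1)} = 1"
  by (simp add: flat_weight_def)

lemma flatD': "flat_weight w \<Longrightarrow> w {down_face j (k + 1), up_face i k} = 1"
  by (simp add: flat_weight_def insert_commute)

lemma vertical_lozenge_alt: "vertical_lozenge i k = {down_face i k, up_face i k}"
  by (auto simp: vertical_lozenge_def)

lemma lozenge_down_iff: "lozenge {down_face j l, g} \<longleftrightarrow> g \<in> {up_face j l, up_face j (l - 1), up_face (j + 1) (l - 1)}"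
proof (cases "unit_triangle g")
  case True
  then show ?thesis
    by (rule unit_triangle_cases) (auto simp: lozenge_down_up)
next
  case False
  then show ?thesis by (auto simp: lozenge_pair_iff)
qed

lemma lozenge_up_iff: "lozenge {up_face i k, g} \<longleftrightarrow> g \<in> {down_face i k, down_face i (k + 1), down_face (i - 1) (k + 1)}"
proof (cases "unit_triangle g")
  case True
  then show ?thesis
    by (rule unit_triangle_cases) (auto simp: lozenge_up_down)
next
  case False
  then show ?thesis by (auto simp: lozenge_pair_iff)
qed

lemma M_expand_down:
  fixes w :: "face set \<Rightarrow> real"
  assumes R: "finite R" and f: "down_face i k \<in> R"
  defines "t \<equiv> \<lambda>g. if g \<in> R then w {down_face i k, g} * M w (R - {down_face i k, g}) else 0"
  shows "M w R = t (up_face i k) + t (up_face i (k - 1)) + t (up_face (i + 1) (k - 1))"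
proof -
  let ?N = "{up_face i k, up_face i (k - 1), up_face (i + 1) (k - 1)}"
  have "M w R = (\<Sum>g | g \<in> R \<and> lozenge {down_face i k, g}. t g)"
    unfolding M_expand[OF R f] t_def by (intro sum.cong) auto
  also have "\<dots> = (\<Sum>g\<in>?N. t g)"
    by (rule sum.mono_neutral_left) (auto simp: lozenge_down_iff t_def)
  also have "\<dots> = t (up_face i k) + t (up_face i (k - 1)) + t (up_face (i + 1) (k - 1))"
    by simp
  finally show ?thesis .
qed

text \<open>A chain of forced lozenges: the triangle \<open>up_face l k\<close> has neither a
  western nor a lower neighbour left, so it takes its eastern one, which puts the next up-pointing
  triangle into the same position.\<close>

lemma M_strip_left:
  assumes "finite R" "flat_weight w" "l \<le> r"
    and "\<And>i. l \<le> i \<Longrightarrow> i < r \<Longrightarrow> up_face i k \<in> R"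
    and "\<And>i. l \<le> i \<Longrightarrow> i < r \<Longrightarrow> down_face i (k + 1) \<in> R"
    and "down_face (l - 1) (k + 1) \<notin> R"
    and "\<And>i. l \<le> i \<Longrightarrow> i < r \<Longrightarrow> down_face i k \<notin> R"
  shows "M w R = M w (R - ((\<lambda>i. up_face i k) ` {l..<r} \<union> (\<lambda>i. down_face i (k + 1)) ` {l..<r}))"
  using assms
proof (induction "nat (r - l)" arbitrary: l R)
  case 0
  then show ?case by simp
next
  case (Suc n)
  then have lr: "l < r" by simp
  let ?R = "R - {up_face l k, down_face l (k + 1)}"
  have "M w R = w {up_face l k, down_face l (k + 1)} * M w ?R"
    by (rule M_forced) (use Suc.prems lr in \<open>auto simp: lozenge_up_iff\<close>)
  also have "\<dots> = M w ?R" using Suc.prems(2) by (simp add: flatD)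
  also have "\<dots> = M w (?R - ((\<lambda>i. up_face i k) ` {l + 1..<r} \<union> (\<lambda>i. down_face i (k + 1)) ` {l + 1..<r}))"
    by (rule Suc.hyps(1)) (use Suc.prems Suc.hyps(2) lr in auto)
  also have "{l..<r} = insert l {l + 1..<r}" using lr by auto
  then have "?R - ((\<lambda>i. up_face i k) ` {l + 1..<r} \<union> (\<lambda>i. down_face i (k + 1)) ` {l + 1..<r})
      = R - ((\<lambda>i. up_face i k) ` {l..<r} \<union> (\<lambda>i. down_face i (k + 1)) ` {l..<r})" by auto
  finally show ?case .
qed

lemma M_strip_right:
  assumes "finite R" "flat_weight w" "l \<le> r"
    and "\<And>i. l < i \<Longrightarrow> i \<le> r \<Longrightarrow> up_face i k \<in> R"
    and "\<And>i. l \<le> i \<Longrightarrow> i < r \<Longrightarrow> down_face i (k + 1) \<in> R"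
    and "down_face r (k + 1) \<notin> R"
    and "\<And>i. l < i \<Longrightarrow> i \<le> r \<Longrightarrow> down_face i k \<notin> R"
  shows "M w R = M w (R - ((\<lambda>i. up_face i k) ` {l<..r} \<union> (\<lambda>i. down_face i (k + 1)) ` {l..<r}))"
  using assms
proof (induction "nat (r - l)" arbitrary: r R)
  case 0
  then show ?case by simp
next
  case (Suc n)
  then have lr: "l < r" by simp
  let ?R = "R - {up_face r k, down_face (r - 1) (k + 1)}"
  have "M w R = w {up_face r k, down_face (r - 1) (k + 1)} * M w ?R"
    by (rule M_forced) (use Suc.prems lr in \<open>auto simp: lozenge_up_iff\<close>)
  also have "\<dots> = M w ?R" using Suc.prems(2) by (simp add: flatD)
  also have "\<dots> = M w (?R - ((\<lambda>i. up_face i k) ` {l<..r - 1} \<union> (\<lambda>i. down_face i (k + 1)) ` {l..<r - 1}))"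
    by (rule Suc.hyps(1)) (use Suc.prems Suc.hyps(2) lr in auto)
  also have "{l<..r} = insert r {l<..r - 1}" "{l..<r} = insert (r - 1) {l..<r - 1}" using lr by auto
  then have "?R - ((\<lambda>i. up_face i k) ` {l<..r - 1} \<union> (\<lambda>i. down_face i (k + 1)) ` {l..<r - 1})
      = R - ((\<lambda>i. up_face i k) ` {l<..r} \<union> (\<lambda>i. down_face i (k + 1)) ` {l..<r})" by auto
  finally show ?case .
qed

text \<open>Between two dents exactly one down-pointing triangle of the strip is matched upwards.\<close>

lemma M_segment:
  assumes "finite R" "flat_weight w" "l < r"
    and "\<And>i. l < i \<Longrightarrow> i < r \<Longrightarrow> up_face i k \<in> R"
    and "\<And>i. l \<le> i \<Longrightarrow> i < r \<Longrightarrow> down_face i (k + 1) \<in> R"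
    and "up_face l k \<notin> R" "up_face r k \<notin> R"
    and "\<And>i. l < i \<Longrightarrow> i < r \<Longrightarrow> down_face i k \<notin> R"
  shows "M w R = (\<Sum>i\<in>{l..<r}. if up_face i (k + 1) \<in> R
      then w (vertical_lozenge i (k + 1)) * M w (R - ((\<lambda>i. up_face i k) ` {l<..<r}
        \<union> (\<lambda>i. down_face i (k + 1)) ` {l..<r}) - {up_face i (k + 1)}) else 0)"
  using assms
proof (induction "nat (r - l)" arbitrary: l R)
  case 0
  then show ?case by simp
next
  case (Suc n)
  let ?D = "\<lambda>l. (\<lambda>i. up_face i k) ` {l<..<r} \<union> (\<lambda>i. down_face i (k + 1)) ` {l..<r}"
  let ?s = "\<lambda>l R i. if up_face i (k + 1) \<in> R
      then w (vertical_lozenge i (k + 1)) * M w (R - ?D l - {up_face i (k + 1)}) else 0"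
  let ?u = "up_face l (k + 1)" and ?d = "down_face l (k + 1)" and ?v = "up_face (l + 1) k"
  have lr: "{l..<r} = insert l {l + 1..<r}" using Suc.prems(3) by auto
  have lr': "{l<..<r} = {l + 1..<r}" by auto
  \<comment> \<open>Expansion at the westernmost down-pointing triangle of the strip. If it is
    matched upwards, the rest of the strip is forced; if it takes \<open>?v\<close>, then
    \<open>l + 1\<close> acts as the new western dent and the segment is shorter.\<close>
  have "M w R = (if ?u \<in> R then w {?d, ?u} * M w (R - {?d, ?u}) else 0)
      + (if ?v \<in> R then w {?d, ?v} * M w (R - {?d, ?v}) else 0)"
    using M_expand_down[of R l "k + 1" w] Suc.prems by simp
  also have "(if ?u \<in> R then w {?d, ?u} * M w (R - {?d, ?u}) else 0) = ?s l R l"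
  proof (cases "?u \<in> R")
    case True
    have "M w (R - {?d, ?u}) = M w (R - {?d, ?u} - ((\<lambda>i. up_face i k) ` {l + 1..<r} \<union> (\<lambda>i. down_face i (k + 1)) ` {l + 1..<r}))"
      by (rule M_strip_left) (use Suc.prems in auto)
    also have "R - {?d, ?u} - ((\<lambda>i. up_face i k) ` {l + 1..<r} \<union> (\<lambda>i. down_face i (k + 1)) ` {l + 1..<r})
        = R - ?D l - {?u}"
      unfolding lr lr' by auto
    finally show ?thesis using True by (simp add: vertical_lozenge_alt)
  qed simp
  also have "(if ?v \<in> R then w {?d, ?v} * M w (R - {?d, ?v}) else 0) = (\<Sum>i\<in>{l + 1..<r}. ?s l R i)"
  proof (cases "l + 1 < r")
    case False
    then have "l + 1 = r" using Suc.prems(3) by simp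
    then show ?thesis using Suc.prems(7) by simp
  next
    case True
    have "M w (R - {?d, ?v}) = (\<Sum>i\<in>{l + 1..<r}. ?s (l + 1) (R - {?d, ?v}) i)"
      by (rule Suc.hyps(1)) (use Suc.prems Suc.hyps(2) True in auto)
    also have "\<dots> = (\<Sum>i\<in>{l + 1..<r}. ?s l R i)"
    proof (rule sum.cong[OF refl])
      fix i assume "i \<in> {l + 1..<r}"
      have "{l<..<r} = insert (l + 1) {l + 1<..<r}" using True by auto
      then have "R - {?d, ?v} - ?D (l + 1) = R - ?D l" unfolding lr by auto
      then show "?s (l + 1) (R - {?d, ?v}) i = ?s l R i" by simp
    qed
    finally show ?thesis
      using True Suc.prems(2,4) by (simp add: flatD')
  qed
  finally show ?case unfolding lr by simp
qed

lemma sum_PiE_insert: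
  assumes "x \<notin> A" "finite A" "\<And>a. a \<in> insert x A \<Longrightarrow> finite (I a)"
  shows "(\<Sum>q\<in>PiE (insert x A) I. F q) = (\<Sum>y\<in>I x. \<Sum>q\<in>PiE A I. F (q(x := y)))"
proof -
  have "(\<Sum>q\<in>PiE (insert x A) I. F q) = (\<Sum>z\<in>I x \<times> PiE A I. F (case z of (y, q) \<Rightarrow> q(x := y)))"
    unfolding PiE_insert_eq
    by (subst sum.reindex) (use inj_combinator[OF assms(1)] in auto)
  also have "\<dots> = (\<Sum>y\<in>I x. \<Sum>q\<in>PiE A I. F (q(x := y)))"
    by (simp add: sum.cartesian_product case_prod_unfold)
  finally show ?thesis .
qed

text \<open>Segments between consecutive dents do not interact, so each chooses its upward exit
  \<open>q s\<close> on its own. The exits are the dents of the next row, and \<open>PiE\<close>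
  expresses that they interlace with \<open>p\<close>.\<close>

lemma M_segments:
  assumes "finite R" "flat_weight w"
    and "\<And>s. s < n \<Longrightarrow> p s < p (Suc s)"
    and "\<And>i. p 0 < i \<Longrightarrow> i < p n \<Longrightarrow> i \<notin> p ` {..n} \<Longrightarrow> up_face i k \<in> R"
    and "\<And>i. p 0 \<le> i \<Longrightarrow> i < p n \<Longrightarrow> down_face i (k + 1) \<in> R"
    and "\<And>s. s \<le> n \<Longrightarrow> up_face (p s) k \<notin> R"
    and "\<And>i. p 0 \<le> i \<Longrightarrow> i < p n \<Longrightarrow> down_face i k \<notin> R"
    and "\<And>i. p 0 \<le> i \<Longrightarrow> i < p n \<Longrightarrow> up_face i (k + 1) \<in> R"
  shows "M w R = (\<Sum>q\<in>PiE {..<n} (\<lambda>s. {p s..<p (Suc s)}).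
      (\<Prod>s<n. w (vertical_lozenge (q s) (k + 1)))
      * M w (R - ((\<lambda>i. up_face i k) ` {p 0<..<p n} \<union> (\<lambda>i. down_face i (k + 1)) ` {p 0..<p n})
           - (\<lambda>s. up_face (q s) (k + 1)) ` {..<n}))"
  using assms
proof (induction n arbitrary: R)
  case 0
  then show ?case by simp
next
  case (Suc n)
  have mono: "p s \<le> p t" if "s \<le> t" "t \<le> Suc n" for s t
    using that
  proof (induction rule: dec_induct)
    case (step m)
    then show ?case using Suc.prems(3)[of m] by simp
  qed simp
  have p0n: "p 0 \<le> p n" "p n < p (Suc n)" using mono[of 0 n] Suc.prems(3)[of n] by simp_all
  let ?D = "\<lambda>l r. (\<lambda>i. up_face i k) ` {l<..<r} \<union> (\<lambda>i. down_face i (k + 1)) ` {l..<r}"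
  let ?I = "\<lambda>s. {p s..<p (Suc s)}"
  let ?w = "\<lambda>i. w (vertical_lozenge i (k + 1))"
  let ?R = "\<lambda>i. R - ?D (p n) (p (Suc n)) - {up_face i (k + 1)}"
  define F where "F q = (\<Prod>s<Suc n. ?w (q s))
      * M w (R - ?D (p 0) (p (Suc n)) - (\<lambda>s. up_face (q s) (k + 1)) ` {..<Suc n})" for q
  have gap: "i \<notin> p ` {..Suc n}" if "p n < i" "i < p (Suc n)" for i
  proof
    assume "i \<in> p ` {..Suc n}"
    then obtain s where "s \<le> Suc n" "i = p s" by auto
    then show False using that mono[of s n] by (cases "s = Suc n") auto
  qed
  have "M w R = (\<Sum>i\<in>?I n. if up_face i (k + 1) \<in> R then ?w i * M w (?R i) else 0)"
    by (rule M_segment) (use Suc.prems p0n gap in auto)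
  also have "\<dots> = (\<Sum>i\<in>?I n. ?w i * M w (?R i))"
    using p0n Suc.prems(8) by (intro sum.cong) auto
  also have "\<dots> = (\<Sum>i\<in>?I n. \<Sum>q\<in>PiE {..<n} ?I. (\<Prod>s<Suc n. ?w ((q(n := i)) s))
      * M w (R - ?D (p 0) (p (Suc n)) - (\<lambda>s. up_face ((q(n := i)) s) (k + 1)) ` {..<Suc n}))"
  proof (rule sum.cong[OF refl])
    fix i assume i: "i \<in> ?I n"
    have IH: "M w (?R i) = (\<Sum>q\<in>PiE {..<n} ?I. (\<Prod>s<n. ?w (q s))
        * M w (?R i - ?D (p 0) (p n) - (\<lambda>s. up_face (q s) (k + 1)) ` {..<n}))"
    proof (rule Suc.IH)
      fix j assume j: "p 0 < j" "j < p n" "j \<notin> p ` {..n}"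
      then have "j \<notin> p ` {..Suc n}" using p0n by (auto simp: atMost_Suc)
      then have "up_face j k \<in> R" using j p0n by (intro Suc.prems(4)) auto
      then show "up_face j k \<in> ?R i" using j by auto
    next
      fix s assume "s \<le> n"
      then show "up_face (p s) k \<notin> ?R i" using Suc.prems(6)[of s] by simp
    qed (use Suc.prems p0n i in auto)
    show "?w i * M w (?R i) = (\<Sum>q\<in>PiE {..<n} ?I. (\<Prod>s<Suc n. ?w ((q(n := i)) s))
      * M w (R - ?D (p 0) (p (Suc n)) - (\<lambda>s. up_face ((q(n := i)) s) (k + 1)) ` {..<Suc n}))"
      unfolding IH sum_distrib_left
    proof (rule sum.cong[OF refl])
      fix q
      \<comment> \<open>The open intervals of the two parts miss the inner dent \<open>p n\<close>,
        whose triangle is absent from \<open>R\<close> anyway. If \<open>p 0 = p n\<close>, there is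
        no inner dent.\<close>
      have D: "?D (p 0) (p (Suc n)) = ?D (p 0) (p n) \<union> ?D (p n) (p (Suc n)) \<union> (if p 0 < p n then {up_face (p n) k} else {})"
      proof -
        have "{p 0<..<p (Suc n)} = {p 0<..<p n} \<union> {p n<..<p (Suc n)} \<union> (if p 0 < p n then {p n} else {})"
          "{p 0..<p (Suc n)} = {p 0..<p n} \<union> {p n..<p (Suc n)}"
          using p0n by auto
        then show ?thesis by (auto split: if_splits)
      qed
      have U: "(\<lambda>s. up_face ((q(n := i)) s) (k + 1)) ` {..<Suc n}
          = insert (up_face i (k + 1)) ((\<lambda>s. up_face (q s) (k + 1)) ` {..<n})"
        by (auto simp: lessThan_Suc)
      have "R - ?D (p 0) (p (Suc n)) - (\<lambda>s. up_face ((q(n := i)) s) (k + 1)) ` {..<Suc n}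
          = ?R i - ?D (p 0) (p n) - (\<lambda>s. up_face (q s) (k + 1)) ` {..<n}"
        unfolding D U using Suc.prems(6)[of n] by auto
      moreover have "(\<Prod>s<Suc n. ?w ((q(n := i)) s)) = ?w i * (\<Prod>s<n. ?w (q s))"
        by simp
      ultimately show "?w i * ((\<Prod>s<n. ?w (q s)) * M w (?R i - ?D (p 0) (p n) - (\<lambda>s. up_face (q s) (k + 1)) ` {..<n}))
        = (\<Prod>s<Suc n. ?w ((q(n := i)) s))
      * M w (R - ?D (p 0) (p (Suc n)) - (\<lambda>s. up_face ((q(n := i)) s) (k + 1)) ` {..<Suc n})"
        by (simp only: mult.assoc)
    qed
  qed
  also have "\<dots> = (\<Sum>i\<in>?I n. \<Sum>q\<in>PiE {..<n} ?I. F (q(n := i)))"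
    by (simp only: F_def)
  also have "\<dots> = (\<Sum>q\<in>PiE (insert n {..<n}) ?I. F q)"
    by (rule sum_PiE_insert[symmetric]) auto
  also have "insert n {..<n} = {..<Suc n}" by auto
  finally show ?case by (simp only: F_def)
qed

text \<open>A pair \<open>(i, j)\<close> is the horizontal unit edge at height \<open>j\<close> with
  western end \<open>i\<close>; it carries an up-pointing triangle above and a down-pointing one
  below. Therefore the same bounds \<open>lo j\<close> and \<open>W - j\<close> serve both
  orientations, and only the ranges of \<open>j\<close> differ.\<close>

definition trap :: "(int \<Rightarrow> int) \<Rightarrow> int \<Rightarrow> int \<Rightarrow> int \<Rightarrow> face set" where
  "trap lo W h k = {up_face i j | i j. k \<le> j \<and> j < h \<and> lo j \<le> i \<and> i < W - j}
                 \<union> {down_face i j | i j. k < j \<and> j \<le> h \<and> lo j \<le> i \<and> i < W - j}"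

lemma up_in_trap [simp]: "up_face i j \<in> trap lo W h k \<longleftrightarrow> k \<le> j \<and> j < h \<and> lo j \<le> i \<and> i < W - j"
  by (auto simp: trap_def)

lemma down_in_trap [simp]: "down_face i j \<in> trap lo W h k \<longleftrightarrow> k < j \<and> j \<le> h \<and> lo j \<le> i \<and> i < W - j"
  by (auto simp: trap_def)

lemma finite_trap [simp]: "finite (trap lo W h k)"
proof -
  have "trap lo W h k \<subseteq> (\<lambda>(i, j). up_face i j) ` (SIGMA j:{k..h}. {lo j..W - j})\<inverse>
      \<union> (\<lambda>(i, j). down_face i j) ` (SIGMA j:{k..h}. {lo j..W - j})\<inverse>"
    by (force simp: trap_def image_iff)
  then show ?thesis by (rule finite_subset) auto
qed

lemma trap_empty: "h \<le> k \<Longrightarrow> trap lo W h k = {}"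
  by (auto simp: trap_def)

lemma trap_unit_triangle: "f \<in> trap lo W h k \<Longrightarrow> unit_triangle f"
  by (auto simp: trap_def)

text \<open>Removes the lowest strip of a trapezoid. A western boundary leaning to the left is
  treated as one more dent at \<open>lo k - 1\<close>, just outside the trapezoid: deleting its
  triangle changes nothing, but the first segment then starts at the boundary.\<close>

lemma M_strip:
  assumes w: "flat_weight w" and k: "k < h" "n = 0 \<or> k + 1 < h"
    and p: "\<And>s. s < n \<Longrightarrow> p s < p (Suc s)" "lo k - 1 \<le> p 0" "p n < W - k"
    and lo: "lo (k + 1) = (if p 0 = lo k - 1 then lo k - 1 else lo k)"
  shows "M w (trap lo W h k - (\<lambda>s. up_face (p s) k) ` {..n})
    = (\<Sum>q\<in>PiE {..<n} (\<lambda>s. {p s..<p (Suc s)}). (\<Prod>s<n. w (vertical_lozenge (q s) (k + 1)))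
        * M w (trap lo W h (k + 1) - (\<lambda>s. up_face (q s) (k + 1)) ` {..<n}))"
proof -
  let ?R = "trap lo W h k - (\<lambda>s. up_face (p s) k) ` {..n}"
  let ?U = "\<lambda>A. (\<lambda>i. up_face i k) ` A" and ?D = "\<lambda>A. (\<lambda>i. down_face i (k + 1)) ` A"
  have mono: "p s \<le> p t" if "s \<le> t" "t \<le> n" for s t
    using that
  proof (induction rule: dec_induct)
    case (step m)
    then show ?case using p(1)[of m] by simp
  qed simp
  have bd: "p 0 \<le> p s" "p s \<le> p n" if "s \<le> n" for s using mono that by auto
  have p0n: "p 0 \<le> p n" using bd by simp
  let ?l = "lo (k + 1)" and ?r = "W - k - 1"
  have lop: "p 0 < ?l \<longleftrightarrow> False" using lo p(2) by (auto split: if_splits)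
  have lo': "?l = lo k \<or> (?l = lo k - 1 \<and> p 0 = ?l)" using lo by (auto split: if_splits)
  have memU: "up_face i j \<in> (\<lambda>s. up_face (p s) k) ` {..n} \<longleftrightarrow> j = k \<and> i \<in> p ` {..n}"
    "down_face i j \<notin> (\<lambda>s. up_face (p s) k) ` {..n}" for i j
    by auto
  have nd: "i \<notin> p ` {..n}" if "i < p 0 \<or> p n < i" for i
    using that bd by (auto simp: not_less[symmetric])
  \<comment> \<open>West of the first dent and east of the last one everything is forced; only the
    segments between dents leave a choice.\<close>
  have "M w ?R = M w (?R - (?U {?l..<p 0} \<union> ?D {?l..<p 0}))"
  proof (rule M_strip_left)
    fix i assume i: "?l \<le> i" "i < p 0"
    then have "i < W - (k + 1)" "lo k \<le> i" using p0n p(3) lo' by auto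
    then show "up_face i k \<in> ?R" "down_face i (k + 1) \<in> ?R" "down_face i k \<notin> ?R"
      using i k nd by (simp_all add: memU)
  qed (use w lop in auto)
  also have "\<dots> = M w (?R - (?U {?l..<p 0} \<union> ?D {?l..<p 0}) - (?U {p n<..?r} \<union> ?D {p n..<?r}))"
  proof (rule M_strip_right)
    fix i assume i: "p n < i" "i \<le> ?r"
    moreover have "lo k \<le> i" using i p0n lo' p(2) by auto
    ultimately show "up_face i k \<in> ?R - (?U {?l..<p 0} \<union> ?D {?l..<p 0})"
      using k nd p0n by (auto simp: memU)
    show "down_face i k \<notin> ?R - (?U {?l..<p 0} \<union> ?D {?l..<p 0})" by simp
  next
    fix i assume "p n \<le> i" "i < ?r"
    then show "down_face i (k + 1) \<in> ?R - (?U {?l..<p 0} \<union> ?D {?l..<p 0})"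
      using k p0n lop by (auto simp: memU)
  qed (use w p in auto)
  also have "\<dots> = (\<Sum>q\<in>PiE {..<n} (\<lambda>s. {p s..<p (Suc s)}). (\<Prod>s<n. w (vertical_lozenge (q s) (k + 1)))
        * M w (?R - (?U {?l..<p 0} \<union> ?D {?l..<p 0}) - (?U {p n<..?r} \<union> ?D {p n..<?r})
            - (?U {p 0<..<p n} \<union> ?D {p 0..<p n}) - (\<lambda>s. up_face (q s) (k + 1)) ` {..<n}))"
  proof (rule M_segments)
    fix i assume i: "p 0 < i" "i < p n" "i \<notin> p ` {..n}"
    have "lo k \<le> i" using i lo' p(2) by auto
    then show "up_face i k \<in> ?R - (?U {?l..<p 0} \<union> ?D {?l..<p 0}) - (?U {p n<..?r} \<union> ?D {p n..<?r})"
      using i k p(3) by (auto simp: memU)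
  next
    fix i assume i: "p 0 \<le> i" "i < p n"
    then have "n \<noteq> 0" by (cases n) simp_all
    then have "k + 1 < h" using k by simp
    moreover have "?l \<le> i" "i < W - (k + 1)" using i p(3) lop by auto
    ultimately show "down_face i (k + 1) \<in> ?R - (?U {?l..<p 0} \<union> ?D {?l..<p 0}) - (?U {p n<..?r} \<union> ?D {p n..<?r})"
      "up_face i (k + 1) \<in> ?R - (?U {?l..<p 0} \<union> ?D {?l..<p 0}) - (?U {p n<..?r} \<union> ?D {p n..<?r})"
      using i by (auto simp: memU)
    show "down_face i k \<notin> ?R - (?U {?l..<p 0} \<union> ?D {?l..<p 0}) - (?U {p n<..?r} \<union> ?D {p n..<?r})"
      by simp
  qed (use w p in auto)
  also have "?R - (?U {?l..<p 0} \<union> ?D {?l..<p 0}) - (?U {p n<..?r} \<union> ?D {p n..<?r})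
            - (?U {p 0<..<p n} \<union> ?D {p 0..<p n}) = trap lo W h (k + 1)" (is "?L = _")
  proof (rule Set.set_eqI)
    fix f
    have up: "up_face i j \<in> ?L \<longleftrightarrow> up_face i j \<in> trap lo W h (k + 1)" for i j
    proof (cases "j = k")
      case True
      have "i \<in> p ` {..n} \<or> i \<in> {?l..<p 0} \<or> i \<in> {p n<..?r} \<or> i \<in> {p 0<..<p n}"
        if "lo k \<le> i" "i < W - k"
      proof -
        have "p 0 \<in> p ` {..n}" "p n \<in> p ` {..n}" by auto
        then show ?thesis using that lo' p0n by (cases "i = p 0"; cases "i = p n") auto
      qed
      then show ?thesis using True by auto
    qed auto
    have down: "down_face i j \<in> ?L \<longleftrightarrow> down_face i j \<in> trap lo W h (k + 1)" for i j
    proof (cases "j = k + 1")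
      case True
      have "i \<in> {?l..<p 0} \<or> i \<in> {p n..<?r} \<or> i \<in> {p 0..<p n}"
        if "?l \<le> i" "i < W - (k + 1)"
        using that by auto
      then show ?thesis using True by auto
    qed auto
    show "f \<in> ?L \<longleftrightarrow> f \<in> trap lo W h (k + 1)"
    proof (cases "unit_triangle f")
      case True
      then show ?thesis
      proof (rule unit_triangle_cases)
        fix i j assume "f = up_face i j"
        then show ?thesis using up[of i j] by simp
      next
        fix i j assume "f = down_face i j"
        then show ?thesis using down[of i j] by simp
      qed
    next
      case False
      then show ?thesis using trap_unit_triangle by blast
    qed
  qed
  finally show ?thesis .
qed

section \<open>Rows of dents\<close>

text \<open>Central factorials. For the difference operator
  \<open>F (x + 1 / 2) - F (x - 1 / 2)\<close> they play the role of the powers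
  \<open>x ^ (2 * j)\<close> and, in the case of \<open>odd_central\<close>,
  \<open>x ^ (2 * j + 1)\<close>.\<close>

definition even_central :: "nat \<Rightarrow> real \<Rightarrow> real" where
  "even_central j x = (\<Prod>i<j. x\<^sup>2 - (real i + 1 / 2)\<^sup>2)"

definition odd_central :: "nat \<Rightarrow> real \<Rightarrow> real" where
  "odd_central j x = x * (\<Prod>i<j. x\<^sup>2 - (real i + 1)\<^sup>2)"

lemma odd_central_Suc: "odd_central (Suc j) x = odd_central j x * (x\<^sup>2 - (real j + 1)\<^sup>2)"
  by (simp add: odd_central_def)

lemma even_central_Suc: "even_central (Suc j) x = even_central j x * (x\<^sup>2 - (real j + 1 / 2)\<^sup>2)"
  by (simp add: even_central_def)

text \<open>The zeros of \<open>odd_central j\<close> are the integers from \<open>- j\<close> to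
  \<open>j\<close>. A shift by a half moves all of them but one onto the zeros of
  \<open>even_central j\<close>; the remaining one is the linear factor.\<close>

lemma odd_central_half:
  "odd_central j (x + 1 / 2) = even_central j x * (x + real j + 1 / 2) \<and> odd_central j (x - 1 / 2) = even_central j x * (x - real j - 1 / 2)"
proof (induction j)
  case 0
  show ?case by (simp add: odd_central_def even_central_def)
next
  case (Suc j)
  have 1: "(x + real j + 1 / 2) * ((x + 1 / 2)\<^sup>2 - (real j + 1)\<^sup>2)
      = (x\<^sup>2 - (real j + 1 / 2)\<^sup>2) * (x + real (Suc j) + 1 / 2)"
    and 2: "(x - real j - 1 / 2) * ((x - 1 / 2)\<^sup>2 - (real j + 1)\<^sup>2)
      = (x\<^sup>2 - (real j + 1 / 2)\<^sup>2) * (x - real (Suc j) - 1 / 2)"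
    by (simp_all add: field_simps power2_eq_square)
  show ?case using Suc 1 2 by (simp add: odd_central_Suc even_central_Suc mult.assoc)
qed

lemma even_central_half:
  "even_central (Suc j) (x + 1 / 2) = odd_central j x * (x + real j + 1) \<and> even_central (Suc j) (x - 1 / 2) = odd_central j x * (x - real j - 1)"
proof (induction j)
  case 0
  show ?case by (simp add: odd_central_def even_central_def field_simps power2_eq_square)
next
  case (Suc j)
  have 1: "(x + real j + 1) * ((x + 1 / 2)\<^sup>2 - (real (Suc j) + 1 / 2)\<^sup>2)
      = (x\<^sup>2 - (real j + 1)\<^sup>2) * (x + real (Suc j) + 1)"
    and 2: "(x - real j - 1) * ((x - 1 / 2)\<^sup>2 - (real (Suc j) + 1 / 2)\<^sup>2)
      = (x\<^sup>2 - (real j + 1)\<^sup>2) * (x - real (Suc j) - 1)"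
    by (simp_all add: field_simps power2_eq_square)
  show ?case using Suc 1 2 by (simp add: odd_central_Suc even_central_Suc[of "Suc j"] mult.assoc)
qed

lemma odd_central_diff: "odd_central j (x + 1 / 2) - odd_central j (x - 1 / 2) = (2 * real j + 1) * even_central j x"
  unfolding odd_central_half[THEN conjunct1] odd_central_half[THEN conjunct2] by (simp add: algebra_simps)

lemma even_central_diff: "even_central (Suc j) (x + 1 / 2) - even_central (Suc j) (x - 1 / 2) = (2 * real j + 2) * odd_central j x"
  unfolding even_central_half[THEN conjunct1] even_central_half[THEN conjunct2] by (simp add: algebra_simps)

lemma odd_central_minus: "odd_central j (- x) = - odd_central j x"
  by (simp add: odd_central_def)

lemma odd_central_0 [simp]: "odd_central j 0 = 0"
  by (simp add: odd_central_def)

lemma even_central_0_left [simp]: "even_central 0 x = 1"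
  by (simp add: even_central_def)

lemma sum_telescope_int:
  fixes F f :: "real \<Rightarrow> real" and a b :: int
  assumes "a \<le> b" "\<And>x. F (x + 1 / 2) - F (x - 1 / 2) = c * f x" "c \<noteq> 0"
  shows "(\<Sum>q\<in>{a..<b}. f (of_int q + t)) = (F (of_int b + t - 1 / 2) - F (of_int a + t - 1 / 2)) / c"
  using assms(1)
proof (induction b rule: int_ge_induct)
  case base
  then show ?case by simp
next
  case (step b)
  have "{a..<b + 1} = insert b {a..<b}" using step by auto
  then have "(\<Sum>q\<in>{a..<b + 1}. f (of_int q + t)) = f (of_int b + t) + (\<Sum>q\<in>{a..<b}. f (of_int q + t))"
    by simp
  also have "f (of_int b + t) = (F (of_int (b + 1) + t - 1 / 2) - F (of_int b + t - 1 / 2)) / c"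
    using assms(2)[of "of_int b + t"] assms(3) by (simp add: field_simps)
  finally show ?case
    unfolding step.IH by (simp add: add_divide_distrib[symmetric])
qed

lemma fdet_divide:
  fixes f :: "nat \<Rightarrow> nat \<Rightarrow> real"
  shows "fdet n (\<lambda>i j. f i j / c j) = fdet n f / (\<Prod>j<n. c j)"
  using fdet_scale[of n "\<lambda>_. 1" "\<lambda>j. 1 / c j" f] by (simp add: prod_dividef)

lemma fdet_prod_rows:
  fixes f :: "nat \<Rightarrow> nat \<Rightarrow> real"
  shows "fdet n (\<lambda>i j. r i * f i j) = (\<Prod>i<n. r i) * fdet n f"
  using fdet_scale[of n r "\<lambda>_. 1" f] by simp

text \<open>Strips alternate: above a row \<open>j\<close> with \<open>j + \<pi>\<close> even the western boundary leans to the right.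
  A tiling is a chain of interlacing rows of dents; summing over a row is taking discrete
  antiderivatives, which exchanges the polynomials \<open>even_central\<close> and \<open>odd_central\<close>.\<close>

locale zigzag_trap =
  fixes lo :: "int \<Rightarrow> int" and W h \<pi> :: int and \<sigma> :: real and w :: "face set \<Rightarrow> real"
  assumes lo_step: "lo (j + 1) = (if even (j + \<pi>) then lo j else lo j - 1)"
    and \<sigma>: "\<sigma> = 0 \<or> \<sigma> = 1 / 2"
    and flat_weight: "flat_weight w"
    and vert: "0 < j \<Longrightarrow> j < h \<Longrightarrow> lo j \<le> i \<Longrightarrow>
      w (vertical_lozenge i j) = (if \<sigma> = 0 \<and> even (j + \<pi>) \<and> i = lo j then 1 / 2 else 1)"
begin

definition dent_M :: "int \<Rightarrow> nat \<Rightarrow> (nat \<Rightarrow> int) \<Rightarrow> real" where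
  "dent_M k n p = M w (trap lo W h k - (\<lambda>s. up_face (p s) k) ` {..<n})"

definition dent_seq :: "int \<Rightarrow> nat \<Rightarrow> (nat \<Rightarrow> int) \<Rightarrow> bool" where
  "dent_seq k n p \<longleftrightarrow> (\<forall>s. Suc s < n \<longrightarrow> p s < p (Suc s)) \<and> (\<forall>s<n. lo k \<le> p s \<and> p s < W - k)"

text \<open>The next row has one dent less. Its entries \<open>odd_central\<close> sum to
  differences of \<open>even_central (Suc j)\<close>, and the constant \<open>even_central 0\<close>
  is the column of ones that restores the determinant of size \<open>n + 1\<close>. The row above
  has the wrong parity for the weight 1/2.\<close>

lemma even_row:
  assumes k: "0 \<le> k" "even (k + \<pi>)" "k + 1 + 2 * int n = h"
    and IH: "\<And>q. dent_seq (k + 1) n q \<Longrightarrow>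
      dent_M (k + 1) n q = fdet n (\<lambda>i j. odd_central j (of_int (q i - lo (k + 1)) + \<sigma> + 1 / 2)) / (\<Prod>j<n. fact (2 * j + 1))"
    and p: "dent_seq k (Suc n) p"
  shows "dent_M k (Suc n) p = fdet (Suc n) (\<lambda>i j. even_central j (of_int (p i - lo k) + \<sigma>)) / (\<Prod>j<Suc n. fact (2 * j))"
proof -
  have lo: "lo (k + 1) = lo k" using k(2) by (simp add: lo_step)
  have bd: "p s < p (Suc s)" if "s < n" for s using p that by (simp add: dent_seq_def)
  have rng: "lo k \<le> p s" "p s < W - k" if "s \<le> n" for s using p that by (auto simp: dent_seq_def)
  have q_seq: "dent_seq (k + 1) n q" if "q \<in> PiE {..<n} (\<lambda>s. {p s..<p (Suc s)})" for q
    unfolding dent_seq_def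
  proof (intro conjI allI impI)
    fix s
    have q: "p s \<le> q s \<and> q s < p (Suc s)" if "s < n" for s
      using PiE_mem[OF \<open>q \<in> _\<close>, of s] that by auto
    show "q s < q (Suc s)" if "Suc s < n" using q[of s] q[of "Suc s"] that by simp
    show "lo (k + 1) \<le> q s" "q s < W - (k + 1)" if "s < n"
      using q[of s] rng(1)[of s] rng(2)[of "Suc s"] that lo by simp_all
  qed
  have "dent_M k (Suc n) p = (\<Sum>q\<in>PiE {..<n} (\<lambda>s. {p s..<p (Suc s)}).
      (\<Prod>s<n. w (vertical_lozenge (q s) (k + 1))) * dent_M (k + 1) n q)"
    unfolding dent_M_def lessThan_Suc_atMost
    by (rule M_strip) (use flat_weight k bd rng[of 0] rng[of n] lo in auto)
  also have "\<dots> = (\<Sum>q\<in>PiE {..<n} (\<lambda>s. {p s..<p (Suc s)}).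
      fdet n (\<lambda>i j. odd_central j (of_int (q i - lo k) + \<sigma> + 1 / 2)) / (\<Prod>j<n. fact (2 * j + 1)))"
  proof (rule sum.cong[OF refl])
    fix q assume q: "q \<in> PiE {..<n} (\<lambda>s. {p s..<p (Suc s)})"
    have "w (vertical_lozenge (q s) (k + 1)) = 1" if "s < n" for s
      using q_seq[OF q] that k by (subst vert) (auto simp: dent_seq_def)
    then have "(\<Prod>s<n. w (vertical_lozenge (q s) (k + 1))) = 1" by simp
    then show "(\<Prod>s<n. w (vertical_lozenge (q s) (k + 1))) * dent_M (k + 1) n q
      = fdet n (\<lambda>i j. odd_central j (of_int (q i - lo k) + \<sigma> + 1 / 2)) / (\<Prod>j<n. fact (2 * j + 1))"
      using IH[OF q_seq[OF q]] lo by simp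
  qed
  also have "\<dots> = fdet n (\<lambda>i j. \<Sum>q\<in>{p i..<p (Suc i)}. odd_central j (of_int (q - lo k) + \<sigma> + 1 / 2))
      / (\<Prod>j<n. fact (2 * j + 1))"
    unfolding sum_divide_distrib[symmetric]
    by (subst fdet_sum_rows[where f = "\<lambda>i j q. odd_central j (of_int (q - lo k) + \<sigma> + 1 / 2)"]) auto
  also have "fdet n (\<lambda>i j. \<Sum>q\<in>{p i..<p (Suc i)}. odd_central j (of_int (q - lo k) + \<sigma> + 1 / 2))
      = fdet n (\<lambda>i j. (even_central (Suc j) (of_int (p (Suc i) - lo k) + \<sigma>) - even_central (Suc j) (of_int (p i - lo k) + \<sigma>)) / (2 * real j + 2))"
  proof (rule fdet_cong)
    fix i j assume "i < n"
    then have "(\<Sum>q\<in>{p i..<p (Suc i)}. odd_central j (of_int q + (\<sigma> + 1 / 2 - of_int (lo k))))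
      = (even_central (Suc j) (of_int (p (Suc i)) + (\<sigma> + 1 / 2 - of_int (lo k)) - 1 / 2)
        - even_central (Suc j) (of_int (p i) + (\<sigma> + 1 / 2 - of_int (lo k)) - 1 / 2)) / (2 * real j + 2)"
      using bd[of i] by (intro sum_telescope_int even_central_diff) auto
    then show "(\<Sum>q\<in>{p i..<p (Suc i)}. odd_central j (of_int (q - lo k) + \<sigma> + 1 / 2))
      = (even_central (Suc j) (of_int (p (Suc i) - lo k) + \<sigma>) - even_central (Suc j) (of_int (p i - lo k) + \<sigma>)) / (2 * real j + 2)"
      by (simp add: algebra_simps)
  qed
  also have "\<dots> = fdet (Suc n) (\<lambda>i j. even_central j (of_int (p i - lo k) + \<sigma>)) / (\<Prod>j<n. 2 * real j + 2)"
    by (subst fdet_divide) (simp add: fdet_first_column_one)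
  also have "\<dots> / (\<Prod>j<n. fact (2 * j + 1))
      = fdet (Suc n) (\<lambda>i j. even_central j (of_int (p i - lo k) + \<sigma>)) / (\<Prod>j<Suc n. fact (2 * j))"
  proof -
    have "(\<Prod>j<Suc n. fact (2 * j)) = (\<Prod>j<n. fact (2 * Suc j) :: real)"
      by (simp only: prod.lessThan_Suc_shift) simp
    also have "\<dots> = (\<Prod>j<n. (2 * real j + 2) * fact (2 * j + 1))"
      by (intro prod.cong refl) (simp add: algebra_simps)
    finally show ?thesis by (simp add: prod.distrib)
  qed
  finally show ?thesis .
qed

text \<open>The next row has equally many dents, the first of which may lie anywhere between the
  boundary and \<open>p 0\<close>. The point is that the antiderivative \<open>odd_central\<close>
  contributes nothing at the western end: for \<open>\<sigma> = 1 / 2\<close> the sum starts at its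
  zero, and for \<open>\<sigma> = 0\<close> the weight 1/2 of the cell on the axis makes up for the
  difference.\<close>

lemma odd_row:
  assumes k: "0 \<le> k" "odd (k + \<pi>)" "k + 2 * int n = h" "n > 0"
    and IH: "\<And>q. dent_seq (k + 1) n q \<Longrightarrow>
      dent_M (k + 1) n q = fdet n (\<lambda>i j. even_central j (of_int (q i - lo (k + 1)) + \<sigma>)) / (\<Prod>j<n. fact (2 * j))"
    and p: "dent_seq k n p"
  shows "dent_M k n p = fdet n (\<lambda>i j. odd_central j (of_int (p i - lo k) + \<sigma> + 1 / 2)) / (\<Prod>j<n. fact (2 * j + 1))"
proof -
  have lo: "lo (k + 1) = lo k - 1" using k(2) by (simp add: lo_step)
  \<comment> \<open>The row with the additional dent just west of the trapezoid, as
    \<open>M_strip\<close> expects it for a boundary leaning to the left.\<close>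
  define P where "P s = (case s of 0 \<Rightarrow> lo k - 1 | Suc t \<Rightarrow> p t)" for s
  have P0: "P 0 = lo k - 1" and PS: "P (Suc s) = p s" for s by (simp_all add: P_def)
  have rng: "lo k \<le> p s" "p s < W - k" if "s < n" for s using p that by (auto simp: dent_seq_def)
  have bd: "P s < P (Suc s)" if "s < n" for s
    using p that rng(1)[of 0] by (cases s) (auto simp: P_def dent_seq_def)
  have Pge: "lo k - 1 \<le> P s" if "s \<le> n" for s
    using rng(1)[of "s - 1"] that by (cases s) (auto simp: P_def)
  have Pn: "P n < W - k" using k(4) rng(2)[of "n - 1"] by (cases n) (auto simp: P_def)
  have q_seq: "dent_seq (k + 1) n q" if "q \<in> PiE {..<n} (\<lambda>s. {P s..<P (Suc s)})" for q
    unfolding dent_seq_def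
  proof (intro conjI allI impI)
    fix s
    have q: "P s \<le> q s \<and> q s < P (Suc s)" if "s < n" for s
      using PiE_mem[OF \<open>q \<in> _\<close>, of s] that by auto
    show "q s < q (Suc s)" if "Suc s < n" using q[of s] q[of "Suc s"] that by simp
    show "lo (k + 1) \<le> q s" "q s < W - (k + 1)" if "s < n"
      using q[of s] Pge[of s] rng(2)[of s] that lo by (simp_all add: PS)
  qed
  have "dent_M k n p = M w (trap lo W h k - (\<lambda>s. up_face (P s) k) ` {..n})"
  proof -
    have "trap lo W h k - (\<lambda>s. up_face (P s) k) ` {..n} = trap lo W h k - (\<lambda>s. up_face (p s) k) ` {..<n}"
    proof -
      have "{..n} = insert 0 (Suc ` {..<n})"
        unfolding lessThan_Suc_atMost[symmetric] by (rule lessThan_Suc_eq_insert_0)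
      then have "(\<lambda>s. up_face (P s) k) ` {..n} = insert (up_face (lo k - 1) k) ((\<lambda>s. up_face (p s) k) ` {..<n})"
        by (simp add: image_image P0 PS)
      moreover have "up_face (lo k - 1) k \<notin> trap lo W h k" by simp
      ultimately show ?thesis by (simp add: Diff_insert0)
    qed
    then show ?thesis by (simp add: dent_M_def)
  qed
  also have "\<dots> = (\<Sum>q\<in>PiE {..<n} (\<lambda>s. {P s..<P (Suc s)}).
      (\<Prod>s<n. w (vertical_lozenge (q s) (k + 1))) * dent_M (k + 1) n q)"
    unfolding dent_M_def
    by (rule M_strip) (use flat_weight k bd Pge[of 0] Pn lo P0 in auto)
  also have "\<dots> = (\<Sum>q\<in>PiE {..<n} (\<lambda>s. {P s..<P (Suc s)}).
      fdet n (\<lambda>i j. w (vertical_lozenge (q i) (k + 1)) * even_central j (of_int (q i - lo k + 1) + \<sigma>))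
        / (\<Prod>j<n. fact (2 * j)))"
  proof (rule sum.cong[OF refl])
    fix q assume q: "q \<in> PiE {..<n} (\<lambda>s. {P s..<P (Suc s)})"
    have eq: "q i - lo (k + 1) = q i - lo k + 1" for i using lo by simp
    show "(\<Prod>s<n. w (vertical_lozenge (q s) (k + 1))) * dent_M (k + 1) n q
      = fdet n (\<lambda>i j. w (vertical_lozenge (q i) (k + 1)) * even_central j (of_int (q i - lo k + 1) + \<sigma>))
        / (\<Prod>j<n. fact (2 * j))"
      unfolding IH[OF q_seq[OF q]] eq fdet_prod_rows by simp
  qed
  also have "\<dots> = fdet n (\<lambda>i j. \<Sum>q\<in>{P i..<P (Suc i)}. w (vertical_lozenge q (k + 1)) * even_central j (of_int (q - lo k + 1) + \<sigma>))
      / (\<Prod>j<n. fact (2 * j))"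
    unfolding sum_divide_distrib[symmetric]
    by (subst fdet_sum_rows[where f = "\<lambda>i j q. w (vertical_lozenge q (k + 1)) * even_central j (of_int (q - lo k + 1) + \<sigma>)"]) auto
  also have "fdet n (\<lambda>i j. \<Sum>q\<in>{P i..<P (Suc i)}. w (vertical_lozenge q (k + 1)) * even_central j (of_int (q - lo k + 1) + \<sigma>))
      = fdet n (\<lambda>i j. (odd_central j (of_int (p i - lo k) + \<sigma> + 1 / 2)
          - (if i = 0 then 0 else odd_central j (of_int (p (i - 1) - lo k) + \<sigma> + 1 / 2))) / (2 * real j + 1))"
  proof (rule fdet_cong)
    fix i j assume i: "i < n" and "j < n"
    let ?v = "\<lambda>q. even_central j (of_int (q - lo k + 1) + \<sigma>)"
    have "(\<Sum>q\<in>{P i..<P (Suc i)}. even_central j (of_int q + (\<sigma> + 1 - of_int (lo k))))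
      = (odd_central j (of_int (P (Suc i)) + (\<sigma> + 1 - of_int (lo k)) - 1 / 2)
        - odd_central j (of_int (P i) + (\<sigma> + 1 - of_int (lo k)) - 1 / 2)) / (2 * real j + 1)"
      using bd[OF i] by (intro sum_telescope_int odd_central_diff) auto
    then have tel: "(\<Sum>q\<in>{P i..<P (Suc i)}. ?v q)
      = (odd_central j (of_int (p i - lo k) + \<sigma> + 1 / 2) - odd_central j (of_int (P i - lo k) + \<sigma> + 1 / 2)) / (2 * real j + 1)"
      by (simp add: algebra_simps PS)
    have wv: "w (vertical_lozenge q (k + 1)) = (if \<sigma> = 0 \<and> q = lo k - 1 then 1 / 2 else 1)" if "q \<in> {P i..<P (Suc i)}" for q
      using that i k Pge[of i] lo by (subst vert) auto
    show "(\<Sum>q\<in>{P i..<P (Suc i)}. w (vertical_lozenge q (k + 1)) * ?v q)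
      = (odd_central j (of_int (p i - lo k) + \<sigma> + 1 / 2)
          - (if i = 0 then 0 else odd_central j (of_int (p (i - 1) - lo k) + \<sigma> + 1 / 2))) / (2 * real j + 1)"
    proof (cases i)
      case (Suc i')
      have "P i \<ge> lo k" using Suc i rng(1)[of i'] by (simp add: P_def)
      then have "(\<Sum>q\<in>{P i..<P (Suc i)}. w (vertical_lozenge q (k + 1)) * ?v q) = (\<Sum>q\<in>{P i..<P (Suc i)}. ?v q)"
        using wv by (intro sum.cong) auto
      then show ?thesis using Suc tel by (simp add: PS)
    next
      case 0
      have sp: "{P i..<P (Suc i)} = insert (lo k - 1) {lo k..<P (Suc i)}"
        using 0 P0 bd[OF i] by auto
      have "(\<Sum>q\<in>{P i..<P (Suc i)}. w (vertical_lozenge q (k + 1)) * ?v q)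
          = (if \<sigma> = 0 then 1 / 2 else 1) * ?v (lo k - 1) + (\<Sum>q\<in>{lo k..<P (Suc i)}. ?v q)"
        using wv unfolding sp by (subst sum.insert) (auto intro!: sum.cong)
      also have "\<dots> = (\<Sum>q\<in>{P i..<P (Suc i)}. ?v q) - (if \<sigma> = 0 then even_central j 0 / 2 else 0)"
        unfolding sp by (subst sum.insert) auto
      also have "\<dots> = odd_central j (of_int (p i - lo k) + \<sigma> + 1 / 2) / (2 * real j + 1)"
      proof -
        define S where "S = (\<Sum>q\<in>{P i..<P (Suc i)}. ?v q)"
        define Y where "Y = odd_central j (of_int (p i - lo k) + \<sigma> + 1 / 2)"
        \<comment> \<open>The cell on the axis extends from -1/2 to 1/2, and
          \<open>odd_central\<close> is odd; so half of this cell accounts for exactly its value at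
          1/2.\<close>
        have half_cells: "odd_central j (1 / 2) = (2 * real j + 1) * even_central j 0 / 2"
          using odd_central_diff[of j 0] odd_central_minus[of j "1 / 2"] by simp
        have "S = (Y - odd_central j (\<sigma> - 1 / 2)) / (2 * real j + 1)"
          unfolding S_def Y_def tel using 0 by (simp add: P0)
        then have "S - (if \<sigma> = 0 then even_central j 0 / 2 else 0) = Y / (2 * real j + 1)"
          using \<sigma> odd_central_minus[of j "1 / 2"] half_cells by (auto simp: field_simps)
        then show ?thesis unfolding S_def Y_def .
      qed
      finally show ?thesis using 0 by simp
    qed
  qed
  also have "\<dots> = fdet n (\<lambda>i j. odd_central j (of_int (p i - lo k) + \<sigma> + 1 / 2)) / (\<Prod>j<n. 2 * real j + 1)"
    by (subst fdet_divide) (use fdet_row_diff[of n "\<lambda>i j. odd_central j (of_int (p i - lo k) + \<sigma> + 1 / 2)"] in simp)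
  also have "\<dots> / (\<Prod>j<n. fact (2 * j))
      = fdet n (\<lambda>i j. odd_central j (of_int (p i - lo k) + \<sigma> + 1 / 2)) / (\<Prod>j<n. fact (2 * j + 1))"
  proof -
    have "(\<Prod>j<n. fact (2 * j + 1) :: real) = (\<Prod>j<n. (2 * real j + 1) * fact (2 * j))"
      by (intro prod.cong refl) (simp add: algebra_simps)
    then show ?thesis by (simp add: prod.distrib)
  qed
  finally show ?thesis .
qed

text \<open>Both parities at once, because each kind of row rests on the other. The number of dents
  is tied to the number of strips still above, so the induction starts from the empty trapezoid at
  the top.\<close>

lemma rows:
  "(\<forall>k p. 0 \<le> k \<longrightarrow> odd (k + \<pi>) \<longrightarrow> k + 2 * int n = h \<longrightarrow> dent_seq k n p \<longrightarrow>
      dent_M k n p = fdet n (\<lambda>i j. odd_central j (of_int (p i - lo k) + \<sigma> + 1 / 2)) / (\<Prod>j<n. fact (2 * j + 1)))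
   \<and> (\<forall>k p. 0 \<le> k \<longrightarrow> even (k + \<pi>) \<longrightarrow> k + 1 + 2 * int n = h \<longrightarrow> dent_seq k (Suc n) p \<longrightarrow>
      dent_M k (Suc n) p = fdet (Suc n) (\<lambda>i j. even_central j (of_int (p i - lo k) + \<sigma>)) / (\<Prod>j<Suc n. fact (2 * j)))"
proof (induction n)
  case 0
  have *: "dent_M k 0 p = fdet 0 (\<lambda>i j. odd_central j (of_int (p i - lo k) + \<sigma> + 1 / 2)) / (\<Prod>j<0. fact (2 * j + 1))"
    if "k = h" for k p
    using that by (simp add: dent_M_def trap_empty)
  show ?case
    using * even_row[of _ 0] by auto
next
  case (Suc n)
  have *: "dent_M k (Suc n) p = fdet (Suc n) (\<lambda>i j. odd_central j (of_int (p i - lo k) + \<sigma> + 1 / 2)) / (\<Prod>j<Suc n. fact (2 * j + 1))"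
    if "0 \<le> k" "odd (k + \<pi>)" "k + 2 * int (Suc n) = h" "dent_seq k (Suc n) p" for k p
  proof (rule odd_row)
    fix q assume "dent_seq (k + 1) (Suc n) q"
    moreover have "even (k + 1 + \<pi>)" "k + 1 + 1 + 2 * int n = h" using that by auto
    ultimately show "dent_M (k + 1) (Suc n) q = fdet (Suc n) (\<lambda>i j. even_central j (of_int (q i - lo (k + 1)) + \<sigma>)) / (\<Prod>j<Suc n. fact (2 * j))"
      using that(1) Suc.IH[THEN conjunct2, rule_format, of "k + 1" q] by simp
  qed (use that in auto)
  have "dent_M k (Suc (Suc n)) p = fdet (Suc (Suc n)) (\<lambda>i j. even_central j (of_int (p i - lo k) + \<sigma>)) / (\<Prod>j<Suc (Suc n). fact (2 * j))"
    if "0 \<le> k" "even (k + \<pi>)" "k + 1 + 2 * int (Suc n) = h" "dent_seq k (Suc (Suc n)) p" for k p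
  proof (rule even_row)
    fix q assume "dent_seq (k + 1) (Suc n) q"
    moreover have "odd (k + 1 + \<pi>)" "k + 1 + 2 * int (Suc n) = h" using that by auto
    ultimately show "dent_M (k + 1) (Suc n) q = fdet (Suc n) (\<lambda>i j. odd_central j (of_int (q i - lo (k + 1)) + \<sigma> + 1 / 2)) / (\<Prod>j<Suc n. fact (2 * j + 1))"
      using that(1) by (intro *) simp_all
  qed (use that in auto)
  with * show ?case by blast
qed

end

section \<open>Discrete Selberg sum\<close>

text \<open>The Vandermonde product of the squares of the elements, not the square of a Vandermonde
  product. As a function of a set it needs no enumeration.\<close>

definition vandermonde_sq :: "int set \<Rightarrow> real" where
  "vandermonde_sq S = (\<Prod>q\<in>S. \<Prod>p | p \<in> S \<and> p < q. of_int (q\<^sup>2 - p\<^sup>2))"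

lemma vandermonde_sq_empty [simp]: "vandermonde_sq {} = 1"
  by (simp add: vandermonde_sq_def)

lemma vandermonde_sq_enum:
  fixes e :: "nat \<Rightarrow> int"
  assumes bij: "bij_betw e {..<n} S" and mono: "\<And>i j. i < j \<Longrightarrow> j < n \<Longrightarrow> e i < e j"
  shows "(\<Prod>j<n. \<Prod>i<j. (of_int (e j))\<^sup>2 - (of_int (e i))\<^sup>2) = vandermonde_sq S"
proof -
  have "vandermonde_sq S = (\<Prod>j<n. \<Prod>p | p \<in> S \<and> p < e j. of_int ((e j)\<^sup>2 - p\<^sup>2))"
    unfolding vandermonde_sq_def by (rule prod.reindex_bij_betw[OF bij, symmetric])
  also have "\<dots> = (\<Prod>j<n. \<Prod>i<j. (of_int (e j))\<^sup>2 - (of_int (e i))\<^sup>2)"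
  proof (rule prod.cong[OF refl])
    fix j assume "j \<in> {..<n}"
    then have j: "j < n" by simp
    have inj: "inj_on (e) {..<j}"
      using bij_betw_imp_inj_on[OF bij] by (rule inj_on_subset) (use j in auto)
    have "{p. p \<in> S \<and> p < e j} = e ` {..<j}"
    proof (intro equalityI subsetI)
      fix p assume p: "p \<in> {p. p \<in> S \<and> p < e j}"
      then obtain i where i: "i < n" "p = e i" using bij by (auto simp: bij_betw_def)
      have "i < j"
      proof (rule ccontr)
        assume "\<not> i < j"
        then have "e j \<le> e i" using mono[of j i] i(1) by (cases "i = j") auto
        then show False using p i by simp
      qed
      then show "p \<in> e ` {..<j}" using i by auto
    next
      fix p assume "p \<in> e ` {..<j}"
      then show "p \<in> {p. p \<in> S \<and> p < e j}"
        using mono j bij by (auto simp: bij_betw_def)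
    qed
    then show "(\<Prod>p | p \<in> S \<and> p < e j. of_int ((e j)\<^sup>2 - p\<^sup>2))
        = (\<Prod>i<j. (of_int (e j))\<^sup>2 - (of_int (e i) :: real)\<^sup>2)"
      by (simp add: prod.reindex[OF inj])
  qed
  finally show ?thesis by simp
qed

lemma vandermonde_sq_nth_elem:
  assumes S: "finite S" "card S = n"
  shows "(\<Prod>j<n. \<Prod>i<j. (of_int (nth_elem S j))\<^sup>2 - (of_int (nth_elem S i))\<^sup>2) = vandermonde_sq S"
  using nth_elem_bij[OF S(1)] nth_elem_strict_mono[OF S(1)] S(2) by (intro vandermonde_sq_enum) auto

text \<open>The nodes \<xi> are free. Two different choices are made later for the two Vandermonde
  factors of the same \<open>S\<close>, each adapted to the weight.\<close>

lemma fdet_newton_vd: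
  assumes "finite S" "card S = n"
  shows "fdet n (\<lambda>i j. \<Prod>m<j. (of_int (nth_elem S i))\<^sup>2 - \<xi> m) = vandermonde_sq S"
  using fdet_newton[of n "\<lambda>i. (of_int (nth_elem S i))\<^sup>2" \<xi>] vandermonde_sq_nth_elem[OF assms] by simp

text \<open>With absolute values it does not matter which elements are below
  \<open>x\<close>.\<close>

lemma vandermonde_sq_insert:
  assumes "finite A" "x \<notin> A" "0 \<le> x" "\<And>q. q \<in> A \<Longrightarrow> 0 \<le> q"
  shows "vandermonde_sq (insert x A) = vandermonde_sq A * (\<Prod>q\<in>A. \<bar>of_int (x\<^sup>2 - q\<^sup>2)\<bar>)"
proof -
  let ?f = "\<lambda>q p. of_int (q\<^sup>2 - p\<^sup>2) :: real"
  have 1: "(\<Prod>p | p \<in> insert x A \<and> p < q. ?f q p)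
      = (\<Prod>p | p \<in> A \<and> p < q. ?f q p) * (if x < q then ?f q x else 1)" for q
  proof (cases "x < q")
    case True
    then have "{p. p \<in> insert x A \<and> p < q} = insert x {p. p \<in> A \<and> p < q}" by auto
    then show ?thesis using True assms(1,2) by simp
  next
    case False
    then have "{p. p \<in> insert x A \<and> p < q} = {p. p \<in> A \<and> p < q}" by auto
    then show ?thesis using False by simp
  qed
  have "vandermonde_sq (insert x A) = (\<Prod>p | p \<in> insert x A \<and> p < x. ?f x p)
      * (\<Prod>q\<in>A. \<Prod>p | p \<in> insert x A \<and> p < q. ?f q p)"
    unfolding vandermonde_sq_def using assms(1,2) by (rule prod.insert)
  also have "(\<Prod>p | p \<in> insert x A \<and> p < x. ?f x p) = (\<Prod>p\<in>A. if p < x then ?f x p else 1)"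
  proof -
    have "{p. p \<in> insert x A \<and> p < x} = {p \<in> A. p < x}" by auto
    then show ?thesis by (simp only:) (rule prod.inter_filter[OF assms(1)])
  qed
  also have "(\<Prod>q\<in>A. \<Prod>p | p \<in> insert x A \<and> p < q. ?f q p) = vandermonde_sq A * (\<Prod>q\<in>A. if x < q then ?f q x else 1)"
    unfolding 1 vandermonde_sq_def by (rule prod.distrib)
  also have "(\<Prod>p\<in>A. if p < x then ?f x p else 1) * (vandermonde_sq A * (\<Prod>q\<in>A. if x < q then ?f q x else 1))
      = vandermonde_sq A * (\<Prod>q\<in>A. (if q < x then ?f x q else 1) * (if x < q then ?f q x else 1))"
    by (simp add: prod.distrib)
  also have "(\<Prod>q\<in>A. (if q < x then ?f x q else 1) * (if x < q then ?f q x else 1))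
      = (\<Prod>q\<in>A. \<bar>of_int (x\<^sup>2 - q\<^sup>2)\<bar>)"
  proof (rule prod.cong[OF refl])
    fix q assume q: "q \<in> A"
    have lt: "u\<^sup>2 < v\<^sup>2" if "0 \<le> u" "u < v" for u v :: int
      using that by (intro power_strict_mono) auto
    show "(if q < x then ?f x q else 1) * (if x < q then ?f q x else 1) = \<bar>of_int (x\<^sup>2 - q\<^sup>2)\<bar>"
      using lt[of q x] lt[of x q] assms(2,3) assms(4)[OF q] q
      by (cases q x rule: linorder_cases) (auto simp: abs_if simp flip: of_int_power)
  qed
  finally show ?thesis .
qed

text \<open>The mixed pairs form a product over \<open>S\<close> of a weight determined by
  \<open>F\<close>. This is how the dents of the ferns turn into a weight on the gap.\<close>

lemma vandermonde_sq_Un: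
  assumes "finite F" "finite S" "F \<inter> S = {}" "\<And>q. q \<in> F \<union> S \<Longrightarrow> 0 \<le> q"
  shows "vandermonde_sq (F \<union> S) = vandermonde_sq F * vandermonde_sq S * (\<Prod>x\<in>S. \<Prod>q\<in>F. \<bar>of_int (x\<^sup>2 - q\<^sup>2)\<bar>)"
  using assms(2-4)
proof (induction S)
  case empty
  then show ?case by simp
next
  case (insert x S)
  have "vandermonde_sq (F \<union> insert x S) = vandermonde_sq (F \<union> S) * (\<Prod>q\<in>F \<union> S. \<bar>of_int (x\<^sup>2 - q\<^sup>2)\<bar>)"
    using insert assms(1) by (subst Un_insert_right, intro vandermonde_sq_insert) auto
  also have "(\<Prod>q\<in>F \<union> S. \<bar>of_int (x\<^sup>2 - q\<^sup>2)\<bar> :: real)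
      = (\<Prod>q\<in>F. \<bar>of_int (x\<^sup>2 - q\<^sup>2)\<bar>) * (\<Prod>q\<in>S. \<bar>of_int (x\<^sup>2 - q\<^sup>2)\<bar>)"
    using insert assms(1) by (intro prod.union_disjoint) auto
  also have "vandermonde_sq (F \<union> S) = vandermonde_sq F * vandermonde_sq S * (\<Prod>x\<in>S. \<Prod>q\<in>F. \<bar>of_int (x\<^sup>2 - q\<^sup>2)\<bar>)"
    using insert by auto
  also have "vandermonde_sq S * (\<Prod>q\<in>S. \<bar>of_int (x\<^sup>2 - q\<^sup>2)\<bar>) = vandermonde_sq (insert x S)"
    using insert by (intro vandermonde_sq_insert[symmetric]) auto
  then have "vandermonde_sq F * vandermonde_sq S * (\<Prod>x\<in>S. \<Prod>q\<in>F. \<bar>of_int (x\<^sup>2 - q\<^sup>2)\<bar>) * ((\<Prod>q\<in>F. \<bar>of_int (x\<^sup>2 - q\<^sup>2)\<bar>) * (\<Prod>q\<in>S. \<bar>of_int (x\<^sup>2 - q\<^sup>2)\<bar>))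
     = vandermonde_sq F * vandermonde_sq (insert x S) * ((\<Prod>q\<in>F. \<bar>of_int (x\<^sup>2 - q\<^sup>2)\<bar>) * (\<Prod>x\<in>S. \<Prod>q\<in>F. \<bar>of_int (x\<^sup>2 - q\<^sup>2)\<bar>))"
    unfolding \<open>vandermonde_sq S * _ = _\<close>[symmetric] by (simp only: mult_ac)
  finally show ?case using insert by simp
qed

lemma vandermonde_sq_pos:
  assumes "finite S" "\<And>q. q \<in> S \<Longrightarrow> 0 \<le> q"
  shows "0 < vandermonde_sq S"
proof -
  have lt: "(of_int p)\<^sup>2 < (of_int q :: real)\<^sup>2" if "p \<in> S" "p < q" for p q
    using that assms(2)[of p] by (intro power_strict_mono) auto
  show ?thesis
    unfolding vandermonde_sq_def by (intro prod_pos) (use lt in auto)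
qed

text \<open>Squaring counts each pair in both orders, which yields for every element the product
  over all others.\<close>

lemma vandermonde_sq_square:
  assumes "finite S" "\<And>q. q \<in> S \<Longrightarrow> 0 \<le> q"
  shows "vandermonde_sq S * vandermonde_sq S = (\<Prod>x\<in>S. \<Prod>q\<in>S - {x}. \<bar>of_int (x\<^sup>2 - q\<^sup>2)\<bar>)"
  using assms
proof (induction S)
  case empty
  then show ?case by simp
next
  case (insert x S)
  let ?f = "\<lambda>x q. \<bar>of_int (x\<^sup>2 - q\<^sup>2)\<bar> :: real"
  have "(\<Prod>q\<in>insert x S - {y}. ?f y q) = ?f x y * (\<Prod>q\<in>S - {y}. ?f y q)" if "y \<in> S" for y
  proof -
    have "insert x S - {y} = insert x (S - {y})" "x \<notin> S - {y}" using that insert by auto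
    then show ?thesis using insert by (simp add: abs_minus_commute)
  qed
  then have "(\<Prod>y\<in>S. \<Prod>q\<in>insert x S - {y}. ?f y q) = (\<Prod>y\<in>S. ?f x y) * (vandermonde_sq S * vandermonde_sq S)"
    using insert by (simp add: prod.distrib)
  moreover have "insert x S - {x} = S" using insert by auto
  moreover have "vandermonde_sq (insert x S) = vandermonde_sq S * (\<Prod>y\<in>S. ?f x y)"
    using insert by (intro vandermonde_sq_insert) auto
  ultimately show ?case using insert by (simp add: mult_ac)
qed

section \<open>Moments of the Racah weight in closed form\<close>

definition central_prod :: "nat \<Rightarrow> real \<Rightarrow> real" where
  "central_prod m x = x * (\<Prod>k<m. x\<^sup>2 - (real k + 1)\<^sup>2)"

lemma central_prod_Suc: "central_prod (Suc m) x = central_prod m x * (x\<^sup>2 - (real m + 1)\<^sup>2)"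
  by (simp add: central_prod_def)

lemma central_prod_add: "central_prod (m + n) x = central_prod m x * (\<Prod>k<n. x\<^sup>2 - (real m + 1 + real k)\<^sup>2)"
  by (induction n) (simp_all add: central_prod_Suc add_ac)

text \<open>The polynomial is the product of the numbers from \<open>x - m\<close> to
  \<open>x + m\<close>, so the shift exchanges one end factor for another.\<close>

lemma central_prod_shift: "central_prod m (x - 1) * (x + real m) = central_prod m x * (x - real m - 1)"
proof (induction m)
  case 0
  show ?case by (simp add: central_prod_def)
next
  case (Suc m)
  have "central_prod (Suc m) (x - 1) * (x + real (Suc m))
      = central_prod m (x - 1) * (x + real m) * ((x - real m - 2) * (x + real m + 1))"
    by (simp add: central_prod_Suc algebra_simps power2_eq_square)
  also have "\<dots> = central_prod (Suc m) x * (x - real (Suc m) - 1)"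
    unfolding Suc by (simp add: central_prod_Suc algebra_simps power2_eq_square)
  finally show ?case .
qed

lemma central_prod_eq_0: "1 \<le> x \<Longrightarrow> x \<le> int m \<Longrightarrow> central_prod m (of_int x) = 0"
  unfolding central_prod_def by (intro mult_eq_0_iff[THEN iffD2] disjI2 prod_zero bexI[of _ "nat (x - 1)"]) auto

lemma central_prod_pochhammer: "central_prod m x = pochhammer (x - real m) (2 * m + 1)"
proof (induction m)
  case 0
  show ?case by (simp add: central_prod_def)
next
  case (Suc m)
  have "pochhammer (x - real (Suc m)) (2 * Suc m + 1)
      = (x - real m - 1) * pochhammer (x - real m) (2 * m + 2)"
    by (simp add: pochhammer_rec)
  also have "pochhammer (x - real m) (2 * m + 2) = pochhammer (x - real m) (2 * m + 1) * (x + real m + 1)"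
    using pochhammer_rec'[of "x - real m" "2 * m + 1"] by (simp add: algebra_simps)
  also have "(x - real m - 1) * (pochhammer (x - real m) (2 * m + 1) * (x + real m + 1))
      = central_prod (Suc m) x"
    unfolding Suc[symmetric] by (simp add: central_prod_Suc algebra_simps power2_eq_square)
  finally show ?case by simp
qed

definition racah :: "nat \<Rightarrow> nat \<Rightarrow> nat \<Rightarrow> nat \<Rightarrow> real" where
  "racah N d m l = (\<Sum>x\<in>{1..int N}. of_int x * central_prod m (of_int x) * central_prod l (of_int x)
      * (\<Prod>q\<in>{N<..N + d}. (real q)\<^sup>2 - (of_int x)\<^sup>2))"

text \<open>The right side is an antidifference in \<open>N\<close> of the summand. After
  \<open>central_prod_shift\<close> the step comes down to \<open>(x + m + 1) * (x + l + 1) - (x - m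
  - 1) * (x - l - 1) = 2 * x * (m + l + 2)\<close>.\<close>

lemma racah_0: "racah N 0 m l * (2 * (real (m + l) + 2))
    = central_prod m (real N) * central_prod l (real N) * (real N + real m + 1) * (real N + real l + 1)"
proof (induction N)
  case 0
  show ?case by (simp add: racah_def central_prod_def)
next
  case (Suc N)
  let ?x = "real N + 1"
  have "{1..int (Suc N)} = insert (int N + 1) {1..int N}" by auto
  then have "racah (Suc N) 0 m l = ?x * central_prod m ?x * central_prod l ?x + racah N 0 m l"
    by (simp add: racah_def)
  then have "racah (Suc N) 0 m l * (2 * (real (m + l) + 2))
      = central_prod m ?x * central_prod l ?x * (?x * (2 * (real (m + l) + 2)))
        + (central_prod m (?x - 1) * (?x + real m)) * (central_prod l (?x - 1) * (?x + real l))"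
    using Suc by (simp add: algebra_simps)
  also have "\<dots> = central_prod m ?x * central_prod l ?x * (?x + real m + 1) * (?x + real l + 1)"
    unfolding central_prod_shift by (simp add: algebra_simps)
  finally show ?case by (simp add: add_ac)
qed

text \<open>The new factor \<open>(N + d + 1)\<^sup>2 - x\<^sup>2\<close> is
  \<open>(N + d + 1)\<^sup>2 - (m + 1)\<^sup>2\<close> minus
  \<open>x\<^sup>2 - (m + 1)\<^sup>2\<close>, and the latter raises \<open>central_prod m\<close> to
  \<open>central_prod (Suc m)\<close>.\<close>

lemma racah_Suc:
  "racah N (Suc d) m l = ((real (N + d) + 1)\<^sup>2 - (real m + 1)\<^sup>2) * racah N d m l - racah N d (Suc m) l"
proof -
  have "{N<..N + Suc d} = insert (N + d + 1) {N<..N + d}" by auto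
  then have "(\<Prod>q\<in>{N<..N + Suc d}. (real q)\<^sup>2 - X) = ((real (N + d) + 1)\<^sup>2 - X) * (\<Prod>q\<in>{N<..N + d}. (real q)\<^sup>2 - X)" for X
    by (simp add: add_ac)
  note split = this
  show ?thesis
    unfolding racah_def sum_distrib_left sum_subtractf[symmetric]
  proof (rule sum.cong[OF refl])
    fix x
    show "of_int x * central_prod m (of_int x) * central_prod l (of_int x) * (\<Prod>q\<in>{N<..N + Suc d}. (real q)\<^sup>2 - (of_int x)\<^sup>2)
      = ((real (N + d) + 1)\<^sup>2 - (real m + 1)\<^sup>2) * (of_int x * central_prod m (of_int x) * central_prod l (of_int x)
          * (\<Prod>q\<in>{N<..N + d}. (real q)\<^sup>2 - (of_int x)\<^sup>2))
        - of_int x * central_prod (Suc m) (of_int x) * central_prod l (of_int x) * (\<Prod>q\<in>{N<..N + d}. (real q)\<^sup>2 - (of_int x)\<^sup>2)"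
      unfolding split central_prod_Suc by (simp add: algebra_simps)
  qed
qed

text \<open>The product of the consecutive numbers from \<open>N - m\<close> to
  \<open>N + m + d + 1\<close>, see \<open>racah_factor_pochhammer\<close>. Two such factors carry
  the whole dependence of a moment on \<open>N\<close>.\<close>

definition racah_factor :: "nat \<Rightarrow> nat \<Rightarrow> nat \<Rightarrow> real" where
  "racah_factor N d m = central_prod m (real N) * pochhammer (real N + real m + 1) (Suc d)"

text \<open>The very-well-poised terminating sum behind the norms of the Racah polynomials.\<close>

lemma racah_closed_form:
  "racah N d m l = fact d / 2 * (fact (m + l + 1) / fact (m + l + 2 + d)) * racah_factor N d m * racah_factor N d l"
proof (induction d arbitrary: m)
  case 0
  define F :: real where "F = fact (m + l + 1)"
  have F: "F \<noteq> 0" "fact (m + l + 2) = (real (m + l) + 2) * F"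
    unfolding F_def by (rule fact_nonzero) (simp add: algebra_simps)
  have "racah N 0 m l = (central_prod m (real N) * (real N + real m + 1)) * (central_prod l (real N) * (real N + real l + 1)) / (2 * (real (m + l) + 2))"
    using racah_0[of N m l] by (simp add: eq_divide_eq mult_ac)
  also have "\<dots> = 1 / 2 * (F / ((real (m + l) + 2) * F)) * (central_prod m (real N) * (real N + real m + 1)) * (central_prod l (real N) * (real N + real l + 1))"
    using F(1) by simp
  finally show ?case
    using F(2) by (simp only: racah_factor_def F_def[symmetric] add_0_right fact_0) simp
next
  case (Suc d)
  let ?s = "m + l"
  let ?A = "racah_factor N d m" and ?B = "racah_factor N d l"
  have f1: "racah_factor N (Suc d) k = racah_factor N d k * (real N + real k + real d + 2)" for k
    by (simp add: racah_factor_def pochhammer_rec' algebra_simps)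
  have f2: "racah_factor N d (Suc m) = (real N - real m - 1) * racah_factor N (Suc d) m"
  proof -
    have "pochhammer (real N + real m + 1) (Suc (Suc d))
        = (real N + real m + 1) * pochhammer (real N + real (Suc m) + 1) (Suc d)"
      by (subst pochhammer_rec) (simp add: add_ac)
    then show ?thesis by (simp add: racah_factor_def central_prod_Suc algebra_simps power2_eq_square)
  qed
  have fa: "fact (?s + 2) = (real ?s + 2) * fact (?s + 1)" "fact (?s + 3 + d) = (real ?s + 3 + real d) * fact (?s + 2 + d)"
    by (simp_all add: algebra_simps eval_nat_numeral)
  \<comment> \<open>The induction hypothesis for \<open>racah N d m l\<close>; the moment with
    \<open>Suc m\<close> is written as a multiple of it.\<close>
  define c where "c = fact d / 2 * fact (?s + 1) / fact (?s + 2 + d) * ?A * ?B"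
  have pos: "real ?s + 3 + real d \<noteq> 0" by linarith
  have "racah N (Suc d) m l = ((real (N + d) + 1)\<^sup>2 - (real m + 1)\<^sup>2) * c - racah N d (Suc m) l"
    unfolding racah_Suc Suc c_def by simp
  also have "racah N d (Suc m) l = c * ((real ?s + 2) / (real ?s + 3 + real d) * (real N - real m - 1) * (real N + real m + real d + 2))"
  proof -
    have e: "Suc m + l + 1 = ?s + 2" "Suc m + l + 2 + d = ?s + 3 + d" by simp_all
    show ?thesis unfolding Suc[of "Suc m"] e fa f2 f1 c_def by (simp add: mult_ac del: fact_Suc)
  qed
  also have "((real (N + d) + 1)\<^sup>2 - (real m + 1)\<^sup>2) * c - c * ((real ?s + 2) / (real ?s + 3 + real d) * (real N - real m - 1) * (real N + real m + real d + 2))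
      = c * (real N + real m + real d + 2) / (real ?s + 3 + real d) *
        ((real N + real d - real m) * (real ?s + 3 + real d) - (real ?s + 2) * (real N - real m - 1))"
    using pos by (simp add: field_simps power2_eq_square)
  \<comment> \<open>The bracket splits into linear factors, and \<open>N + l + d + 2\<close> is just
    what \<open>racah_factor N d l\<close> lacks; so the symmetry in \<open>m\<close> and
    \<open>l\<close> is restored.\<close>
  also have "(real N + real d - real m) * (real ?s + 3 + real d) - (real ?s + 2) * (real N - real m - 1)
      = (real d + 1) * (real N + real l + real d + 2)"
    by (simp add: algebra_simps)
  also have "c * (real N + real m + real d + 2) / (real ?s + 3 + real d) * ((real d + 1) * (real N + real l + real d + 2))
      = fact (Suc d) / 2 * (fact (?s + 1) / fact (?s + 2 + Suc d)) * racah_factor N (Suc d) m * racah_factor N (Suc d) l"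
  proof -
    have e: "?s + 2 + Suc d = ?s + 3 + d" by simp
    show ?thesis unfolding e fa f1 c_def by (simp add: field_simps)
  qed
  finally show ?case .
qed

lemma racah_factor_pochhammer:
  "racah_factor N d m = pochhammer (real N - real m) (2 * m + d + 2)"
proof -
  have "pochhammer (real N - real m) ((2 * m + 1) + Suc d)
      = pochhammer (real N - real m) (2 * m + 1) * pochhammer (real N - real m + real (2 * m + 1)) (Suc d)"
    by (rule pochhammer_product')
  then show ?thesis by (simp add: racah_factor_def central_prod_pochhammer algebra_simps)
qed

text \<open>Read from the largest index downwards, the starting points rise by 1 and the lengths
  fall by 2, which is the shape of \<open>T\<close>. The cases \<open>c = a\<close> and
  \<open>c = 0\<close> give the two factors \<open>T\<close> of the theorem.\<close>

lemma prod_racah_factor: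
  assumes "c \<le> a"
  shows "(\<Prod>i<y. racah_factor (a + x + y) d (c + i)) = T (x + (a - c) + 1) (2 * c + 2 * y + d) y"
proof -
  have "(\<Prod>i<y. racah_factor (a + x + y) d (c + i)) = (\<Prod>i<y. racah_factor (a + x + y) d (c + (y - Suc i)))"
    by (rule prod.nat_diff_reindex[symmetric])
  also have "\<dots> = T (x + (a - c) + 1) (2 * c + 2 * y + d) y"
    unfolding T_def
  proof (rule prod.cong[OF refl])
    fix i assume "i \<in> {..<y}"
    then have i: "i < y" by simp
    have "real (a + x + y) - real (c + (y - Suc i)) = real (x + (a - c) + 1 + i)"
      using i assms by (simp add: of_nat_diff)
    moreover have "2 * (c + (y - Suc i)) + d + 2 = 2 * c + 2 * y + d - 2 * i" using i by simp
    ultimately show "racah_factor (a + x + y) d (c + (y - Suc i)) = pochhammer (real (x + (a - c) + 1 + i)) (2 * c + 2 * y + d - 2 * i)"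
      by (simp only: racah_factor_pochhammer)
  qed
  finally show ?thesis .
qed

text \<open>The set consists of the distances from the axis outside the gap:
  \<open>{0..int a}\<close> belongs to the western fern and the extra dent at 0,
  \<open>{int N<..int K}\<close> to the eastern fern and the triangle of side \<open>z\<close>. The
  single factor \<open>x\<close> comes from the lower half.\<close>

definition selberg_weight :: "nat \<Rightarrow> nat \<Rightarrow> nat \<Rightarrow> int \<Rightarrow> real" where
  "selberg_weight a N K x = of_int x * (\<Prod>q\<in>{0..int a} \<union> {int N<..int K}. \<bar>of_int (x\<^sup>2 - q\<^sup>2)\<bar>)"

definition selberg_sum :: "nat \<Rightarrow> nat \<Rightarrow> nat \<Rightarrow> nat \<Rightarrow> real" where
  "selberg_sum a N K y = (\<Sum>S | S \<subseteq> {int a<..int N} \<and> card S = y. vandermonde_sq S * vandermonde_sq S * (\<Prod>x\<in>S. selberg_weight a N K x))"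

text \<open>On the gap all signs are known. The distance \<open>q = 0\<close> contributes
  \<open>x\<^sup>2\<close>; together with the factor \<open>x\<close> of the weight this is one
  \<open>x\<close> for the measure and one for each of two odd polynomials.\<close>

lemma selberg_sum_weight_pw:
  assumes x: "int a < x" "x \<le> int N" and "a \<le> N"
  shows "selberg_weight a N (N + d) x = of_int x * central_prod a (of_int x) * central_prod 0 (of_int x)
      * (\<Prod>q\<in>{N<..N + d}. (real q)\<^sup>2 - (of_int x)\<^sup>2)"
proof -
  let ?f = "\<lambda>q. \<bar>of_int (x\<^sup>2 - q\<^sup>2)\<bar> :: real"
  have abs1: "?f q = (of_int x)\<^sup>2 - (of_int q)\<^sup>2" if "0 \<le> q" "q \<le> x" for q
    using that power_mono[of q x 2] by (auto simp flip: of_int_power)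
  have abs2: "?f q = (of_int q)\<^sup>2 - (of_int x)\<^sup>2" if "x \<le> q" for q
    using that x power_mono[of x q 2] by (auto simp flip: of_int_power)
  have "(\<Prod>q\<in>{0..int a} \<union> {int N<..int (N + d)}. ?f q)
      = (\<Prod>q\<in>{0..int a}. ?f q) * (\<Prod>q\<in>{int N<..int (N + d)}. ?f q)"
    using assms(3) by (intro prod.union_disjoint) auto
  also have "(\<Prod>q\<in>{0..int a}. ?f q) = (\<Prod>q\<in>{0..int a}. (of_int x)\<^sup>2 - (of_int q)\<^sup>2)"
    using x by (intro prod.cong abs1) auto
  also have "\<dots> = (\<Prod>k<Suc a. (of_int x)\<^sup>2 - (real k)\<^sup>2)"
    by (rule prod.reindex_bij_witness[of _ int nat]) auto
  also have "\<dots> = (of_int x)\<^sup>2 * (\<Prod>k<a. (of_int x)\<^sup>2 - (real k + 1)\<^sup>2)"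
    by (subst prod.lessThan_Suc_shift) (simp add: add_ac)
  also have "(\<Prod>q\<in>{int N<..int (N + d)}. ?f q) = (\<Prod>q\<in>{int N<..int (N + d)}. (of_int q)\<^sup>2 - (of_int x)\<^sup>2)"
    using x by (intro prod.cong abs2) auto
  also have "\<dots> = (\<Prod>q\<in>{N<..N + d}. (real q)\<^sup>2 - (of_int x)\<^sup>2)"
    by (rule prod.reindex_bij_witness[of _ int nat]) auto
  finally show ?thesis by (simp add: selberg_weight_def central_prod_def power2_eq_square)
qed

text \<open>The parameter \<open>x\<close> enters the moments only through \<open>a + x + y\<close>,
  hence only through \<open>racah_factor\<close>. The constant \<open>c\<close> is the determinant
  left over; it may depend on everything but \<open>x\<close>.\<close>

lemma selberg_sum_eq_T:
  obtains c where "\<And>x. selberg_sum a (a + x + y) (a + x + y + d) y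
    = c * T (x + 1) (2 * a + 2 * y + d) y * T (x + a + 1) (2 * y + d) y"
proof
  fix x
  let ?N = "a + x + y"
  let ?G = "{int a<..int ?N}"
  \<comment> \<open>The nodes continue \<open>central_prod a\<close> in the first basis and
    \<open>central_prod 0\<close> in the second, so that weight times basis elements is again a
    product of two central products.\<close>
  let ?f = "\<lambda>i x. \<Prod>k<i. (of_int x)\<^sup>2 - (real a + 1 + real k)\<^sup>2"
  let ?g = "\<lambda>i x. \<Prod>k<i. (of_int x)\<^sup>2 - (real k + 1)\<^sup>2"
  have "selberg_sum a ?N (?N + d) y = (\<Sum>S | S \<subseteq> ?G \<and> card S = y. (\<Prod>x\<in>S. selberg_weight a ?N (?N + d) x)
      * (fdet y (\<lambda>i j. ?f j (nth_elem S i)) * fdet y (\<lambda>i j. ?g j (nth_elem S i))))"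
    unfolding selberg_sum_def
  proof (rule sum.cong[OF refl])
    fix S assume "S \<in> {S. S \<subseteq> ?G \<and> card S = y}"
    then have S: "finite S" "card S = y" by (auto intro: finite_subset)
    show "vandermonde_sq S * vandermonde_sq S * (\<Prod>x\<in>S. selberg_weight a ?N (?N + d) x) = (\<Prod>x\<in>S. selberg_weight a ?N (?N + d) x)
      * (fdet y (\<lambda>i j. ?f j (nth_elem S i)) * fdet y (\<lambda>i j. ?g j (nth_elem S i)))"
      unfolding fdet_newton_vd[OF S] by simp
  qed
  also have "\<dots> = fdet y (\<lambda>i j. \<Sum>x\<in>?G. selberg_weight a ?N (?N + d) x * ?f i x * ?g j x)"
    by (rule andreief) simp
  also have "\<dots> = fdet y (\<lambda>i j. racah ?N d (a + i) j)"
  proof (rule fdet_cong)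
    fix i j
    let ?h = "\<lambda>x. of_int x * central_prod (a + i) (of_int x) * central_prod j (of_int x) * (\<Prod>q\<in>{?N<..?N + d}. (real q)\<^sup>2 - (of_int x)\<^sup>2)"
    have "(\<Sum>x\<in>?G. selberg_weight a ?N (?N + d) x * ?f i x * ?g j x) = (\<Sum>x\<in>?G. ?h x)"
    proof (rule sum.cong[OF refl])
      fix x assume "x \<in> ?G"
      then have "selberg_weight a ?N (?N + d) x = of_int x * central_prod a (of_int x) * central_prod 0 (of_int x)
          * (\<Prod>q\<in>{?N<..?N + d}. (real q)\<^sup>2 - (of_int x)\<^sup>2)"
        by (intro selberg_sum_weight_pw) auto
      then show "selberg_weight a ?N (?N + d) x * ?f i x * ?g j x = ?h x"
        using central_prod_add[of 0 j "of_int x"] by (simp add: central_prod_add add_ac)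
    qed
    \<comment> \<open>The added terms vanish, because \<open>central_prod (a + i)\<close> has the
      zeros 1 to \<open>a + i\<close>. Only on the full range is the sum known in closed
      form.\<close>
    also have "\<dots> = (\<Sum>x\<in>{1..int ?N}. ?h x)"
      by (rule sum.mono_neutral_left) (auto intro!: central_prod_eq_0)
    finally show "(\<Sum>x\<in>?G. selberg_weight a ?N (?N + d) x * ?f i x * ?g j x) = racah ?N d (a + i) j"
      by (simp only: racah_def)
  qed
  also have "\<dots> = fdet y (\<lambda>i j. racah_factor ?N d (a + i) * racah_factor ?N d j
      * (fact d / 2 * (fact (a + i + j + 1) / fact (a + i + j + 2 + d))))"
    by (rule fdet_cong) (simp only: racah_closed_form mult_ac)
  also have "\<dots> = (\<Prod>i<y. racah_factor ?N d (a + i)) * (\<Prod>i<y. racah_factor ?N d (0 + i))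
      * fdet y (\<lambda>i j. fact d / 2 * (fact (a + i + j + 1) / fact (a + i + j + 2 + d)))"
    by (simp only: fdet_scale add_0)
  also have "(\<Prod>i<y. racah_factor ?N d (a + i)) = T (x + 1) (2 * a + 2 * y + d) y"
    by (subst prod_racah_factor) auto
  also have "(\<Prod>i<y. racah_factor ?N d (0 + i)) = T (x + a + 1) (2 * y + d) y"
    by (subst prod_racah_factor) auto
  finally show "selberg_sum a ?N (?N + d) y = fdet y (\<lambda>i j. fact d / 2 * (fact (a + i + j + 1) / fact (a + i + j + 2 + d)))
      * T (x + 1) (2 * a + 2 * y + d) y * T (x + a + 1) (2 * y + d) y"
    by (simp only: mult_ac)
qed

text \<open>The differences give \<open>fact x * fact n\<close>. The sums \<open>x + q\<close> give
  the factorial of \<open>2 * x + n\<close> divided by that of \<open>x - 1\<close>, with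
  \<open>2 * x\<close> left out.\<close>

lemma prod_square_diff:
  assumes "1 \<le> x"
  shows "(\<Prod>q\<in>{..x + n} - {x}. \<bar>(real x)\<^sup>2 - (real q)\<^sup>2\<bar>) = fact n * fact (2 * x + n) / 2"
proof (induction n)
  case 0
  have "(\<Prod>q\<in>{..x + 0} - {x}. \<bar>(real x)\<^sup>2 - (real q)\<^sup>2\<bar>) = (\<Prod>q<x. (real x - real q) * (real x + real q))"
  proof (rule prod.cong)
    fix q assume "q \<in> {..<x}"
    then have "(real q)\<^sup>2 \<le> (real x)\<^sup>2" by (intro power_mono) auto
    then show "\<bar>(real x)\<^sup>2 - (real q)\<^sup>2\<bar> = (real x - real q) * (real x + real q)"
      by (simp add: algebra_simps power2_eq_square)
  qed auto
  also have "\<dots> = (\<Prod>q<x. real x - real q) * pochhammer (real x) x"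
    by (simp add: prod.distrib pochhammer_prod lessThan_atLeast0)
  also have "(\<Prod>q<x. real x - real q) = fact x"
  proof -
    have "(\<Prod>q<x. real x - real q) = (\<Prod>q<x. real x - real (x - Suc q))"
      by (rule prod.nat_diff_reindex[symmetric])
    also have "\<dots> = (\<Prod>q<x. real (Suc q))"
      by (intro prod.cong refl) (simp add: of_nat_diff)
    also have "\<dots> = fact x" by (simp add: fact_prod_Suc lessThan_atLeast0)
    finally show ?thesis .
  qed
  also have "fact x * pochhammer (real x) x = fact (2 * x) / 2"
  proof -
    obtain x' where x': "x = Suc x'" using assms by (cases x) auto
    have "fact (x' + x) = fact x' * pochhammer (real x) x"
      using pochhammer_product'[of "1 :: real" x' x] by (simp add: pochhammer_fact[symmetric] x' add_ac)
    moreover have "fact (2 * x) = 2 * real x * fact (x' + x)"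
    proof -
      have e: "2 * x = Suc (x' + x)" by (simp add: x')
      have "real (Suc (x' + x)) = 2 * real x" by (simp add: x')
      then show ?thesis unfolding e fact_Suc by simp
    qed
    moreover have "fact x = real x * (fact x' :: real)" by (simp add: x')
    ultimately show ?thesis by simp
  qed
  finally show ?case by simp
next
  case (Suc n)
  have "{..x + Suc n} - {x} = insert (x + Suc n) ({..x + n} - {x})" by auto
  then have "(\<Prod>q\<in>{..x + Suc n} - {x}. \<bar>(real x)\<^sup>2 - (real q)\<^sup>2\<bar>)
      = \<bar>(real x)\<^sup>2 - (real (x + Suc n))\<^sup>2\<bar> * (fact n * fact (2 * x + n) / 2)"
    using Suc by simp
  also have "\<bar>(real x)\<^sup>2 - (real (x + Suc n))\<^sup>2\<bar> = (real n + 1) * (2 * real x + real n + 1)"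
  proof -
    have "(real x)\<^sup>2 - (real (x + Suc n))\<^sup>2 = - ((real n + 1) * (2 * real x + real n + 1))"
      by (simp add: algebra_simps power2_eq_square)
    then show ?thesis by (simp only: abs_minus_cancel) (simp add: abs_mult)
  qed
  finally show ?case by (simp add: algebra_simps)
qed

lemma H_add: "H (m + n) = H m * (\<Prod>i<n. fact (m + i))"
  by (induction n) (simp_all add: H_def)

lemma H_pos: "0 < H n"
  by (simp add: H_def prod_pos)

text \<open>Each \<open>x\<close> contributes itself times a value of
  \<open>prod_square_diff\<close>. The halves there give the power of 2, the factors
  \<open>x\<close> the quotient of factorials, and the two families of consecutive factorials the
  quotients of \<open>H\<close>.\<close>

lemma selberg_sum_full:
  "selberg_sum a (a + y) (a + y + d) y = 2 powi (- int y) * (fact (a + y) / fact a)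
     * (H (2 * a + 2 * y + d + 1) * H (y + d) / (H (2 * a + y + d + 1) * H d))"
proof -
  let ?N = "a + y" and ?M = "a + y + d"
  let ?G = "{int a<..int ?N}"
  let ?f = "\<lambda>x q. \<bar>of_int (x\<^sup>2 - q\<^sup>2)\<bar> :: real"
  have "{S. S \<subseteq> ?G \<and> card S = y} = {?G}"
    using card_subset_eq[of ?G] by auto
  then have "selberg_sum a ?N ?M y = vandermonde_sq ?G * vandermonde_sq ?G * (\<Prod>x\<in>?G. selberg_weight a ?N ?M x)"
    by (simp add: selberg_sum_def)
  also have "vandermonde_sq ?G * vandermonde_sq ?G = (\<Prod>x\<in>?G. \<Prod>q\<in>?G - {x}. ?f x q)"
    by (rule vandermonde_sq_square) auto
  \<comment> \<open>Gap and ferns together fill the interval from 0 to \<open>a + y + d\<close>, so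
    for every \<open>x\<close> the product extends over all other distances.\<close>
  also have "\<dots> * (\<Prod>x\<in>?G. selberg_weight a ?N ?M x) = (\<Prod>x\<in>?G. of_int x * (\<Prod>q\<in>{0..int ?M} - {x}. ?f x q))"
    unfolding prod.distrib[symmetric]
  proof (rule prod.cong[OF refl])
    fix x assume x: "x \<in> ?G"
    have "{0..int ?M} - {x} = (?G - {x}) \<union> ({0..int a} \<union> {int ?N<..int ?M})" using x by auto
    moreover have "(?G - {x}) \<inter> ({0..int a} \<union> {int ?N<..int ?M}) = {}" by auto
    ultimately have "(\<Prod>q\<in>{0..int ?M} - {x}. ?f x q)
        = (\<Prod>q\<in>?G - {x}. ?f x q) * (\<Prod>q\<in>{0..int a} \<union> {int ?N<..int ?M}. ?f x q)"
      using prod.union_disjoint[of "?G - {x}" "{0..int a} \<union> {int ?N<..int ?M}" "?f x"] by simp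
    then show "(\<Prod>q\<in>?G - {x}. ?f x q) * selberg_weight a ?N ?M x = of_int x * (\<Prod>q\<in>{0..int ?M} - {x}. ?f x q)"
      by (simp add: selberg_weight_def)
  qed
  also have "\<dots> = (\<Prod>i<y. real (a + 1 + i) * (fact (d + (y - Suc i)) * fact (2 * a + y + d + 1 + i) / 2))"
  proof (rule prod.reindex_bij_witness[of _ "\<lambda>i. int (a + 1 + i)" "\<lambda>x. nat (x - int a - 1)"])
    fix x assume x: "x \<in> ?G"
    define i where "i = nat (x - int a - 1)"
    have xi: "x = int (a + 1 + i)" and i: "i < y" using x by (auto simp: i_def)
    have "(\<Prod>q\<in>{0..int ?M} - {x}. ?f x q) = (\<Prod>q\<in>{..a + 1 + i + (d + (y - Suc i))} - {a + 1 + i}. \<bar>(real (a + 1 + i))\<^sup>2 - (real q)\<^sup>2\<bar>)"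
      by (rule prod.reindex_bij_witness[of _ int nat]) (use i in \<open>auto simp: xi\<close>)
    also have "\<dots> = fact (d + (y - Suc i)) * fact (2 * (a + 1 + i) + (d + (y - Suc i))) / 2"
      by (rule prod_square_diff) simp
    also have "2 * (a + 1 + i) + (d + (y - Suc i)) = 2 * a + y + d + 1 + i" using i by simp
    finally show "real (a + 1 + nat (x - int a - 1)) * (fact (d + (y - Suc (nat (x - int a - 1)))) * fact (2 * a + y + d + 1 + nat (x - int a - 1)) / 2)
        = of_int x * (\<Prod>q\<in>{0..int ?M} - {x}. ?f x q)"
      unfolding i_def[symmetric] by (simp add: xi)
  qed auto
  also have "\<dots> = (\<Prod>i<y. real (a + 1 + i)) * (\<Prod>i<y. fact (d + (y - Suc i))) * (\<Prod>i<y. fact (2 * a + y + d + 1 + i)) / 2 ^ y"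
    by (simp add: prod.distrib prod_dividef)
  also have "(\<Prod>i<y. real (a + 1 + i)) = fact (a + y) / fact a"
  proof (induction y)
    case (Suc y)
    have "fact (a + Suc y) = real (a + 1 + y) * fact (a + y)" by (simp add: algebra_simps)
    then show ?case using Suc by simp
  qed simp
  also have "(\<Prod>i<y. fact (d + (y - Suc i))) = (\<Prod>i<y. fact (d + i) :: real)"
    by (rule prod.nat_diff_reindex)
  also have "\<dots> = H (y + d) / H d"
    using H_add[of d y] H_pos[of d] by (simp add: add.commute)
  also have "(\<Prod>i<y. fact (2 * a + y + d + 1 + i)) = H (2 * a + 2 * y + d + 1) / H (2 * a + y + d + 1)"
  proof -
    have e: "2 * a + 2 * y + d + 1 = 2 * a + y + d + 1 + y" by simp
    show ?thesis
      unfolding e H_add[of "2 * a + y + d + 1" y] using H_pos[of "2 * a + y + d + 1"] by simp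
  qed
  finally show ?thesis by (simp add: power_int_minus field_simps)
qed

section \<open>Trapezoids with dents and holes\<close>

definition row_ups :: "int set \<Rightarrow> face set" where
  "row_ups S = (\<lambda>i. up_face i 0) ` S"

lemma up_in_row_ups [simp]: "up_face i k \<in> row_ups S \<longleftrightarrow> k = 0 \<and> i \<in> S"
  by (auto simp: row_ups_def)

lemma down_in_row_ups [simp]: "down_face i k \<notin> row_ups S"
  by (auto simp: row_ups_def)

context zigzag_trap
begin

lemma dent_set:
  assumes "finite S" "S \<subseteq> {lo 0..<W}" "card S = n"
  shows "M w (trap lo W h 0 - row_ups S) = dent_M 0 n (nth_elem S)" "dent_seq 0 n (nth_elem S)"
proof -
  have bij: "bij_betw (nth_elem S) {..<n} S" using nth_elem_bij[OF assms(1)] assms(3) by simp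
  have "row_ups S = (\<lambda>s. up_face (nth_elem S s) 0) ` {..<n}"
    using bij image_image[of "\<lambda>i. up_face i 0" "nth_elem S" "{..<n}"] by (simp add: row_ups_def bij_betw_def)
  then show "M w (trap lo W h 0 - row_ups S) = dent_M 0 n (nth_elem S)"
    by (simp add: dent_M_def)
  show "dent_seq 0 n (nth_elem S)"
    unfolding dent_seq_def using nth_elem_strict_mono[OF assms(1)] bij_betwE[OF bij] assms(2,3)
    by auto
qed

lemma vandermonde_sq_shift:
  assumes "finite S" "card S = n"
  shows "(\<Prod>j<n. \<Prod>i<j. (of_int (nth_elem S j + c))\<^sup>2 - (of_int (nth_elem S i + c))\<^sup>2) = vandermonde_sq ((\<lambda>p. p + c) ` S)"
proof (rule vandermonde_sq_enum)
  have "bij_betw (nth_elem S) {..<n} S" using nth_elem_bij[OF assms(1)] assms(2) by simp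
  moreover have "bij_betw (\<lambda>p. p + c) S ((\<lambda>p. p + c) ` S)" by (auto simp: bij_betw_def inj_on_def)
  ultimately show "bij_betw (\<lambda>i. nth_elem S i + c) {..<n} ((\<lambda>p. p + c) ` S)"
    using bij_betw_trans by (fastforce simp: comp_def)
  show "nth_elem S i + c < nth_elem S j + c" if "i < j" "j < n" for i j
    using nth_elem_strict_mono[OF assms(1)] that assms(2) by simp
qed

text \<open>In the squared distances the polynomials \<open>even_central\<close> form a Newton
  basis, so the nodes drop out of the determinant.\<close>

lemma M_even:
  assumes "finite S" "S \<subseteq> {lo 0..<W}" "card S = Suc n" and \<pi>: "even \<pi>" and "\<sigma> = 0" and h: "h = 2 * int n + 1"
  shows "M w (trap lo W h 0 - row_ups S) = vandermonde_sq ((\<lambda>p. p - lo 0) ` S) / (\<Prod>j<Suc n. fact (2 * j))"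
proof -
  have "dent_M 0 (Suc n) (nth_elem S) = fdet (Suc n) (\<lambda>i j. even_central j (of_int (nth_elem S i - lo 0) + \<sigma>)) / (\<Prod>j<Suc n. fact (2 * j))"
    using rows[of n, THEN conjunct2, rule_format, of 0 "nth_elem S"] \<pi> h dent_set[OF assms(1-3)] by simp
  also have "fdet (Suc n) (\<lambda>i j. even_central j (of_int (nth_elem S i - lo 0) + \<sigma>)) = vandermonde_sq ((\<lambda>p. p - lo 0) ` S)"
    unfolding even_central_def fdet_newton using vandermonde_sq_shift[OF assms(1,3), of "- lo 0"] \<open>\<sigma> = 0\<close> by simp
  finally show ?thesis using dent_set(1)[OF assms(1-3)] by simp
qed

text \<open>Here every row also has the factor \<open>x\<close> of \<open>odd_central\<close>; it
  comes out as the product of the distances.\<close>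

lemma M_odd:
  assumes "finite S" "S \<subseteq> {lo 0..<W}" "card S = n" and \<pi>: "odd \<pi>" and "\<sigma> = 1 / 2" and h: "h = 2 * int n"
  shows "M w (trap lo W h 0 - row_ups S)
    = (\<Prod>p\<in>S. of_int (p - lo 0 + 1)) * vandermonde_sq ((\<lambda>p. p - lo 0 + 1) ` S) / (\<Prod>j<n. fact (2 * j + 1))"
proof -
  let ?x = "\<lambda>i. of_int (nth_elem S i - lo 0 + 1) :: real"
  have bij: "bij_betw (nth_elem S) {..<n} S" using nth_elem_bij[OF assms(1)] assms(3) by simp
  have "dent_M 0 n (nth_elem S) = fdet n (\<lambda>i j. odd_central j (of_int (nth_elem S i - lo 0) + \<sigma> + 1 / 2)) / (\<Prod>j<n. fact (2 * j + 1))"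
    using rows[of n, THEN conjunct1, rule_format, of 0 "nth_elem S"] \<pi> h dent_set[OF assms(1-3)] by simp
  also have "fdet n (\<lambda>i j. odd_central j (of_int (nth_elem S i - lo 0) + \<sigma> + 1 / 2)) = fdet n (\<lambda>i j. ?x i * (\<Prod>m<j. (?x i)\<^sup>2 - (real m + 1)\<^sup>2))"
    by (simp add: odd_central_def \<open>\<sigma> = 1 / 2\<close> add.assoc)
  also have "\<dots> = (\<Prod>i<n. ?x i) * vandermonde_sq ((\<lambda>p. p - lo 0 + 1) ` S)"
    unfolding fdet_prod_rows fdet_newton using vandermonde_sq_shift[OF assms(1,3), of "1 - lo 0"]
    by (simp add: algebra_simps)
  also have "(\<Prod>i<n. ?x i) = (\<Prod>p\<in>S. of_int (p - lo 0 + 1))"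
    by (rule prod.reindex_bij_betw[OF bij])
  finally show ?thesis using dent_set(1)[OF assms(1-3)] by simp
qed

end

text \<open>A cell \<open>(i, k)\<close> stands for the vertical lozenge around a horizontal edge.
  At height 0 only its upper triangle is taken, since the lower one is beyond the base line.\<close>

definition hole :: "(int \<times> int) set \<Rightarrow> face set" where
  "hole A = {up_face i k | i k. (i, k) \<in> A \<and> 0 \<le> k} \<union> {down_face i k | i k. (i, k) \<in> A \<and> 1 \<le> k}"

lemma up_in_hole [simp]: "up_face i k \<in> hole A \<longleftrightarrow> (i, k) \<in> A \<and> 0 \<le> k"
  by (auto simp: hole_def)

lemma down_in_hole [simp]: "down_face i k \<in> hole A \<longleftrightarrow> (i, k) \<in> A \<and> 1 \<le> k"
  by (auto simp: hole_def)

lemma face_set_eqI: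
  assumes "\<And>f. f \<in> A \<Longrightarrow> unit_triangle f" "\<And>f. f \<in> B \<Longrightarrow> unit_triangle f"
    and "\<And>i k. up_face i k \<in> A \<longleftrightarrow> up_face i k \<in> B"
    and "\<And>i k. down_face i k \<in> A \<longleftrightarrow> down_face i k \<in> B"
  shows "A = B"
proof (rule Set.set_eqI)
  fix f show "f \<in> A \<longleftrightarrow> f \<in> B"
  proof (cases "unit_triangle f")
    case True
    then show ?thesis
    proof (rule unit_triangle_cases)
      fix i k assume "f = up_face i k"
      then show ?thesis using assms(3) by simp
    next
      fix i k assume "f = down_face i k"
      then show ?thesis using assms(4) by simp
    qed
  next
    case False
    then show ?thesis using assms(1,2) by blast
  qed
qed

text \<open>The inner horizontal lines carry equally many triangles of both orientations. Only the
  bottom line, reduced by the dents, and the top line differ; so a trapezoid with a tiling dictates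
  the number of its dents.\<close>

lemma trap_balanced:
  assumes h: "1 \<le> h" and wide: "\<And>j. 0 \<le> j \<Longrightarrow> j \<le> h \<Longrightarrow> lo j \<le> W - j"
    and S: "S \<subseteq> {lo 0..<W}" and nz: "M w (trap lo W h 0 - row_ups S) \<noteq> 0"
  shows "int (card S) = h + lo h - lo 0"
proof -
  let ?R = "trap lo W h 0 - row_ups S"
  let ?A = "\<lambda>J. SIGMA j:J. {lo j..<W - j}"
  have fS: "finite S" using S finite_subset by blast
  have crd: "int (card (?A J)) = (\<Sum>j\<in>J. W - j - lo j)" if "J \<subseteq> {0..h}" for J
  proof -
    have "finite J" using that finite_subset by blast
    then have "int (card (?A J)) = (\<Sum>j\<in>J. int (nat (W - j - lo j)))" by (simp add: card_SigmaI)
    also have "\<dots> = (\<Sum>j\<in>J. W - j - lo j)"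
      using that wide by (intro sum.cong) (auto simp: subset_iff)
    finally show ?thesis .
  qed
  have im: "up_face i k \<in> (\<lambda>(j, i). up_face i j) ` A \<longleftrightarrow> (k, i) \<in> A"
    "down_face i k \<in> (\<lambda>(j, i). down_face i j) ` A \<longleftrightarrow> (k, i) \<in> A"
    "down_face i k \<notin> (\<lambda>(j, i). up_face i j) ` A" "up_face i k \<notin> (\<lambda>(j, i). down_face i j) ` A" for i k A
    by (auto simp: image_iff)
  have "{f \<in> ?R. \<exists>i k. f = up_face i k} = (\<lambda>(j, i). up_face i j) ` ?A {0..<h} - row_ups S"
    by (rule face_set_eqI) (auto simp: im)
  moreover have "row_ups S \<subseteq> (\<lambda>(j, i). up_face i j) ` ?A {0..<h}"
    using S h by (intro image_subsetI subsetI) (auto simp: row_ups_def im)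
  moreover have "inj_on (\<lambda>(j, i). up_face i j) (?A {0..<h})" by (auto simp: inj_on_def)
  moreover have "card (row_ups S) = card S" unfolding row_ups_def by (rule card_image) (auto simp: inj_on_def)
  moreover have "finite (row_ups S)" using fS by (simp add: row_ups_def)
  ultimately have up: "int (card {f \<in> ?R. \<exists>i k. f = up_face i k}) = int (card (?A {0..<h})) - int (card S)"
    using card_mono[of "(\<lambda>(j, i). up_face i j) ` ?A {0..<h}" "row_ups S"]
    by (simp add: card_Diff_subset card_image of_nat_diff)
  have "{f \<in> ?R. \<exists>i k. f = down_face i k} = (\<lambda>(j, i). down_face i j) ` ?A {1..h}"
    by (rule face_set_eqI) (auto simp: im)
  moreover have "inj_on (\<lambda>(j, i). down_face i j) (?A {1..h})" by (auto simp: inj_on_def)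
  ultimately have down: "int (card {f \<in> ?R. \<exists>i k. f = down_face i k}) = int (card (?A {1..h}))"
    by (simp add: card_image)
  have "int (card (?A {0..<h})) - int (card S) = int (card (?A {1..h}))"
    using M_balanced[OF _ nz] up down by simp
  moreover have "int (card (?A {0..<h})) = (\<Sum>j\<in>{0..<h}. W - j - lo j)"
    "int (card (?A {1..h})) = (\<Sum>j\<in>{1..h}. W - j - lo j)" by (rule crd; auto)+
  moreover have "{0..<h} = insert 0 {1..<h}" "{1..h} = insert h {1..<h}" using h by auto
  then have "(\<Sum>j\<in>{0..<h}. W - j - lo j) = W - lo 0 + (\<Sum>j\<in>{1..<h}. W - j - lo j)"
    "(\<Sum>j\<in>{1..h}. W - j - lo j) = W - h - lo h + (\<Sum>j\<in>{1..<h}. W - j - lo j)"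
    by (simp_all only:) simp_all
  ultimately show ?thesis by linarith
qed

lemma hole_unit_triangle: "f \<in> hole A \<Longrightarrow> unit_triangle f"
  by (auto simp: hole_def)

lemma hole_Un: "hole (A \<union> B) = hole A \<union> hole B"
  by (auto simp: hole_def)

lemma hole_UN: "hole (\<Union>i\<in>I. A i) = (\<Union>i\<in>I. hole (A i))"
  by (auto simp: hole_def)

text \<open>The down-pointing triangle of a lowest cell has lost both neighbours in its strip, for
  these would belong to lower cells of \<open>D\<close>. So it is matched upwards, and the argument
  is repeated without this cell.\<close>

lemma M_forced_verticals:
  assumes "finite R" "finite D"
    and "\<And>i k. (i, k) \<in> D \<Longrightarrow> up_face i k \<in> R" "\<And>i k. (i, k) \<in> D \<Longrightarrow> down_face i k \<in> R"
    and "\<And>i k. (i, k) \<in> D \<Longrightarrow> up_face i (k - 1) \<in> R \<Longrightarrow> (i, k - 1) \<in> D"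
    and "\<And>i k. (i, k) \<in> D \<Longrightarrow> up_face (i + 1) (k - 1) \<in> R \<Longrightarrow> (i + 1, k - 1) \<in> D"
  shows "M w R = (\<Prod>(i, k)\<in>D. w (vertical_lozenge i k))
    * M w (R - ((\<lambda>(i, k). up_face i k) ` D \<union> (\<lambda>(i, k). down_face i k) ` D))"
  using assms
proof (induction "card D" arbitrary: D R)
  case 0
  then show ?case by simp
next
  case (Suc n)
  have ne: "D \<noteq> {}" "finite (snd ` D)" using Suc.hyps(2) Suc.prems(2) by auto
  then have "Min (snd ` D) \<in> snd ` D" by (intro Min_in) auto
  then obtain i k where ik: "(i, k) \<in> D" "k = Min (snd ` D)" by force
  have low: "k \<le> k'" if "(i', k') \<in> D" for i' k'
    using that ne by (auto simp: ik(2) intro!: Min_le image_eqI[of _ snd "(i', k')"])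
  have nb: "up_face i (k - 1) \<notin> R" "up_face (i + 1) (k - 1) \<notin> R"
    using Suc.prems(5,6)[OF ik(1)] low[of _ "k - 1"] by fastforce+
  let ?R = "R - {down_face i k, up_face i k}" and ?D = "D - {(i, k)}"
  have "M w R = w {down_face i k, up_face i k} * M w ?R"
    by (rule M_forced) (use Suc.prems ik nb in \<open>auto simp: lozenge_down_iff\<close>)
  also have "M w ?R = (\<Prod>(i, k)\<in>?D. w (vertical_lozenge i k))
    * M w (?R - ((\<lambda>(i, k). up_face i k) ` ?D \<union> (\<lambda>(i, k). down_face i k) ` ?D))"
  proof (rule Suc.hyps(1))
    show "n = card ?D" using Suc.hyps(2) ik(1) Suc.prems(2) by simp
  next
    fix i' k' assume "(i', k') \<in> ?D" "up_face i' (k' - 1) \<in> ?R"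
    then show "(i', k' - 1) \<in> ?D" using Suc.prems(5)[of i' k'] by auto
  next
    fix i' k' assume "(i', k') \<in> ?D" "up_face (i' + 1) (k' - 1) \<in> ?R"
    then show "(i' + 1, k' - 1) \<in> ?D" using Suc.prems(6)[of i' k'] by auto
  qed (use Suc.prems in auto)
  also have "?R - ((\<lambda>(i, k). up_face i k) ` ?D \<union> (\<lambda>(i, k). down_face i k) ` ?D)
      = R - ((\<lambda>(i, k). up_face i k) ` D \<union> (\<lambda>(i, k). down_face i k) ` D)"
  proof -
    have "D = insert (i, k) ?D" using ik(1) by auto
    then have "(\<lambda>(i, k). up_face i k) ` D = insert (up_face i k) ((\<lambda>(i, k). up_face i k) ` ?D)"
      "(\<lambda>(i, k). down_face i k) ` D = insert (down_face i k) ((\<lambda>(i, k). down_face i k) ` ?D)"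
      by (metis (no_types, lifting) case_prod_conv image_insert)+
    then show ?thesis by auto
  qed
  also have "w {down_face i k, up_face i k} * ((\<Prod>(i, k)\<in>?D. w (vertical_lozenge i k)) * X)
      = (\<Prod>(i, k)\<in>D. w (vertical_lozenge i k)) * X" for X
    using prod.remove[OF Suc.prems(2) ik(1), of "\<lambda>(i, k). w (vertical_lozenge i k)"]
    by (simp add: vertical_lozenge_alt)
  finally show ?case .
qed

text \<open>A hole is a staircase growing from its base: the unit triangles above its base dents are
  forced to form vertical lozenges.\<close>

lemma M_hole:
  assumes c: "\<And>i k. (i, k) \<in> A \<Longrightarrow> 1 \<le> k \<Longrightarrow> (i + 1, k - 1) \<in> A"
      "\<And>i k. (i, k) \<in> A \<Longrightarrow> 1 \<le> k \<Longrightarrow> (i, k - 1) \<in> A \<or> i < lo (k - 1)"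
    and r: "\<And>i k. (i, k) \<in> A \<Longrightarrow> 1 \<le> k \<Longrightarrow> lo k \<le> i \<Longrightarrow> k < h \<and> i < W - k"
  shows "M w (trap lo W h 0 - row_ups ({i. (i, 0) \<in> A} \<union> S))
    = (\<Prod>(i, k)\<in>{(i, k). (i, k) \<in> A \<and> 1 \<le> k \<and> lo k \<le> i}. w (vertical_lozenge i k))
      * M w (trap lo W h 0 - hole A - row_ups S)"
proof -
  let ?D = "{(i, k). (i, k) \<in> A \<and> 1 \<le> k \<and> lo k \<le> i}"
  let ?R = "trap lo W h 0 - row_ups ({i. (i, 0) \<in> A} \<union> S)"
  have "?D \<subseteq> (\<lambda>(k, i). (i, k)) ` (SIGMA k:{1..h}. {lo k..W - k})"
  proof
    fix z assume z: "z \<in> ?D"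
    then obtain i k where ik: "z = (i, k)" by (cases z) auto
    then have "(k, i) \<in> (SIGMA k:{1..h}. {lo k..W - k})" using z r[of i k] by auto
    then show "z \<in> (\<lambda>(k, i). (i, k)) ` (SIGMA k:{1..h}. {lo k..W - k})" using ik by force
  qed
  then have fD: "finite ?D" by (rule finite_subset) auto
  have "M w ?R = (\<Prod>(i, k)\<in>?D. w (vertical_lozenge i k))
    * M w (?R - ((\<lambda>(i, k). up_face i k) ` ?D \<union> (\<lambda>(i, k). down_face i k) ` ?D))"
  proof (rule M_forced_verticals)
    fix i k assume D: "(i, k) \<in> ?D"
    then have ik: "(i, k) \<in> A" "1 \<le> k" "lo k \<le> i" by auto
    show "up_face i k \<in> ?R" "down_face i k \<in> ?R" using ik r[OF ik] by auto
    show "(i, k - 1) \<in> ?D" if "up_face i (k - 1) \<in> ?R"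
      using that c(2)[OF ik(1,2)] ik by (cases "k = 1") auto
    show "(i + 1, k - 1) \<in> ?D" if "up_face (i + 1) (k - 1) \<in> ?R"
      using that c(1)[OF ik(1,2)] ik by (cases "k = 1") auto
  qed (use fD in auto)
  also have "?R - ((\<lambda>(i, k). up_face i k) ` ?D \<union> (\<lambda>(i, k). down_face i k) ` ?D)
      = trap lo W h 0 - hole A - row_ups S"
  proof (rule face_set_eqI)
    fix i k
    have "up_face i k \<in> (\<lambda>(i, k). up_face i k) ` ?D \<longleftrightarrow> (i, k) \<in> ?D"
      "down_face i k \<in> (\<lambda>(i, k). down_face i k) ` ?D \<longleftrightarrow> (i, k) \<in> ?D"
      "up_face i k \<notin> (\<lambda>(i, k). down_face i k) ` ?D"
      "down_face i k \<notin> (\<lambda>(i, k). up_face i k) ` ?D"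
      by (auto simp: image_iff)
    then show "up_face i k \<in> ?R - ((\<lambda>(i, k). up_face i k) ` ?D \<union> (\<lambda>(i, k). down_face i k) ` ?D)
        \<longleftrightarrow> up_face i k \<in> trap lo W h 0 - hole A - row_ups S"
      and "down_face i k \<in> ?R - ((\<lambda>(i, k). up_face i k) ` ?D \<union> (\<lambda>(i, k). down_face i k) ` ?D)
        \<longleftrightarrow> down_face i k \<in> trap lo W h 0 - hole A - row_ups S"
      by (cases "k = 0"; auto)+
  qed (auto dest: trap_unit_triangle)
  finally show ?thesis .
qed

section \<open>From conditions on points of the plane to integer inequalities\<close>

lemma up_in_faces_in:
  "up_face i k \<in> faces_in P \<longleftrightarrow> P (ucoord (i, k)) k \<and> P (ucoord (i + 1, k)) k \<and> P (ucoord (i, k + 1)) (k + 1)"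
  by (simp add: faces_in_def) (simp add: up_face_def)

lemma down_in_faces_in:
  "down_face i k \<in> faces_in P \<longleftrightarrow> P (ucoord (i, k)) k \<and> P (ucoord (i + 1, k)) k \<and> P (ucoord (i + 1, k - 1)) (k - 1)"
  by (simp add: faces_in_def) (simp add: down_face_def)

lemma faces_in_unit_triangle: "f \<in> faces_in P \<Longrightarrow> unit_triangle f"
  by (simp add: faces_in_def)

text \<open>The western boundary leans by half a unit to either side, so \<open>lo\<close> falls by
  0 or 1 per line. Then the apex of a triangle satisfies the western condition as soon as its
  horizontal edge does.\<close>

lemma faces_in_eq_trap:
  assumes P: "\<And>i k. P (ucoord (i, k)) k \<longleftrightarrow> 0 \<le> k \<and> k \<le> h \<and> lo k \<le> i \<and> i \<le> W - k"
    and lo: "\<And>k. lo (k + 1) \<le> lo k" "\<And>k. lo k \<le> lo (k + 1) + 1"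
  shows "faces_in P = trap lo W h 0"
proof (rule face_set_eqI)
  fix i k
  show "up_face i k \<in> faces_in P \<longleftrightarrow> up_face i k \<in> trap lo W h 0"
    unfolding up_in_faces_in P up_in_trap using lo(1)[of k] by auto
  show "down_face i k \<in> faces_in P \<longleftrightarrow> down_face i k \<in> trap lo W h 0"
    unfolding down_in_faces_in P down_in_trap using lo(2)[of "k - 1"] by auto
qed (auto dest: trap_unit_triangle faces_in_unit_triangle)

text \<open>The first index at height \<open>k\<close> on or east of the zigzag; \<open>c\<close> is
  0 for \<open>K'\<close> and -1 for the upper part of \<open>N\<close>.\<close>

definition lo_K :: "int \<Rightarrow> int \<Rightarrow> int" where
  "lo_K c k = c - k div 2"

definition lo_Q :: "int \<Rightarrow> int" where
  "lo_Q k = - ((k + 1) div 2)"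

lemma K_west_le: "of_int c + K_west k \<le> ucoord (i, k) \<longleftrightarrow> lo_K c k \<le> i"
proof (cases "even k")
  case True
  then obtain m where "k = 2 * m" by (elim evenE)
  then show ?thesis by (simp add: K_west_def lo_K_def ucoord_def) linarith
next
  case False
  then obtain m where "k = 2 * m + 1" by (elim oddE)
  then show ?thesis by (simp add: K_west_def lo_K_def ucoord_def field_simps) linarith
qed

lemma Q_west_le: "Q_west k \<le> ucoord (i, k) \<longleftrightarrow> lo_Q k \<le> i"
proof (cases "even k")
  case True
  then obtain m where "k = 2 * m" by (elim evenE)
  then show ?thesis by (simp add: Q_west_def lo_Q_def ucoord_def) linarith
next
  case False
  then obtain m where "k = 2 * m + 1" by (elim oddE)
  then show ?thesis by (simp add: Q_west_def lo_Q_def ucoord_def field_simps) linarith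
qed

lemma ucoord_le: "ucoord (i, k) \<le> of_int W - of_int k / 2 \<longleftrightarrow> i \<le> W - k"
  by (simp add: ucoord_def field_simps) linarith

lemma ucoord_ge: "of_int W + of_int k / 2 \<le> ucoord (i, k) \<longleftrightarrow> W \<le> i"
  by (simp add: ucoord_def)

lemma lo_K_step: "lo_K c (k + 1) \<le> lo_K c k" "lo_K c k \<le> lo_K c (k + 1) + 1"
  by (auto simp: lo_K_def)

lemma lo_Q_step: "lo_Q (k + 1) \<le> lo_Q k" "lo_Q k \<le> lo_Q (k + 1) + 1"
  by (auto simp: lo_Q_def)

definition tri_cells :: "int \<Rightarrow> int \<Rightarrow> (int \<times> int) set" where
  "tri_cells p c = {(i, k). 0 \<le> k \<and> p \<le> i \<and> i + k < p + c}"

lemma up_triangle_eq_hole: "up_triangle p c = hole (tri_cells (int p) (int c))"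
proof (rule face_set_eqI)
  fix i k
  have *: "(0 \<le> real_of_int k \<and> real p + of_int k / 2 \<le> ucoord (i, k) \<and> ucoord (i, k) \<le> real p + real c - of_int k / 2)
      \<longleftrightarrow> 0 \<le> k \<and> int p \<le> i \<and> i \<le> int p + int c - k" for i k
    using ucoord_ge[of "int p" k i] ucoord_le[of i k "int p + int c"] by simp
  show "up_face i k \<in> up_triangle p c \<longleftrightarrow> up_face i k \<in> hole (tri_cells (int p) (int c))"
    by (simp only: up_triangle_def up_in_faces_in * up_in_hole tri_cells_def) auto
  show "down_face i k \<in> up_triangle p c \<longleftrightarrow> down_face i k \<in> hole (tri_cells (int p) (int c))"
    by (simp only: up_triangle_def down_in_faces_in * down_in_hole tri_cells_def) auto
qed (auto dest: hole_unit_triangle faces_in_unit_triangle simp: up_triangle_def)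

lemma vertical_lozenge_eq_iff: "vertical_lozenge i k = vertical_lozenge j l \<longleftrightarrow> i = j \<and> k = l"
  by (auto simp: vertical_lozenge_def doubleton_eq_iff)

lemma zigzag_weight_vertical:
  "zigzag_weight Z (vertical_lozenge i k) = (if {(i, k), (i, k + 1), (i + 1, k - 1)} \<subseteq> Z then 1 / 2 else 1)"
  by (auto simp: zigzag_weight_def vertical_lozenge_eq_iff)

lemma zigzag_weight_flat: "flat_weight (zigzag_weight Z)"
  by (auto simp: flat_weight_def zigzag_weight_def vertical_lozenge_def doubleton_eq_iff)

text \<open>The zigzag sticks out to the west at even heights, and a vertical lozenge has both
  western sides on it exactly if its western vertex is such a corner. The bounds on \<open>j\<close>
  ensure that the zigzag continues above and below the corner.\<close>

lemma zigzag_K: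
  assumes \<alpha>: "\<And>k. \<alpha> k = of_int c + K_west k" and j: "0 < j" "j < h"
  shows "zigzag_weight (zigzag \<alpha> h) (vertical_lozenge i j) = (if even j \<and> i = lo_K c j then 1 / 2 else 1)"
proof (cases "even j")
  case True
  then obtain m where "j = 2 * m" by (elim evenE)
  then show ?thesis using j
    unfolding zigzag_weight_vertical zigzag_def
    by (auto simp: \<alpha> K_west_def lo_K_def ucoord_def field_simps)
next
  case False
  then obtain m where "j = 2 * m + 1" by (elim oddE)
  then show ?thesis using j
    unfolding zigzag_weight_vertical zigzag_def
    by (auto simp: \<alpha> K_west_def lo_K_def ucoord_def field_simps)
qed

lemma zigzag_trap_K:
  assumes "\<And>k. \<alpha> k = of_int c + K_west k"
  shows "zigzag_trap (lo_K c) h 0 0 (zigzag_weight (zigzag \<alpha> h))"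
proof
  show "lo_K c (j + 1) = (if even (j + 0) then lo_K c j else lo_K c j - 1)" for j
    unfolding lo_K_def by (auto elim!: evenE oddE)
qed (auto simp: zigzag_weight_flat zigzag_K[OF assms])

text \<open>The first step of this zigzag goes west, whence \<open>\<pi> = 1\<close>. The first
  edges of the rows have their midpoints at distance 1/2 or 1 from the axis, so no lozenge is
  centred on it.\<close>

lemma zigzag_trap_Q: "zigzag_trap lo_Q h 1 (1 / 2) (\<lambda>_. 1)"
proof
  show "lo_Q (j + 1) = (if even (j + 1) then lo_Q j else lo_Q j - 1)" for j
    unfolding lo_Q_def by (auto elim!: evenE oddE)
qed (auto simp: flat_weight_def)

section \<open>Ferns\<close>

lemma mem_tri [simp]: "(i, k) \<in> tri_cells p c \<longleftrightarrow> 0 \<le> k \<and> p \<le> i \<and> i + k < p + c"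
  by (simp add: tri_cells_def)

lemma tri_0 [simp]: "tri_cells p 0 = {}"
  by (auto simp: tri_cells_def)

text \<open>The triangles of a fern laid out to the right from \<open>c\<close>, resp. to the left from \<open>L\<close>; the
  flag tells whether the first one is taken.\<close>

fun fern_cells :: "bool \<Rightarrow> int \<Rightarrow> nat list \<Rightarrow> (int \<times> int) set" where
  "fern_cells par c [] = {}"
| "fern_cells par c (x # xs) = (if par then tri_cells c (int x) else {}) \<union> fern_cells (\<not> par) (c + int x) xs"

fun rfern_cells :: "bool \<Rightarrow> int \<Rightarrow> nat list \<Rightarrow> (int \<times> int) set" where
  "rfern_cells par L [] = {}"
| "rfern_cells par L (x # xs) = (if par then tri_cells (L - int x) (int x) else {}) \<union> rfern_cells (\<not> par) (L - int x) xs"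

fun alternate_sum :: "bool \<Rightarrow> nat list \<Rightarrow> nat" where
  "alternate_sum par [] = 0"
| "alternate_sum par (x # xs) = (if par then x else 0) + alternate_sum (\<not> par) xs"

definition base :: "(int \<times> int) set \<Rightarrow> int set" where
  "base A = {i. (i, 0) \<in> A}"

lemma mem_base [simp]: "i \<in> base A \<longleftrightarrow> (i, 0) \<in> A"
  by (simp add: base_def)

lemma base_Un: "base (A \<union> B) = base A \<union> base B"
  by auto

lemma alt_le: "alternate_sum par xs \<le> sum_list xs"
proof (induction xs arbitrary: par)
  case (Cons x xs)
  show ?case using Cons[of True] Cons[of False] by simp
qed simp

lemma alt_add: "alternate_sum True xs + alternate_sum False xs = sum_list xs"
  by (induction xs) auto

lemma fern_cells_append:
  "fern_cells par c (xs @ ys) = fern_cells par c xs \<union> fern_cells (par \<longleftrightarrow> even (length xs)) (c + int (sum_list xs)) ys"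
proof (induction xs arbitrary: par c)
  case (Cons x xs)
  have "((\<not> par) = even (length xs)) = (par = even (length (x # xs)))" by auto
  then show ?case by (simp add: Cons Un_assoc add.assoc)
qed simp

lemma rfern_cells_append:
  "rfern_cells par L (xs @ ys) = rfern_cells par L xs \<union> rfern_cells (par \<longleftrightarrow> even (length xs)) (L - int (sum_list xs)) ys"
proof (induction xs arbitrary: par L)
  case (Cons x xs)
  have "((\<not> par) = even (length xs)) = (par = even (length (x # xs)))" by auto
  moreover have "L - int x - int (sum_list xs) = L - int (sum_list (x # xs))" by simp
  ultimately show ?case by (simp only: append_Cons rfern_cells.simps Cons Un_assoc)
qed simp

text \<open>In \<open>t_plus\<close> and \<open>t_minus\<close> the fern of \<open>b\<close> is
  written backwards. Read from its eastern end it is the fern of the region; the length decides how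
  the flags at the two ends are related.\<close>

lemma fern_cells_rev:
  "fern_cells par c (rev xs) = rfern_cells (par \<longleftrightarrow> odd (length xs)) (c + int (sum_list xs)) xs"
proof (induction xs)
  case (Cons x xs)
  show ?case by (auto simp: fern_cells_append Cons split: if_splits)
qed simp

lemma fern_cells_zeros: "fern_cells par c (replicate n 0) = {}" "rfern_cells par c (replicate n 0) = {}"
  by (induction n arbitrary: par) auto

lemma entries_pad:
  assumes "length xs \<le> K"
  shows "map (entry xs) [1..<Suc K] = xs @ replicate (K - length xs) 0"
  using assms by (intro nth_equalityI) (auto simp: entry_def nth_append simp del: upt_Suc)

lemma entries_pad_simps:
  assumes "length xs \<le> K"
  shows "fern_cells par c (map (entry xs) [1..<Suc K]) = fern_cells par c xs"
    "rfern_cells par c (map (entry xs) [1..<Suc K]) = rfern_cells par c xs"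
    "sum_list (map (entry xs) [1..<Suc K]) = sum_list xs"
  unfolding entries_pad[OF assms]
  by (simp_all add: fern_cells_append rfern_cells_append fern_cells_zeros sum_list_replicate)

text \<open>Splits off the entry next to the gap, which the sequences \<open>t\<close> merge with
  \<open>x + y\<close>. Since \<open>entry\<close> is 0 beyond the end of the list, \<open>K\<close>
  can be chosen by parity.\<close>

lemma entries_last:
  assumes "length xs \<le> Suc K"
  shows "fern_cells par c xs = fern_cells par c (map (entry xs) [1..<Suc K])
      \<union> (if par \<longleftrightarrow> even K then tri_cells (c + int (sum_list (map (entry xs) [1..<Suc K]))) (int (entry xs (Suc K))) else {})"
    "rfern_cells par c xs = rfern_cells par c (map (entry xs) [1..<Suc K])
      \<union> (if par \<longleftrightarrow> even K then tri_cells (c - int (sum_list (map (entry xs) [1..<Suc K])) - int (entry xs (Suc K))) (int (entry xs (Suc K))) else {})"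
    "sum_list xs = sum_list (map (entry xs) [1..<Suc K]) + entry xs (Suc K)"
proof -
  have e: "map (entry xs) [1..<Suc (Suc K)] = map (entry xs) [1..<Suc K] @ [entry xs (Suc K)]"
    by simp
  note pad = entries_pad_simps[OF assms, unfolded e]
  show "fern_cells par c xs = fern_cells par c (map (entry xs) [1..<Suc K])
      \<union> (if par \<longleftrightarrow> even K then tri_cells (c + int (sum_list (map (entry xs) [1..<Suc K]))) (int (entry xs (Suc K))) else {})"
    unfolding pad(1)[symmetric] fern_cells_append by (simp del: upt_Suc)
  show "rfern_cells par c xs = rfern_cells par c (map (entry xs) [1..<Suc K])
      \<union> (if par \<longleftrightarrow> even K then tri_cells (c - int (sum_list (map (entry xs) [1..<Suc K])) - int (entry xs (Suc K))) (int (entry xs (Suc K))) else {})"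
    unfolding pad(2)[symmetric] rfern_cells_append by (simp del: upt_Suc)
  show "sum_list xs = sum_list (map (entry xs) [1..<Suc K]) + entry xs (Suc K)"
    unfolding pad(3)[symmetric] by (simp del: upt_Suc)
qed

lemma fern_cells_mem:
  assumes "(i, k) \<in> fern_cells par c xs"
  shows "0 \<le> k \<and> c \<le> i \<and> i + k < c + int (sum_list xs) \<and> k < int (alternate_sum par xs)"
  using assms by (induction par c xs rule: fern_cells.induct) (force split: if_splits)+

lemma rfern_cells_mem:
  assumes "(i, k) \<in> rfern_cells par L xs"
  shows "0 \<le> k \<and> L - int (sum_list xs) \<le> i \<and> i + k < L \<and> k < int (alternate_sum par xs)"
  using assms by (induction par L xs rule: rfern_cells.induct) (force split: if_splits)+

text \<open>Closure under both lower neighbours, as \<open>M_hole\<close> asks of a hole away from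
  the boundary; triangles standing on the base line have it.\<close>

definition stair :: "(int \<times> int) set \<Rightarrow> bool" where
  "stair A \<longleftrightarrow> (\<forall>i k. (i, k) \<in> A \<longrightarrow> 1 \<le> k \<longrightarrow> (i + 1, k - 1) \<in> A \<and> (i, k - 1) \<in> A)"

lemma stair_Un: "stair A \<Longrightarrow> stair B \<Longrightarrow> stair (A \<union> B)"
  unfolding stair_def by blast

lemma stair_tri: "stair (tri_cells p c)"
  by (auto simp: stair_def)

lemma stair_tris: "stair (fern_cells par c xs)"
  by (induction par c xs rule: fern_cells.induct) (auto intro!: stair_Un stair_tri simp: stair_def[of "{}"])

lemma stair_rtris: "stair (rfern_cells par L xs)"
  by (induction par L xs rule: rfern_cells.induct) (auto intro!: stair_Un stair_tri simp: stair_def[of "{}"])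

lemma base_tri: "base (tri_cells p c) = {p..<p + c}"
  by auto

lemma base_tris_subset: "base (fern_cells par c xs) \<subseteq> {c..<c + int (sum_list xs)}"
  using fern_cells_mem by fastforce

lemma base_rtris_subset: "base (rfern_cells par L xs) \<subseteq> {L - int (sum_list xs)..<L}"
  using rfern_cells_mem by fastforce

lemma finite_base_tris: "finite (base (fern_cells par c xs))" "finite (base (rfern_cells par L xs))"
  by (rule finite_subset[OF base_tris_subset], simp) (rule finite_subset[OF base_rtris_subset], simp)

lemma disjoint_interval:
  fixes l m n :: int
  shows "B \<subseteq> {m..<n} \<Longrightarrow> {l..<m} \<inter> B = {}" "B \<subseteq> {l..<m} \<Longrightarrow> {m..<n} \<inter> B = {}"
  by auto

lemma swap_partition:
  assumes "A \<union> B = I \<and> A \<inter> B = {}" "X \<inter> A = {}"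
  shows "X \<union> B \<union> A = X \<union> I \<and> (X \<union> B) \<inter> A = {}"
proof
  show "X \<union> B \<union> A = X \<union> I" unfolding conjunct1[OF assms(1), symmetric] by auto
  show "(X \<union> B) \<inter> A = {}" using assms by (simp only: Int_Un_distrib2 Int_commute[of B A]) simp
qed

text \<open>Along a fern every unit edge is the base of a triangle on exactly one side of \<ell>.
  For this reason the entries of the fern disappear from the Selberg weight and only its length
  remains.\<close>

lemma base_tris_cases:
  "base (fern_cells True c xs) \<union> base (fern_cells False c xs) = {c..<c + int (sum_list xs)}
   \<and> base (fern_cells True c xs) \<inter> base (fern_cells False c xs) = {}"
proof (induction xs arbitrary: c)
  case (Cons x xs)
  let ?c = "c + int x"
  have "base (fern_cells True c (x # xs)) = {c..<?c} \<union> base (fern_cells False ?c xs)"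
    "base (fern_cells False c (x # xs)) = base (fern_cells True ?c xs)"
    by (auto simp: base_Un)
  moreover have "{c..<c + int (sum_list (x # xs))} = {c..<?c} \<union> {?c..<?c + int (sum_list xs)}" by auto
  moreover have "{c..<?c} \<inter> base (fern_cells True ?c xs) = {}" by (rule disjoint_interval(1)[OF base_tris_subset])
  ultimately show ?case using swap_partition[OF Cons[of ?c]] by (simp only:)
qed auto

lemma base_rtris_cases:
  "base (rfern_cells True L xs) \<union> base (rfern_cells False L xs) = {L - int (sum_list xs)..<L}
   \<and> base (rfern_cells True L xs) \<inter> base (rfern_cells False L xs) = {}"
proof (induction xs arbitrary: L)
  case (Cons x xs)
  let ?c = "L - int x"
  have "base (rfern_cells True L (x # xs)) = {?c..<L} \<union> base (rfern_cells False ?c xs)"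
    "base (rfern_cells False L (x # xs)) = base (rfern_cells True ?c xs)"
    by (auto simp: base_Un)
  moreover have "{L - int (sum_list (x # xs))..<L} = {?c..<L} \<union> {?c - int (sum_list xs)..<?c}" by auto
  moreover have "{?c..<L} \<inter> base (rfern_cells True ?c xs) = {}" by (rule disjoint_interval(2)[OF base_rtris_subset])
  ultimately show ?case using swap_partition[OF Cons[of ?c]] by (simp only:)
qed auto

lemma card_base_tris: "card (base (fern_cells par c xs)) = alternate_sum par xs"
proof (induction xs arbitrary: par c)
  case Nil
  then show ?case by (simp add: base_def)
next
  case (Cons x xs)
  let ?A = "if par then {c..<c + int x} else {}" and ?B = "base (fern_cells (\<not> par) (c + int x) xs)"
  have "base (fern_cells par c (x # xs)) = ?A \<union> ?B" by auto
  moreover have "?A \<inter> ?B = {}" using disjoint_interval(1)[OF base_tris_subset, of c] by simp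
  ultimately show ?case using Cons finite_base_tris by (simp add: card_Un_disjoint)
qed

lemma card_base_rtris: "card (base (rfern_cells par L xs)) = alternate_sum par xs"
proof (induction xs arbitrary: par L)
  case Nil
  then show ?case by (simp add: base_def)
next
  case (Cons x xs)
  let ?A = "if par then {L - int x..<L} else {}" and ?B = "base (rfern_cells (\<not> par) (L - int x) xs)"
  have "base (rfern_cells par L (x # xs)) = ?A \<union> ?B" by auto
  moreover have "?A \<inter> ?B = {}" using disjoint_interval(2)[OF base_rtris_subset] by simp
  ultimately show ?case using Cons finite_base_tris by (simp add: card_Un_disjoint)
qed

lemma fern_cells_shift: "(i, k) \<in> fern_cells par (c + d) xs \<longleftrightarrow> (i - d, k) \<in> fern_cells par c xs"
proof (induction xs arbitrary: par c)
  case (Cons x xs)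
  have e: "c + d + int x = (c + int x) + d" by simp
  have "(i, k) \<in> fern_cells (\<not> par) (c + d + int x) xs \<longleftrightarrow> (i - d, k) \<in> fern_cells (\<not> par) (c + int x) xs"
    unfolding e by (rule Cons)
  then show ?case by auto
qed simp

lemma rfern_cells_shift: "(i, k) \<in> rfern_cells par (c + d) xs \<longleftrightarrow> (i - d, k) \<in> rfern_cells par c xs"
proof (induction xs arbitrary: par c)
  case (Cons x xs)
  have e: "c + d - int x = (c - int x) + d" by simp
  have "(i, k) \<in> rfern_cells (\<not> par) (c + d - int x) xs \<longleftrightarrow> (i - d, k) \<in> rfern_cells (\<not> par) (c - int x) xs"
    unfolding e by (rule Cons)
  then show ?case by auto
qed simp

section \<open>Indexed descriptions of ferns; the dents of \<open>t_plus\<close> and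
  \<open>t_minus\<close>\<close>

lemma entry_snoc: "entry (xs @ [x]) i = (if i = Suc (length xs) then x else entry xs i)"
  by (auto simp: entry_def nth_append)

lemma psum_snoc: "i \<le> length xs \<Longrightarrow> psum (xs @ [x]) i = psum xs i"
  by (auto simp: psum_def entry_snoc intro!: sum.cong)

lemma psum_length: "psum xs (length xs) = sum_list xs"
proof (induction xs rule: rev_induct)
  case Nil
  show ?case by (simp add: psum_def)
next
  case (snoc x xs)
  have "psum (xs @ [x]) (Suc (length xs)) = psum (xs @ [x]) (length xs) + entry (xs @ [x]) (Suc (length xs))"
    by (simp add: psum_def)
  then show ?case using snoc by (simp add: psum_snoc entry_snoc)
qed

lemma psum_Suc: "psum xs (Suc i) = psum xs i + entry xs (Suc i)"
  by (simp add: psum_def)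

lemma psum_le: "psum xs i \<le> sum_list xs"
proof (induction i)
  case 0
  show ?case by (simp add: psum_def)
next
  case (Suc i)
  show ?case
  proof (cases "Suc i \<le> length xs")
    case True
    have "psum xs (Suc i) \<le> psum xs (length xs)"
      unfolding psum_def using True by (intro sum_mono2) auto
    then show ?thesis by (simp add: psum_length)
  next
    case False
    then show ?thesis using Suc by (simp add: psum_Suc entry_def)
  qed
qed

text \<open>Connects the recursive ferns with the triangles removed by index. The induction appends
  at the end, which changes no earlier partial sum.\<close>

lemma fern_cells_index:
  "fern_cells par c xs = (\<Union>i\<in>{i \<in> {1..length xs}. odd i \<longleftrightarrow> par}. tri_cells (c + int (psum xs (i - 1))) (int (entry xs i)))"
proof (induction xs rule: rev_induct)
  case (snoc x xs)
  let ?n = "length xs"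
  have "{i \<in> {1..length (xs @ [x])}. odd i \<longleftrightarrow> par} = {i \<in> {1..?n}. odd i \<longleftrightarrow> par} \<union> (if par \<longleftrightarrow> even ?n then {Suc ?n} else {})"
    by (auto simp: le_Suc_eq)
  moreover have "(\<Union>i\<in>{i \<in> {1..?n}. odd i \<longleftrightarrow> par}. tri_cells (c + int (psum (xs @ [x]) (i - 1))) (int (entry (xs @ [x]) i)))
     = (\<Union>i\<in>{i \<in> {1..?n}. odd i \<longleftrightarrow> par}. tri_cells (c + int (psum xs (i - 1))) (int (entry xs i)))"
    by (intro SUP_cong refl) (auto simp: psum_snoc entry_snoc)
  ultimately show ?case
    by (simp add: fern_cells_append snoc psum_snoc entry_snoc psum_length)
qed simp

lemma rfern_cells_index:
  "rfern_cells par L xs = (\<Union>j\<in>{j \<in> {1..length xs}. odd j \<longleftrightarrow> par}. tri_cells (L - int (psum xs j)) (int (entry xs j)))"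
proof (induction xs rule: rev_induct)
  case (snoc x xs)
  let ?n = "length xs"
  have "{i \<in> {1..length (xs @ [x])}. odd i \<longleftrightarrow> par} = {i \<in> {1..?n}. odd i \<longleftrightarrow> par} \<union> (if par \<longleftrightarrow> even ?n then {Suc ?n} else {})"
    by (auto simp: le_Suc_eq)
  moreover have "(\<Union>i\<in>{i \<in> {1..?n}. odd i \<longleftrightarrow> par}. tri_cells (L - int (psum (xs @ [x]) i)) (int (entry (xs @ [x]) i)))
     = (\<Union>i\<in>{i \<in> {1..?n}. odd i \<longleftrightarrow> par}. tri_cells (L - int (psum xs i)) (int (entry xs i)))"
    by (intro SUP_cong refl) (auto simp: psum_snoc entry_snoc)
  ultimately show ?case
    by (simp add: rfern_cells_append snoc psum_snoc entry_snoc psum_length psum_Suc diff_diff_eq)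
qed simp

lemma alt_index: "alternate_sum par xs = (\<Sum>i | i \<in> {1..length xs} \<and> (odd i \<longleftrightarrow> par). entry xs i)"
proof (induction xs rule: rev_induct)
  case (snoc x xs)
  let ?n = "length xs"
  have ap: "alternate_sum par (ys @ zs) = alternate_sum par ys + alternate_sum (par \<longleftrightarrow> even (length ys)) zs" for ys zs par
  proof (induction ys arbitrary: par)
    case (Cons y ys)
    have "((\<not> par) = even (length ys)) = (par = even (length (y # ys)))" by auto
    then show ?case by (simp add: Cons)
  qed simp
  have "{i. i \<in> {1..length (xs @ [x])} \<and> (odd i \<longleftrightarrow> par)} = {i. i \<in> {1..?n} \<and> (odd i \<longleftrightarrow> par)} \<union> (if par \<longleftrightarrow> even ?n then {Suc ?n} else {})"
    by (auto simp: le_Suc_eq)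
  moreover have "(\<Sum>i | i \<in> {1..?n} \<and> (odd i \<longleftrightarrow> par). entry (xs @ [x]) i) = (\<Sum>i | i \<in> {1..?n} \<and> (odd i \<longleftrightarrow> par). entry xs i)"
    by (intro sum.cong refl) (auto simp: entry_snoc)
  ultimately show ?case
    by (simp add: ap snoc entry_snoc)
qed simp

lemma odd_sum_alt: "odd_sum xs = alternate_sum True xs" and even_sum_alt: "even_sum xs = alternate_sum False xs"
  by (simp_all add: odd_sum_def even_sum_def alt_index)

lemma dents_eq_hole: "dents t = hole (fern_cells False 0 t)"
proof -
  have "fern_cells False 0 t = (\<Union>i\<in>{1..length t div 2}. tri_cells (int (psum t (2 * i - 1))) (int (entry t (2 * i))))"
  proof -
    have "{i \<in> {1..length t}. odd i \<longleftrightarrow> False} = (\<lambda>i. 2 * i) ` {1..length t div 2}"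
      by (auto elim!: evenE)
    then show ?thesis by (simp only: fern_cells_index) simp
  qed
  then show ?thesis by (simp add: dents_def up_triangle_eq_hole hole_UN)
qed

text \<open>The merged middle entry has an odd position and carries no dent, while the odd entries
  absorbed in it have no triangle below \<ell> either. The last entry is the dent of side
  \<open>z\<close> at \<open>L\<close>.\<close>

lemma t_minus_tris:
  "fern_cells False 0 (t_minus x y z as bs)
    = fern_cells False 0 as \<union> rfern_cells False (int (N_len x y as bs)) bs \<union> tri_cells (int (N_len x y as bs)) (int z)"
proof -
  let ?A = "map (entry as) [1..<mu' as + 1]" and ?B = "map (entry bs) [1..<mu' bs + 1]"
  let ?L = "int (N_len x y as bs)"
  let ?mid = "entry as (mu' as + 1) + x + y + entry bs (mu' bs + 1)"
  have len: "length as \<le> Suc (mu' as)" "length bs \<le> Suc (mu' bs)"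
    by (auto simp: mu'_def seq_len_def)
  have ev: "even (mu' as)" "even (mu' bs)" by (auto simp: mu'_def)
  have "fern_cells False 0 (t_minus x y z as bs)
      = fern_cells False 0 ?A \<union> fern_cells True (int (sum_list ?A + ?mid)) (rev ?B) \<union> tri_cells (int (sum_list ?A + ?mid + sum_list ?B)) (int z)"
    unfolding t_minus_def fern_cells_append using ev by (simp add: add_ac Un_assoc sum_list_rev del: upt_Suc)
  also have "fern_cells True (int (sum_list ?A + ?mid)) (rev ?B) = rfern_cells False (int (sum_list ?A + ?mid + sum_list ?B)) ?B"
    unfolding fern_cells_rev using ev by (simp del: upt_Suc)
  also have "int (sum_list ?A + ?mid + sum_list ?B) = ?L"
    using entries_last(3)[OF len(1)] entries_last(3)[OF len(2)]
    by (simp add: N_len_def del: upt_Suc)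
  also have "fern_cells False 0 ?A = fern_cells False 0 as"
    using entries_last(1)[OF len(1), of False 0] ev by (simp del: upt_Suc)
  also have "rfern_cells False ?L ?B = rfern_cells False ?L bs"
    using entries_last(2)[OF len(2), of False ?L] ev by (simp del: upt_Suc)
  finally show ?thesis .
qed

text \<open>Only bases can be compared: the first dent of \<open>t_plus\<close> has side
  \<open>entry as 1 + 1\<close>, whereas the region has a triangle of side \<open>entry as 1\<close>
  and a separate dent at -1. The formula for a trapezoid sees nothing but the bases.\<close>

lemma t_plus_base:
  "i \<in> base (fern_cells False 0 (t_plus x y as bs)) \<longleftrightarrow>
     i - 1 \<in> {- 1} \<union> base (fern_cells True 0 as) \<union> base (rfern_cells True (int (N_len x y as bs)) bs)"
proof -
  let ?A = "map (entry as) [2..<mu as]" and ?B = "map (entry bs) [1..<mu bs]"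
  let ?L = "int (N_len x y as bs)"
  let ?a1 = "entry as 1"
  let ?mid = "entry as (mu as) + x + y + entry bs (mu bs)"
  define m where "m = mu as - 1"
  define n where "n = mu bs - 1"
  \<comment> \<open>\<open>mu\<close> is even, positive and not below the length, so the merged
    entry of \<open>t_plus\<close> is at the odd position \<open>mu as + 1\<close>.\<close>
  have *: "mu xs = Suc (mu xs - 1) \<and> odd (mu xs - 1) \<and> length xs \<le> mu xs" for xs
  proof -
    have s: "1 \<le> seq_len xs" "length xs \<le> seq_len xs" by (auto simp: seq_len_def)
    then obtain K where K: "(seq_len xs + 1) div 2 = Suc K"
      by (cases "(seq_len xs + 1) div 2") auto
    have "s \<le> 2 * Suc K" if "(s + 1) div 2 = Suc K" for s :: nat using that by presburger
    with K have "seq_len xs \<le> 2 * Suc K" by blast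
    then show ?thesis using s K by (simp add: mu_def)
  qed
  have m: "mu as = Suc m" "odd m" and n: "mu bs = Suc n" "odd n"
    and len: "length as \<le> Suc m" "length bs \<le> Suc n"
    using *[of as] *[of bs] by (simp_all add: m_def n_def)
  have A1: "map (entry as) [1..<Suc m] = ?a1 # ?A"
  proof -
    have "[1..<Suc m] = 1 # [2..<Suc m]"
    proof -
      have "1 < Suc m" using m(2) by (cases m) auto
      from upt_conv_Cons[OF this] show ?thesis by (simp add: numeral_2_eq_2)
    qed
    then show ?thesis by (simp only: m list.map)
  qed
  have lenA: "even (length ?A)" "length ?B = n" using m n by auto
  have "fern_cells False 0 (t_plus x y as bs)
      = tri_cells 0 (int (?a1 + 1)) \<union> fern_cells False (int (?a1 + 1)) ?A
        \<union> fern_cells True (int (?a1 + 1 + sum_list ?A + ?mid)) (rev ?B)"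
    unfolding t_plus_def fern_cells_append using lenA by (simp add: add_ac Un_assoc del: upt_Suc length_map length_upt)
  also have "fern_cells True (int (?a1 + 1 + sum_list ?A + ?mid)) (rev ?B)
      = rfern_cells True (int (?a1 + 1 + sum_list ?A + ?mid + sum_list ?B)) ?B"
    unfolding fern_cells_rev using n lenA by (simp add: add_ac del: upt_Suc)
  also have "int (?a1 + 1 + sum_list ?A + ?mid + sum_list ?B) = ?L + 1"
    using entries_last(3)[OF len(1), unfolded A1] entries_last(3)[OF len(2)]
    by (simp add: N_len_def m n del: upt_Suc)
  also have "rfern_cells True (?L + 1) ?B = rfern_cells True (?L + 1) bs"
    using entries_last(2)[OF len(2), of True "?L + 1"] n by (simp del: upt_Suc)
  also have "fern_cells False (int (?a1 + 1)) ?A = fern_cells False (int ?a1 + 1) ?A" by (simp add: add.commute)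
  finally have t: "fern_cells False 0 (t_plus x y as bs)
      = tri_cells 0 (int (?a1 + 1)) \<union> fern_cells False (int ?a1 + 1) ?A \<union> rfern_cells True (?L + 1) bs" .
  have "fern_cells True 0 as = tri_cells 0 (int ?a1) \<union> fern_cells False (int ?a1) ?A"
    using entries_last(1)[OF len(1), of True 0, unfolded A1] m by simp
  then show ?thesis
    unfolding t by (auto simp: fern_cells_shift rfern_cells_shift)
qed

section \<open>The regions\<close>

text \<open>The reflection in \<ell>: it keeps \<open>u = i + k / 2\<close> and negates the height,
  and it exchanges the two orientations of triangles.\<close>

definition mirror_vertex :: "vertex \<Rightarrow> vertex" where
  "mirror_vertex v = (fst v + snd v, - snd v)"

definition mirror :: "face \<Rightarrow> face" where
  "mirror f = mirror_vertex ` f"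

lemma mirror_vertex_mirror_vertex [simp]: "mirror_vertex (mirror_vertex v) = v"
  by (simp add: mirror_vertex_def)

lemma inj_mirror_vertex: "inj mirror_vertex"
  by (metis injI mirror_vertex_mirror_vertex)

lemma mirror_mirror [simp]: "mirror (mirror f) = f"
  by (simp add: mirror_def image_image)

lemma inj_mirror: "inj mirror"
  by (metis injI mirror_mirror)

lemma mirror_up [simp]: "mirror (up_face i k) = down_face (i + k) (- k)"
  by (auto simp: mirror_def up_face_def down_face_def mirror_vertex_def)

lemma mirror_down [simp]: "mirror (down_face i k) = up_face (i + k) (- k)"
  by (auto simp: mirror_def up_face_def down_face_def mirror_vertex_def)

lemma mem_mirror_image: "f \<in> mirror ` A \<longleftrightarrow> mirror f \<in> A"
  by (metis imageE imageI mirror_mirror)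

lemma unit_triangle_mirror [simp]: "unit_triangle (mirror f) \<longleftrightarrow> unit_triangle f"
  by (metis mirror_down mirror_mirror mirror_up unit_triangle_cases unit_triangle_faces)

lemma lozenge_mirror [simp]: "lozenge (mirror ` l) \<longleftrightarrow> lozenge l"
proof -
  have *: "lozenge (mirror ` l)" if l: "lozenge l" for l
  proof -
    obtain f g where fg: "l = {f, g}" by (rule lozenge_pairE[OF l])
    have "card (mirror f \<inter> mirror g) = card (f \<inter> g)"
      unfolding mirror_def image_Int[OF inj_mirror_vertex, symmetric]
      by (rule card_image) (rule inj_on_subset[OF inj_mirror_vertex subset_UNIV])
    moreover have "mirror f \<noteq> mirror g" if "f \<noteq> g" using that by (metis mirror_mirror)
    ultimately show ?thesis using l unfolding fg by (simp add: lozenge_pair_iff)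
  qed
  have "mirror ` mirror ` l = l" by (simp add: image_image)
  then show ?thesis using *[of l] *[of "mirror ` l"] by auto
qed

lemma M_mirror:
  assumes "\<And>l. lozenge l \<Longrightarrow> l \<subseteq> mirror ` R \<Longrightarrow> w l = 1"
  shows "M w (mirror ` R) = M (\<lambda>_. 1) R"
proof (rule M_image)
  show "inj_on mirror R" using inj_mirror by (rule inj_on_subset) simp
  show "w (mirror ` l) = 1" if "lozenge l" "l \<subseteq> R" for l
    using that by (intro assms) auto
qed simp

lemma faces_in_mirror: "faces_in P = mirror ` faces_in (\<lambda>u k. P u (- k))"
proof -
  have "f \<in> faces_in P \<longleftrightarrow> mirror f \<in> faces_in (\<lambda>u k. P u (- k))" for f
  proof -
    have "ucoord (mirror_vertex v) = ucoord v" "- snd (mirror_vertex v) = snd v" for v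
      by (simp_all add: mirror_vertex_def ucoord_def field_simps)
    then have "(\<forall>v\<in>mirror f. P (ucoord v) (- snd v)) \<longleftrightarrow> (\<forall>v\<in>f. P (ucoord v) (snd v))"
      by (simp add: mirror_def)
    then show ?thesis by (simp only: faces_in_def mem_Collect_eq unit_triangle_mirror)
  qed
  then show ?thesis by (simp only: Set.set_eq_iff mem_mirror_image) simp
qed

lemma down_triangle_eq_mirror: "down_triangle p c = mirror ` hole (tri_cells (int p) (int c))"
  unfolding down_triangle_def up_triangle_eq_hole[symmetric] up_triangle_def faces_in_mirror[of "\<lambda>u k. k \<le> 0 \<and> _ u k"]
  by (subst faces_in_mirror) simp

definition half_cells :: "nat \<Rightarrow> (int \<times> int) set" where
  "half_cells c = {(i, k). 0 \<le> k \<and> i + k < int c}"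

lemma half_faces: "faces_in (\<lambda>u k. 0 \<le> k \<and> u \<le> real c - k / 2) = hole (half_cells c)"
proof (rule face_set_eqI)
  fix i k
  have *: "(0 \<le> real_of_int k \<and> ucoord (i, k) \<le> real c - of_int k / 2) \<longleftrightarrow> 0 \<le> k \<and> i \<le> int c - k" for i k
    using ucoord_le[of i k "int c"] by simp
  show "up_face i k \<in> faces_in (\<lambda>u k. 0 \<le> k \<and> u \<le> real c - k / 2) \<longleftrightarrow> up_face i k \<in> hole (half_cells c)"
    by (simp only: up_in_faces_in * up_in_hole half_cells_def) auto
  show "down_face i k \<in> faces_in (\<lambda>u k. 0 \<le> k \<and> u \<le> real c - k / 2) \<longleftrightarrow> down_face i k \<in> hole (half_cells c)"
    by (simp only: down_in_faces_in * down_in_hole half_cells_def) auto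
qed (auto dest: hole_unit_triangle faces_in_unit_triangle)

lemma K'_trap:
  "faces_in (\<lambda>u k. 0 \<le> k \<and> k \<le> 2 * int e - 1 \<and> K_west k \<le> u \<and> u \<le> real s - k / 2)
    = trap (lo_K 0) (int s) (2 * int e - 1) 0"
proof (rule faces_in_eq_trap, goal_cases)
  case (1 i k)
  show ?case using K_west_le[of 0 k i] ucoord_le[of i k "int s"] by simp
qed (rule lo_K_step)+

lemma Q_trap:
  "faces_in (\<lambda>u k. 0 \<le> k \<and> k \<le> 2 * int e \<and> Q_west k \<le> u \<and> u \<le> real s - k / 2)
    = trap lo_Q (int s) (2 * int e) 0"
proof (rule faces_in_eq_trap, goal_cases)
  case (1 i k)
  show ?case using Q_west_le[of k i] ucoord_le[of i k "int s"] by simp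
qed (rule lo_Q_step)+

lemma base_dents: "base (fern_cells False 0 t) \<subseteq> {0..<int (odd_sum t + even_sum t)}"
  using base_tris_subset[of False 0 t] by (simp add: odd_sum_alt even_sum_alt alt_add)

text \<open>The dents begin east of 0, away from the weighted lozenges; the lozenges forced inside
  them have weight 1, and each dent may be replaced by its base.\<close>

lemma M_dents:
  assumes lo: "lo 0 = 0" and h: "int (even_sum t) \<le> h"
    and w: "\<And>i k. 1 \<le> k \<Longrightarrow> k < h \<Longrightarrow> lo k \<le> i \<Longrightarrow> 0 \<le> i \<Longrightarrow> w (vertical_lozenge i k) = 1"
  shows "M w (trap lo (int (odd_sum t + even_sum t)) h 0 - dents t)
    = M w (trap lo (int (odd_sum t + even_sum t)) h 0 - row_ups (base (fern_cells False 0 t)))"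
proof -
  let ?A = "fern_cells False 0 t" and ?W = "int (odd_sum t + even_sum t)"
  have mem: "0 \<le> i \<and> i + k < ?W \<and> k < h" if "(i, k) \<in> ?A" for i k
    using fern_cells_mem[OF that] h alt_add[of t] by (simp add: odd_sum_alt even_sum_alt)
  have "M w (trap lo ?W h 0 - row_ups ({i. (i, 0) \<in> ?A} \<union> {}))
    = (\<Prod>(i, k)\<in>{(i, k). (i, k) \<in> ?A \<and> 1 \<le> k \<and> lo k \<le> i}. w (vertical_lozenge i k))
      * M w (trap lo ?W h 0 - hole ?A - row_ups {})"
    using stair_tris[of False 0 t] mem by (intro M_hole) (force simp: stair_def)+
  also have "(\<Prod>(i, k)\<in>{(i, k). (i, k) \<in> ?A \<and> 1 \<le> k \<and> lo k \<le> i}. w (vertical_lozenge i k)) = 1"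
    using mem w by (intro prod.neutral) force
  finally show ?thesis by (simp add: dents_eq_hole base_def row_ups_def)
qed

lemma K'_value:
  assumes "1 \<le> even_sum t"
  shows "K' t = vandermonde_sq (base (fern_cells False 0 t)) / (\<Prod>j<even_sum t. fact (2 * j))"
proof -
  let ?W = "int (odd_sum t + even_sum t)" and ?h = "2 * int (even_sum t) - 1"
  let ?w = "zigzag_weight (zigzag K_west ?h)"
  interpret zigzag_trap "lo_K 0" ?W ?h 0 0 ?w
    by (rule zigzag_trap_K) simp
  obtain n where n: "even_sum t = Suc n" using assms by (cases "even_sum t") auto
  have "K' t = M ?w (trap (lo_K 0) ?W ?h 0 - dents t)"
    unfolding K'_def K'_region_def K'_trap by simp
  also have "\<dots> = M ?w (trap (lo_K 0) ?W ?h 0 - row_ups (base (fern_cells False 0 t)))"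
  proof (rule M_dents)
    fix i k :: int assume "1 \<le> k" "k < ?h" "lo_K 0 k \<le> i" "0 \<le> i"
    then show "?w (vertical_lozenge i k) = 1"
      by (subst vert) (auto simp: lo_K_def elim!: evenE)
  qed (use assms in \<open>auto simp: lo_K_def\<close>)
  also have "\<dots> = vandermonde_sq ((\<lambda>p. p - lo_K 0 0) ` base (fern_cells False 0 t)) / (\<Prod>j<Suc n. fact (2 * j))"
    using base_dents[of t] n by (intro M_even) (auto simp: finite_base_tris lo_K_def card_base_tris even_sum_alt)
  finally show ?thesis using n by (simp add: lo_K_def)
qed

lemma Q_value:
  "real (Q t) = (\<Prod>p\<in>base (fern_cells False 0 t). of_int (p + 1)) * vandermonde_sq ((\<lambda>p. p + 1) ` base (fern_cells False 0 t))
    / (\<Prod>j<even_sum t. fact (2 * j + 1))"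
proof -
  let ?W = "int (odd_sum t + even_sum t)" and ?h = "2 * int (even_sum t)"
  interpret zigzag_trap lo_Q ?W ?h 1 "1 / 2" "\<lambda>_. 1"
    by (rule zigzag_trap_Q)
  have "real (Q t) = M (\<lambda>_. 1) (trap lo_Q ?W ?h 0 - dents t)"
    unfolding Q_def Q_region_def Q_trap M_def by simp
  also have "\<dots> = M (\<lambda>_. 1) (trap lo_Q ?W ?h 0 - row_ups (base (fern_cells False 0 t)))"
    by (rule M_dents) (auto simp: lo_Q_def)
  also have "\<dots> = (\<Prod>p\<in>base (fern_cells False 0 t). of_int (p - lo_Q 0 + 1)) * vandermonde_sq ((\<lambda>p. p - lo_Q 0 + 1) ` base (fern_cells False 0 t))
      / (\<Prod>j<even_sum t. fact (2 * j + 1))"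
    using base_dents[of t] by (intro M_odd) (auto simp: finite_base_tris lo_Q_def card_base_tris even_sum_alt)
  finally show ?thesis by (simp add: lo_Q_def)
qed

definition holes_up :: "nat list \<Rightarrow> nat list \<Rightarrow> int \<Rightarrow> (int \<times> int) set" where
  "holes_up as bs L = half_cells (entry as 1) \<union> fern_cells True 0 as \<union> rfern_cells True L bs"

definition holes_down :: "nat list \<Rightarrow> nat list \<Rightarrow> nat \<Rightarrow> int \<Rightarrow> (int \<times> int) set" where
  "holes_down as bs z L = fern_cells False 0 as \<union> rfern_cells False L bs \<union> tri_cells L (int z)"

lemma N_upper_eq:
  "N_upper x y as bs = trap (lo_K (- 1)) (int (N_len x y as bs)) (int (N_up y as bs)) 0 - hole (half_cells (entry as 1))"
proof -
  have "faces_in (\<lambda>u k. 0 \<le> k \<and> k \<le> int (N_up y as bs) \<and> N_west_up k \<le> u \<and> u \<le> real (N_len x y as bs) - k / 2)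
    = trap (lo_K (- 1)) (int (N_len x y as bs)) (int (N_up y as bs)) 0"
  proof (rule faces_in_eq_trap, goal_cases)
    case (1 i k)
    have "N_west_up k = of_int (- 1) + K_west k" by (simp add: N_west_up_def K_west_def)
    then show ?case using K_west_le[of "- 1" k i] ucoord_le[of i k "int (N_len x y as bs)"] by simp
  qed (rule lo_K_step)+
  then show ?thesis using half_faces[of "entry as 1"] by (simp add: N_upper_def)
qed

text \<open>The bend of the eastern boundary is removed by completing the reflected region to a
  trapezoid of width \<open>L + z\<close> and cutting out the added triangle of side
  \<open>z\<close>. This is the origin of the dent \<open>z\<close> in
  \<open>t_minus\<close>.\<close>

lemma N_lower_eq:
  "N_lower x y z as bs = mirror ` (trap lo_Q (int (N_len x y as bs) + int z) (int (N_down y z as bs)) 0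
     - hole (tri_cells (int (N_len x y as bs)) (int z)))"
proof -
  let ?L = "int (N_len x y as bs)" and ?B = "int (N_down y z as bs)"
  let ?P = "\<lambda>u k. - ?B \<le> - k \<and> - k \<le> 0 \<and> N_west_down (- k) \<le> u \<and>
      u \<le> real (N_len x y as bs) - real_of_int (- k) / 2 \<and> u \<le> real (N_len x y as bs) + real z + real_of_int (- k) / 2"
  have P: "?P (ucoord (i, k)) k \<longleftrightarrow> 0 \<le> k \<and> k \<le> ?B \<and> lo_Q k \<le> i \<and> i \<le> ?L \<and> i \<le> ?L + int z - k" for i k
  proof -
    have "N_west_down (- k) = Q_west k" by (simp add: N_west_down_def Q_west_def)
    moreover have "ucoord (i, k) \<le> real (N_len x y as bs) + of_int k / 2 \<longleftrightarrow> i \<le> ?L"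
    proof -
      have "ucoord (i, k) \<le> real (N_len x y as bs) + of_int k / 2 \<longleftrightarrow> real_of_int i \<le> of_int ?L"
        by (simp add: ucoord_def)
      then show ?thesis by (simp only: of_int_le_iff)
    qed
    ultimately show ?thesis
      using Q_west_le[of k i] ucoord_le[of i k "?L + int z"] by auto
  qed
  have "faces_in ?P = trap lo_Q (?L + int z) ?B 0 - hole (tri_cells ?L (int z))"
  proof (rule face_set_eqI)
    fix i k
    show "up_face i k \<in> faces_in ?P \<longleftrightarrow> up_face i k \<in> trap lo_Q (?L + int z) ?B 0 - hole (tri_cells ?L (int z))"
      unfolding up_in_faces_in P using lo_Q_step(1)[of k] by auto
    show "down_face i k \<in> faces_in ?P \<longleftrightarrow> down_face i k \<in> trap lo_Q (?L + int z) ?B 0 - hole (tri_cells ?L (int z))"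
      unfolding down_in_faces_in P using lo_Q_step(2)[of "k - 1"] by auto
  qed (auto dest: trap_unit_triangle faces_in_unit_triangle)
  then show ?thesis
    unfolding N_lower_def by (subst faces_in_mirror) simp
qed

text \<open>The first triangle of the fern is not among the removed ones, being part of the half
  triangle. So the upper triangles agree with \<open>fern_cells\<close> only after union with
  \<open>half_cells\<close>.\<close>

lemma N_removed_a_eq:
  obtains A where "N_removed_a as = hole A \<union> mirror ` hole (fern_cells False 0 as)"
    "half_cells (entry as 1) \<union> A = half_cells (entry as 1) \<union> fern_cells True 0 as"
proof
  let ?t = "\<lambda>i. tri_cells (int (psum as (i - 1))) (int (entry as i))"
  let ?A = "\<Union>i\<in>{i \<in> {2..length as}. odd i}. ?t i"
  have "N_removed_a as = (\<Union>i\<in>{2..length as}. if even i then mirror ` hole (?t i) else hole (?t i))"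
    unfolding N_removed_a_def by (intro SUP_cong refl) (simp add: down_triangle_eq_mirror up_triangle_eq_hole)
  also have "\<dots> = (\<Union>i\<in>{i \<in> {2..length as}. odd i}. hole (?t i)) \<union> (\<Union>i\<in>{i \<in> {2..length as}. even i}. mirror ` hole (?t i))"
    by (auto split: if_splits)
  also have "(\<Union>i\<in>{i \<in> {2..length as}. even i}. mirror ` hole (?t i)) = mirror ` hole (fern_cells False 0 as)"
  proof -
    have "{i \<in> {2..length as}. even i} = {i \<in> {1..length as}. odd i \<longleftrightarrow> False}"
      by (auto simp: Suc_le_eq intro: ccontr)
    then show ?thesis by (simp only: fern_cells_index hole_UN image_UN add_0)
  qed
  finally show "N_removed_a as = hole ?A \<union> mirror ` hole (fern_cells False 0 as)"
    by (simp only: hole_UN)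
  have "fern_cells True 0 as \<union> tri_cells 0 (int (entry as 1)) = ?A \<union> tri_cells 0 (int (entry as 1))"
  proof (cases "length as = 0")
    case False
    then have "1 \<le> length as" by (cases as) auto
    then have "{1..length as} = insert 1 {2..length as}" by auto
    then have "{i \<in> {1..length as}. odd i \<longleftrightarrow> True} = insert 1 {i \<in> {2..length as}. odd i}" by auto
    then have "fern_cells True 0 as = ?t 1 \<union> ?A" unfolding fern_cells_index by simp
    moreover have "?t 1 = tri_cells 0 (int (entry as 1))" by (simp add: psum_def)
    ultimately show ?thesis by blast
  qed simp
  moreover have "tri_cells 0 (int (entry as 1)) \<subseteq> half_cells (entry as 1)" by (auto simp: half_cells_def tri_cells_def)
  ultimately show "half_cells (entry as 1) \<union> ?A = half_cells (entry as 1) \<union> fern_cells True 0 as" by blast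
qed

lemma N_removed_b_eq:
  assumes "sum_list bs \<le> L"
  shows "N_removed_b L bs = hole (rfern_cells True (int L) bs) \<union> mirror ` hole (rfern_cells False (int L) bs)"
proof -
  let ?t = "\<lambda>j. tri_cells (int L - int (psum bs j)) (int (entry bs j))"
  have "int (L - psum bs j) = int L - int (psum bs j)" for j
    using psum_le[of bs j] assms by simp
  then have "N_removed_b L bs = (\<Union>j\<in>{1..length bs}. if odd j then hole (?t j) else mirror ` hole (?t j))"
    unfolding N_removed_b_def by (intro SUP_cong refl) (simp add: down_triangle_eq_mirror up_triangle_eq_hole)
  also have "\<dots> = (\<Union>j\<in>{j \<in> {1..length bs}. odd j \<longleftrightarrow> True}. hole (?t j)) \<union> (\<Union>j\<in>{j \<in> {1..length bs}. odd j \<longleftrightarrow> False}. mirror ` hole (?t j))"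
    by (auto split: if_splits)
  finally show ?thesis by (simp only: rfern_cells_index hole_UN image_UN)
qed

lemma N_region_eq:
  fixes x y z as bs
  defines "L \<equiv> int (N_len x y as bs)"
  shows "N_region x y z as bs
    = (trap (lo_K (- 1)) L (int (N_up y as bs)) 0 - hole (holes_up as bs L))
      \<union> mirror ` (trap lo_Q (L + int z) (int (N_down y z as bs)) 0 - hole (holes_down as bs z L))"
proof -
  obtain A where A: "N_removed_a as = hole A \<union> mirror ` hole (fern_cells False 0 as)"
    "half_cells (entry as 1) \<union> A = half_cells (entry as 1) \<union> fern_cells True 0 as"
    by (rule N_removed_a_eq)
  have B: "N_removed_b (N_len x y as bs) bs = hole (rfern_cells True L bs) \<union> mirror ` hole (rfern_cells False L bs)"
    unfolding L_def by (rule N_removed_b_eq) (simp add: N_len_def)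
  have "hole (holes_up as bs L) = hole (half_cells (entry as 1)) \<union> hole A \<union> hole (rfern_cells True L bs)"
    unfolding holes_up_def A(2)[symmetric] hole_Un ..
  then show ?thesis
    unfolding N_region_def N_upper_eq N_lower_eq A(1) B L_def[symmetric]
  proof (intro face_set_eqI, goal_cases)
    case (3 i k)
    then show ?case by (auto simp: mem_mirror_image holes_down_def hole_Un simp del: mem_tri)
  next
    case (4 i k)
    then show ?case by (auto simp: mem_mirror_image holes_down_def hole_Un simp del: mem_tri)
  qed (auto dest: trap_unit_triangle)
qed

text \<open>The element -1 is the edge of the half triangle's base that lies in the trapezoid west
  of 0.\<close>

definition fern_up :: "nat list \<Rightarrow> nat list \<Rightarrow> int \<Rightarrow> int set" where
  "fern_up as bs L = {- 1} \<union> base (fern_cells True 0 as) \<union> base (rfern_cells True L bs)"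

definition fern_down :: "nat list \<Rightarrow> nat list \<Rightarrow> nat \<Rightarrow> int \<Rightarrow> int set" where
  "fern_down as bs z L = base (fern_cells False 0 as) \<union> base (rfern_cells False L bs) \<union> {L..<L + int z}"

text \<open>Outside the gap every unit edge from -1 to \<open>L + z\<close> is the base of one dent,
  above or below; the intervals no longer show the single entries.\<close>

lemma fern_disjoint_parts:
  assumes L: "int (sum_list as + sum_list bs) \<le> L"
  shows "fern_up as bs L \<inter> fern_down as bs z L = {}"
    "fern_up as bs L \<union> fern_down as bs z L = {- 1..<int (sum_list as)} \<union> {L - int (sum_list bs)..<L + int z}"
proof -
  let ?a1 = "base (fern_cells True 0 as)" and ?a2 = "base (fern_cells False 0 as)"
  let ?b1 = "base (rfern_cells True L bs)" and ?b2 = "base (rfern_cells False L bs)"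
  have a: "?a1 \<union> ?a2 = {0..<int (sum_list as)}" "?a1 \<inter> ?a2 = {}"
    using base_tris_cases[of 0 as] by simp_all
  have b: "?b1 \<union> ?b2 = {L - int (sum_list bs)..<L}" "?b1 \<inter> ?b2 = {}"
    using base_rtris_cases[of L bs] by simp_all
  have s: "?a1 \<subseteq> {0..<int (sum_list as)}" "?a2 \<subseteq> {0..<int (sum_list as)}"
    "?b1 \<subseteq> {L - int (sum_list bs)..<L}" "?b2 \<subseteq> {L - int (sum_list bs)..<L}"
    using a(1) b(1) by blast+
  have d: "{0..<int (sum_list as)} \<inter> {L - int (sum_list bs)..<L} = {}"
    "{0..<int (sum_list as)} \<inter> {L..<L + int z} = {}" "{L - int (sum_list bs)..<L} \<inter> {L..<L + int z} = {}"
    "{- 1} \<inter> {0..<int (sum_list as)} = {}" "{- 1} \<inter> {L - int (sum_list bs)..<L} = {}" "{- 1} \<inter> {L..<L + int z} = {}"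
    using L by auto
  show "fern_up as bs L \<inter> fern_down as bs z L = {}"
    unfolding fern_up_def fern_down_def using a(2) b(2) s d by blast
  have "fern_up as bs L \<union> fern_down as bs z L = {- 1} \<union> (?a1 \<union> ?a2) \<union> (?b1 \<union> ?b2) \<union> {L..<L + int z}"
    unfolding fern_up_def fern_down_def by blast
  also have "\<dots> = {- 1..<int (sum_list as)} \<union> {L - int (sum_list bs)..<L + int z}"
    unfolding a(1) b(1) using L by auto
  finally show "fern_up as bs L \<union> fern_down as bs z L = {- 1..<int (sum_list as)} \<union> {L - int (sum_list bs)..<L + int z}" .
qed

lemma finite_ferns: "finite (fern_up as bs L)" "finite (fern_down as bs z L)"
  by (simp_all add: fern_up_def fern_down_def finite_base_tris)

lemma card_ferns:
  assumes L: "int (sum_list as + sum_list bs) \<le> L"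
  shows "card (fern_up as bs L) = Suc (odd_sum as + odd_sum bs)"
    "card (fern_down as bs z L) = even_sum as + even_sum bs + z"
proof -
  have s: "base (fern_cells p 0 as) \<subseteq> {0..<int (sum_list as)}" "base (rfern_cells p L bs) \<subseteq> {L - int (sum_list bs)..<L}" for p
    using base_tris_subset[of p 0 as] base_rtris_subset[of p L bs] by simp_all
  have d: "{0..<int (sum_list as)} \<inter> {L - int (sum_list bs)..<L} = {}" using L by auto
  have ab: "base (fern_cells p 0 as) \<inter> base (rfern_cells p L bs) = {}" for p
    using s(1)[of p] s(2)[of p] d by blast
  then have c: "card (base (fern_cells p 0 as) \<union> base (rfern_cells p L bs)) = alternate_sum p as + alternate_sum p bs" for p
    using card_Un_disjoint[OF finite_base_tris(1) finite_base_tris(2) ab[of p]]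
    by (simp add: card_base_tris card_base_rtris)
  have "- 1 \<notin> base (fern_cells True 0 as) \<union> base (rfern_cells True L bs)"
    using s(1)[of True] s(2)[of True] L by (auto simp: subset_iff simp del: mem_base)
  moreover have "fern_up as bs L = insert (- 1) (base (fern_cells True 0 as) \<union> base (rfern_cells True L bs))"
    by (simp add: fern_up_def)
  ultimately show "card (fern_up as bs L) = Suc (odd_sum as + odd_sum bs)"
    using c[of True] by (simp add: finite_base_tris odd_sum_alt)
  have "(base (fern_cells False 0 as) \<union> base (rfern_cells False L bs)) \<inter> {L..<L + int z} = {}"
    using s(1)[of False] s(2)[of False] L by (auto simp: subset_iff simp del: mem_base)
  then show "card (fern_down as bs z L) = even_sum as + even_sum bs + z"
    unfolding fern_down_def using c[of False]
    by (subst card_Un_disjoint) (simp_all add: finite_base_tris even_sum_alt)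
qed

lemma sums_le: "odd_sum xs \<le> sum_list xs" "even_sum xs \<le> sum_list xs" "odd_sum xs + even_sum xs = sum_list xs"
  by (simp_all add: odd_sum_alt even_sum_alt alt_le alt_add)

lemma entry1_le: "entry xs 1 \<le> odd_sum xs"
  by (cases xs) (auto simp: entry_def odd_sum_alt)

section \<open>The two halves of the region and the cut along \<ell>\<close>

locale N_setup =
  fixes x y z :: nat and as bs :: "nat list"
begin

definition "L = int (N_len x y as bs)"
definition "A = int (N_up y as bs)"
definition "B = int (N_down y z as bs)"
definition "w = zigzag_weight (zigzag N_west_up A)"
definition "G = {int (sum_list as)..<int (sum_list as + x + y)}"
definition "U = trap (lo_K (- 1)) L A 0 - hole (holes_up as bs L)"
definition "D = trap lo_Q (L + int z) B 0 - hole (holes_down as bs z L)"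

lemma L_eq: "L = int (sum_list as) + int x + int y + int (sum_list bs)"
  by (simp add: L_def N_len_def)

lemma L_ge: "int (sum_list as + sum_list bs) \<le> L"
  by (simp add: L_eq)

lemma A_eq: "A = 2 * int (odd_sum as + odd_sum bs + y) + 1"
  by (simp add: A_def N_up_def)

lemma B_eq: "B = 2 * int (even_sum as + even_sum bs + z + y)"
  by (simp add: B_def N_down_def)

lemma finite_G: "finite G"
  by (simp add: G_def)

lemma G_disjoint: "S \<subseteq> G \<Longrightarrow> fern_up as bs L \<inter> S = {}" "S \<subseteq> G \<Longrightarrow> fern_down as bs z L \<inter> S = {}"
proof -
  have "(fern_up as bs L \<union> fern_down as bs z L) \<inter> G = {}"
    unfolding fern_disjoint_parts(2)[OF L_ge] G_def by (auto simp: L_eq)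
  then show "S \<subseteq> G \<Longrightarrow> fern_up as bs L \<inter> S = {}" "S \<subseteq> G \<Longrightarrow> fern_down as bs z L \<inter> S = {}" by blast+
qed

sublocale up: zigzag_trap "lo_K (- 1)" L A 0 0 w
proof -
  have "N_west_up k = of_int (- 1) + K_west k" for k by (simp add: N_west_up_def K_west_def)
  then show "zigzag_trap (lo_K (- 1)) A 0 0 w" unfolding w_def by (rule zigzag_trap_K)
qed

sublocale down: zigzag_trap lo_Q "L + int z" B 1 "1 / 2" "\<lambda>_. 1"
  by (rule zigzag_trap_Q)

text \<open>The critical hole is the half triangle. Inside the zigzag its cells have height at most
  \<open>2 * entry as 1\<close>, and this entry is one of those counted in
  \<open>odd_sum as\<close>, hence in \<open>A\<close>.\<close>

lemma up_range:
  assumes "(i, k) \<in> holes_up as bs L" "lo_K (- 1) k \<le> i"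
  shows "k < A \<and> i < L - k"
  using assms(1) unfolding holes_up_def
proof (elim UnE)
  assume "(i, k) \<in> half_cells (entry as 1)"
  then have "0 \<le> k" "i + k < int (entry as 1)" by (auto simp: half_cells_def)
  moreover have "entry as 1 \<le> odd_sum as" "odd_sum as \<le> sum_list as" by (rule entry1_le, rule sums_le)
  ultimately show ?thesis using assms(2) by (auto simp: lo_K_def A_eq L_eq)
next
  assume "(i, k) \<in> fern_cells True 0 as"
  from fern_cells_mem[OF this] show ?thesis by (auto simp: A_eq L_eq odd_sum_alt)
next
  assume "(i, k) \<in> rfern_cells True L bs"
  from rfern_cells_mem[OF this] show ?thesis by (auto simp: A_eq odd_sum_alt)
qed

text \<open>Among the lozenges forced in the holes, only those of the half triangle reach the axis:
  one at each of the heights 2, 4, ..., \<open>2 * entry as 1\<close>.\<close>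

lemma up_weights:
  "(\<Prod>(i, k)\<in>{(i, k). (i, k) \<in> holes_up as bs L \<and> 1 \<le> k \<and> lo_K (- 1) k \<le> i}. w (vertical_lozenge i k))
    = (1 / 2) ^ entry as 1"
proof -
  let ?D = "{(i, k). (i, k) \<in> holes_up as bs L \<and> 1 \<le> k \<and> lo_K (- 1) k \<le> i}"
  let ?D' = "(\<lambda>m. (- 1 - m, 2 * m)) ` {1..int (entry as 1)}"
  have fin: "finite ?D"
  proof (rule finite_subset)
    show "?D \<subseteq> {- 1 - A..L} \<times> {1..A}"
    proof clarify
      fix i k assume ik: "(i, k) \<in> holes_up as bs L" "1 \<le> k" "lo_K (- 1) k \<le> i"
      have "- 1 - A \<le> lo_K (- 1) k" using up_range[OF ik(1,3)] ik(2) by (auto simp: lo_K_def)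
      then show "i \<in> {- 1 - A..L} \<and> k \<in> {1..A}" using up_range[OF ik(1,3)] ik by auto
    qed
  qed simp
  have wt: "w (vertical_lozenge i k) = (if (i, k) \<in> ?D' then 1 / 2 else 1)" if "(i, k) \<in> ?D" for i k
  proof -
    have ik: "(i, k) \<in> holes_up as bs L" "1 \<le> k" "lo_K (- 1) k \<le> i" using that by auto
    have "w (vertical_lozenge i k) = (if even k \<and> i = lo_K (- 1) k then 1 / 2 else 1)"
      using ik up_range[OF ik(1,3)] by (subst up.vert) auto
    moreover have "(even k \<and> i = lo_K (- 1) k) \<longleftrightarrow> (i, k) \<in> ?D'"
    proof
      assume e: "even k \<and> i = lo_K (- 1) k"
      then obtain m where m: "k = 2 * m" by (elim conjE evenE)
      then have i: "i = - 1 - m" "i < 0" using e ik(2) by (auto simp: lo_K_def)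
      have "(i, k) \<in> half_cells (entry as 1)"
        using ik(1) i(2) fern_cells_mem[of i k True 0 as] rfern_cells_mem[of i k True L bs] L_ge
        unfolding holes_up_def by auto
      then show "(i, k) \<in> ?D'" using i m ik(2) by (auto simp: half_cells_def)
    qed (auto simp: lo_K_def)
    ultimately show ?thesis by simp
  qed
  have sub: "?D' \<subseteq> ?D"
    by (auto simp: holes_up_def half_cells_def lo_K_def)
  have "(\<Prod>(i, k)\<in>?D. w (vertical_lozenge i k)) = (\<Prod>z\<in>?D. if z \<in> ?D' then 1 / 2 else 1)"
    using wt by (intro prod.cong refl) auto
  also have "\<dots> = (\<Prod>z\<in>?D'. 1 / 2)"
    using fin sub by (subst prod.mono_neutral_right[of ?D ?D']) auto
  also have "\<dots> = (1 / 2) ^ card ?D'" by simp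
  also have "card ?D' = entry as 1"
    by (subst card_image) (auto simp: inj_on_def)
  finally show ?thesis .
qed

text \<open>Filling the holes brings in the forced weight of \<open>up_weights\<close>, which must
  be divided out again: this is the power of 2. With a wrong number of dents the trapezoid is
  unbalanced.\<close>

lemma M_up:
  assumes S: "S \<subseteq> G"
  shows "M w (U - row_ups S) = (if card S = y
    then 2 ^ entry as 1 * vandermonde_sq ((\<lambda>p. p + 1) ` (fern_up as bs L \<union> S)) / (\<Prod>j<Suc (odd_sum as + odd_sum bs + y). fact (2 * j))
    else 0)"
proof -
  let ?T = "trap (lo_K (- 1)) L A 0" and ?F = "fern_up as bs L"
  have fS: "finite S" using S finite_G finite_subset by blast
  have st: "stair (holes_up as bs L)"
    unfolding holes_up_def by (intro stair_Un stair_tris stair_rtris) (auto simp: stair_def half_cells_def)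
  have "M w (?T - row_ups ({i. (i, 0) \<in> holes_up as bs L} \<union> S)) = (1 / 2) ^ entry as 1 * M w (?T - hole (holes_up as bs L) - row_ups S)"
    unfolding up_weights[symmetric]
    using st up_range by (intro M_hole) (force simp: stair_def)+
  moreover have "?T - row_ups ({i. (i, 0) \<in> holes_up as bs L} \<union> S) = ?T - row_ups (?F \<union> S)"
  proof (rule face_set_eqI)
    fix i k
    \<comment> \<open>The cells of the half triangle continue to the west without end; from -1 on,
      their base is -1 itself and the base of the first triangle of the fern.\<close>
    have "(i, 0) \<in> holes_up as bs L \<longleftrightarrow> i \<in> ?F" if "- 1 \<le> i"
    proof -
      have "(i, 0) \<in> tri_cells 0 (int (entry as 1)) \<Longrightarrow> (i, 0) \<in> fern_cells True 0 as"
        by (cases as) (auto simp: entry_def)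
      then show ?thesis using that by (auto simp: holes_up_def fern_up_def half_cells_def)
    qed
    then show "up_face i k \<in> ?T - row_ups ({i. (i, 0) \<in> holes_up as bs L} \<union> S) \<longleftrightarrow> up_face i k \<in> ?T - row_ups (?F \<union> S)"
      by (auto simp: lo_K_def)
    show "down_face i k \<in> ?T - row_ups ({i. (i, 0) \<in> holes_up as bs L} \<union> S) \<longleftrightarrow> down_face i k \<in> ?T - row_ups (?F \<union> S)"
      by simp
  qed (auto dest: trap_unit_triangle)
  ultimately have eq: "M w (U - row_ups S) = 2 ^ entry as 1 * M w (?T - row_ups (?F \<union> S))"
    by (simp add: U_def power_one_over)
  have sub: "?F \<union> S \<subseteq> {lo_K (- 1) 0..<L}"
  proof -
    have "?F \<subseteq> {- 1..<L}"
      using base_tris_subset[of True 0 as] base_rtris_subset[of True L bs] L_ge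
      unfolding fern_up_def by (auto simp: subset_iff L_eq simp del: mem_base)
    moreover have "S \<subseteq> {- 1..<L}" using S by (auto simp: G_def L_eq)
    ultimately show ?thesis by (simp add: lo_K_def)
  qed
  have card: "card (?F \<union> S) = Suc (odd_sum as + odd_sum bs) + card S"
    using card_Un_disjoint[OF finite_ferns(1) fS G_disjoint(1)[OF S]] card_ferns(1)[OF L_ge] by simp
  show ?thesis
  proof (cases "card S = y")
    case True
    have "M w (?T - row_ups (?F \<union> S)) = vandermonde_sq ((\<lambda>p. p - lo_K (- 1) 0) ` (?F \<union> S)) / (\<Prod>j<Suc (odd_sum as + odd_sum bs + y). fact (2 * j))"
      using True card sub fS by (intro up.M_even) (auto simp: finite_ferns A_eq)
    then show ?thesis using True eq by (simp add: lo_K_def)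
  next
    case False
    have "M w (?T - row_ups (?F \<union> S)) = 0"
    proof (rule ccontr)
      assume nz: "M w (?T - row_ups (?F \<union> S)) \<noteq> 0"
      have "int (card (?F \<union> S)) = A + lo_K (- 1) A - lo_K (- 1) 0"
      proof (rule trap_balanced[OF _ _ sub nz])
        fix j assume j: "0 \<le> j" "j \<le> A"
        have "int (odd_sum as) \<le> int (sum_list as)" "int (odd_sum bs) \<le> int (sum_list bs)"
          using sums_le(1)[of as] sums_le(1)[of bs] by simp_all
        moreover have "2 * (j - j div 2) \<le> j + 1" by presburger
        moreover have "j \<le> 2 * (int (odd_sum as) + int (odd_sum bs) + int y) + 1"
          using j by (simp add: A_eq)
        ultimately have "2 * (j - j div 2) \<le> 2 * (L + 1)" unfolding L_eq by simp
        then have "j - j div 2 \<le> L + 1" by simp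
        then show "lo_K (- 1) j \<le> L - j" by (simp add: lo_K_def)
      qed (simp add: A_eq)
      then have "card S = y" unfolding card by (simp add: lo_K_def A_eq)
      then show False using False by simp
    qed
    then show ?thesis using False eq by simp
  qed
qed

lemma M_down:
  assumes S: "S \<subseteq> G" "card S = y"
  shows "M (\<lambda>_. 1) (D - row_ups S) = (\<Prod>p\<in>fern_down as bs z L \<union> S. of_int (p + 1))
    * vandermonde_sq ((\<lambda>p. p + 1) ` (fern_down as bs z L \<union> S)) / (\<Prod>j<even_sum as + even_sum bs + z + y. fact (2 * j + 1))"
proof -
  let ?T = "trap lo_Q (L + int z) B 0" and ?F = "fern_down as bs z L"
  have fS: "finite S" using S finite_G finite_subset by blast
  have st: "stair (holes_down as bs z L)"
    unfolding holes_down_def by (intro stair_Un stair_tris stair_rtris stair_tri)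
  have rng: "k < B \<and> i < L + int z - k" if "(i, k) \<in> holes_down as bs z L" for i k
    using that unfolding holes_down_def
  proof (elim UnE)
    assume "(i, k) \<in> fern_cells False 0 as"
    from fern_cells_mem[OF this] show ?thesis by (auto simp: B_eq L_eq even_sum_alt)
  next
    assume "(i, k) \<in> rfern_cells False L bs"
    from rfern_cells_mem[OF this] show ?thesis by (auto simp: B_eq even_sum_alt)
  qed (auto simp: B_eq)
  have "M (\<lambda>_. 1) (?T - row_ups ({i. (i, 0) \<in> holes_down as bs z L} \<union> S)) = M (\<lambda>_. 1) (?T - hole (holes_down as bs z L) - row_ups S)"
    using M_hole[of "holes_down as bs z L" lo_Q B "L + int z" "\<lambda>_. 1" S] st rng by (force simp: stair_def)
  moreover have "{i. (i, 0) \<in> holes_down as bs z L} = ?F"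
    by (auto simp: holes_down_def fern_down_def)
  ultimately have eq: "M (\<lambda>_. 1) (D - row_ups S) = M (\<lambda>_. 1) (?T - row_ups (?F \<union> S))"
    by (simp add: D_def)
  have sub: "?F \<union> S \<subseteq> {lo_Q 0..<L + int z}"
  proof -
    have "?F \<subseteq> {0..<L + int z}"
      using base_tris_subset[of False 0 as] base_rtris_subset[of False L bs] L_ge
      unfolding fern_down_def by (auto simp: subset_iff L_eq simp del: mem_base)
    moreover have "S \<subseteq> {0..<L + int z}" using S by (auto simp: G_def L_eq)
    ultimately show ?thesis by (simp add: lo_Q_def)
  qed
  have "card (?F \<union> S) = even_sum as + even_sum bs + z + y"
    using card_Un_disjoint[OF finite_ferns(2) fS G_disjoint(2)[OF S(1)]] card_ferns(2)[OF L_ge] S(2) by simp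
  then have "M (\<lambda>_. 1) (?T - row_ups (?F \<union> S)) = (\<Prod>p\<in>?F \<union> S. of_int (p - lo_Q 0 + 1))
    * vandermonde_sq ((\<lambda>p. p - lo_Q 0 + 1) ` (?F \<union> S)) / (\<Prod>j<even_sum as + even_sum bs + z + y. fact (2 * j + 1))"
    using sub fS by (intro down.M_odd) (auto simp: finite_ferns B_eq)
  then show ?thesis using eq by (simp add: lo_Q_def)
qed

text \<open>A lozenge can cross \<ell> only at an edge with a remaining triangle on both sides, that
  is, in the gap. The balance of the upper half leaves only the sets \<open>S\<close> of size
  \<open>y\<close>.\<close>

lemma MN_sum: "MN x y z as bs = (\<Sum>S | S \<subseteq> G \<and> card S = y. M w (U - row_ups S) * M (\<lambda>_. 1) (D - row_ups S))"
proof -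
  define E where "E = {i. up_face i 0 \<in> U \<and> up_face i 0 \<in> D}"
  \<comment> \<open>If \<open>B = 0\<close>, there is no lower half and nothing crosses, although
    the gap may be nonempty; \<open>y\<close> is then 0, too.\<close>
  have E: "E = (if 0 < B then G else {})"
  proof -
    have "i \<in> G" if "i \<in> E" for i
    proof -
      have i: "- 1 \<le> i" "i < L" "0 \<le> i" "(i, 0) \<notin> holes_up as bs L" "(i, 0) \<notin> holes_down as bs z L"
        using that by (auto simp: E_def U_def D_def lo_K_def lo_Q_def)
      then have "i \<notin> fern_up as bs L \<union> fern_down as bs z L"
        by (auto simp: holes_up_def holes_down_def fern_up_def fern_down_def)
      then show "i \<in> G"
        using i unfolding fern_disjoint_parts(2)[OF L_ge] by (auto simp: G_def L_eq)
    qed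
    moreover have "i \<in> E" if i: "i \<in> G" and B: "0 < B" for i
    proof -
      have "i \<notin> fern_up as bs L" "i \<notin> fern_down as bs z L"
        using G_disjoint[of "{i}"] i by auto
      moreover have "int (sum_list as) \<le> i" "i < L" using i by (auto simp: G_def L_eq)
      moreover have "int (entry as 1) \<le> int (sum_list as)"
        using entry1_le[of as] sums_le(1)[of as] by linarith
      ultimately show ?thesis using B
        by (auto simp: E_def U_def D_def lo_K_def lo_Q_def A_eq holes_up_def holes_down_def fern_up_def fern_down_def half_cells_def)
    qed
    moreover have "E = {}" if "\<not> 0 < B" using that by (auto simp: E_def D_def)
    ultimately show ?thesis by auto
  qed
  have R: "N_region x y z as bs = U \<union> mirror ` D"
    unfolding N_region_eq U_def D_def L_def A_def B_def ..
  have fin: "finite U" "finite D" by (simp_all add: U_def D_def)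
  have unit: "unit_triangle f" if "f \<in> U \<or> f \<in> mirror ` D" for f
    using that by (auto simp: U_def D_def dest: trap_unit_triangle)
  have Umem: "up_face i k \<in> U \<Longrightarrow> 0 \<le> k" "down_face i k \<in> U \<Longrightarrow> 1 \<le> k" for i k
    by (simp_all add: U_def)
  have Dmem: "up_face i k \<in> mirror ` D \<Longrightarrow> k \<le> - 1" "down_face i k \<in> mirror ` D \<Longrightarrow> k \<le> 0" for i k
    by (simp_all add: mem_mirror_image D_def)
  have "MN x y z as bs = M w (U \<union> mirror ` D)"
    unfolding MN_def R w_def A_def ..
  also have "\<dots> = (\<Sum>S\<in>Pow E. (\<Prod>i\<in>S. w {up_face i 0, down_face i 0})
      * M w (U - (\<lambda>i. up_face i 0) ` S) * M w (mirror ` D - (\<lambda>i. down_face i 0) ` S))"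
  proof (rule M_cut)
    show "U \<inter> mirror ` D = {}"
    proof (rule ccontr)
      assume "U \<inter> mirror ` D \<noteq> {}"
      then obtain f where f: "f \<in> U" "f \<in> mirror ` D" by blast
      then have "unit_triangle f" using unit by blast
      then show False
      proof (rule unit_triangle_cases)
        fix i k assume "f = up_face i k"
        then show False using Umem(1)[of i k] Dmem(1)[of i k] f by simp
      next
        fix i k assume "f = down_face i k"
        then show False using Umem(2)[of i k] Dmem(2)[of i k] f by simp
      qed
    qed
    show "finite E" unfolding E by (simp add: finite_G)
    show "(\<lambda>i. down_face i 0) ` E \<subseteq> mirror ` D"
      by (auto simp: E_def mem_mirror_image)
    fix f g assume f: "f \<in> U" and g: "g \<in> mirror ` D" and fg: "lozenge {f, g}"
    show "\<exists>i\<in>E. f = up_face i 0 \<and> g = down_face i 0"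
      using fg
    proof (rule lozenge_cases)
      fix i k j m assume eq: "{f, g} = {up_face i k, down_face j m}"
        and adj: "(j = i \<and> m = k) \<or> (j = i \<and> m = k + 1) \<or> (j = i - 1 \<and> m = k + 1)"
      show ?thesis
      proof (cases "f = up_face i k")
        case True
        then have g': "g = down_face j m" using eq by (metis doubleton_eq_iff)
        have "0 \<le> k" "m \<le> 0" using Umem(1)[of i k] Dmem(2)[of j m] f g True g' by simp_all
        then have "k = 0" "m = 0" "j = i" using adj by auto
        then show ?thesis using True g' f g by (intro bexI[of _ i]) (auto simp: E_def mem_mirror_image)
      next
        case False
        then have "f = down_face j m" "g = up_face i k" using eq by (auto simp: doubleton_eq_iff)
        then have "1 \<le> m" "k \<le> - 1" using Umem(2)[of j m] Dmem(1)[of i k] f g by simp_all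
        then show ?thesis using adj by auto
      qed
    qed
  qed (use fin in \<open>auto simp: E_def inj_on_def lozenge_up_down\<close>)
  also have "\<dots> = (\<Sum>S\<in>Pow E. M w (U - row_ups S) * M (\<lambda>_. 1) (D - row_ups S))"
  proof (rule sum.cong[OF refl])
    fix S
    \<comment> \<open>A vertical lozenge of the lower half has its bottom vertex below \<ell>, where
      the weighted zigzag has no vertices.\<close>
    have wl: "w l = 1" if l: "lozenge l" "l \<subseteq> mirror ` D" for l
    proof -
      have "False" if v: "l = vertical_lozenge i k" "(i + 1, k - 1) \<in> zigzag N_west_up A" for i k
      proof -
        have "down_face i k \<in> mirror ` D" using l v(1) by (auto simp: vertical_lozenge_def)
        then show False using Dmem(2)[of i k] v(2) by (simp add: zigzag_def)
      qed
      then show ?thesis by (auto simp: w_def zigzag_weight_def)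
    qed
    have "w {up_face i 0, down_face i 0} = 1" for i
      unfolding w_def vertical_lozenge_def[symmetric] zigzag_weight_vertical by (simp add: zigzag_def)
    moreover have "mirror ` D - (\<lambda>i. down_face i 0) ` S = mirror ` (D - row_ups S)"
      unfolding image_set_diff[OF inj_mirror] row_ups_def image_image by simp
    moreover have "M w (mirror ` (D - row_ups S)) = M (\<lambda>_. 1) (D - row_ups S)"
      by (rule M_mirror) (rule wl, auto)
    ultimately show "(\<Prod>i\<in>S. w {up_face i 0, down_face i 0})
      * M w (U - (\<lambda>i. up_face i 0) ` S) * M w (mirror ` D - (\<lambda>i. down_face i 0) ` S)
      = M w (U - row_ups S) * M (\<lambda>_. 1) (D - row_ups S)"
      by (simp add: row_ups_def)
  qed
  also have "\<dots> = (\<Sum>S | S \<subseteq> G \<and> card S = y. M w (U - row_ups S) * M (\<lambda>_. 1) (D - row_ups S))"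
  proof (cases "0 < B")
    case True
    then show ?thesis
      using E finite_G M_up by (intro sum.mono_neutral_right) auto
  next
    case False
    then have "y = 0" "E = {}" using E by (auto simp: B_eq)
    moreover have "{S. S \<subseteq> G \<and> card S = 0} = {{}}"
      using finite_G by (auto dest: finite_subset)
    ultimately show ?thesis by simp
  qed
  finally show ?thesis .
qed

end

text \<open>What the two halves contribute independently of \<open>S\<close>. The gap enters through
  \<open>L\<close> only, hence through \<open>x + y\<close>.\<close>

definition fern_const :: "nat list \<Rightarrow> nat list \<Rightarrow> nat \<Rightarrow> int \<Rightarrow> real" where
  "fern_const as bs z L = vandermonde_sq ((\<lambda>p. p + 1) ` fern_up as bs L)
     * (vandermonde_sq ((\<lambda>p. p + 1) ` fern_down as bs z L) * (\<Prod>q\<in>fern_down as bs z L. of_int (q + 1)))"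

text \<open>The denominators of \<open>M_even\<close> and \<open>M_odd\<close> for the dents in the
  two halves, whose numbers depend on \<open>y\<close> but not on \<open>x\<close>.\<close>

definition norm_const :: "nat list \<Rightarrow> nat list \<Rightarrow> nat \<Rightarrow> nat \<Rightarrow> real" where
  "norm_const as bs z y = (\<Prod>j<Suc (odd_sum as + odd_sum bs + y). fact (2 * j))
     * (\<Prod>j<even_sum as + even_sum bs + z + y. fact (2 * j + 1))"

lemma norm_const_pos: "0 < norm_const as bs z y"
  unfolding norm_const_def by (intro mult_pos_pos prod_pos) simp_all

lemma fern_nonneg:
  assumes "int (sum_list as + sum_list bs) \<le> L"
  shows "p \<in> fern_up as bs L \<Longrightarrow> 0 \<le> p + 1" "p \<in> fern_down as bs z L \<Longrightarrow> 0 < p + 1"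
proof -
  have "p \<in> fern_up as bs L \<union> fern_down as bs z L \<Longrightarrow> - 1 \<le> p"
    unfolding fern_disjoint_parts(2)[OF assms] using assms by auto
  moreover have "- 1 \<in> fern_up as bs L" by (simp add: fern_up_def)
  then have "p \<in> fern_down as bs z L \<Longrightarrow> p \<noteq> - 1"
    using fern_disjoint_parts(1)[OF assms, of z] by blast
  ultimately show "p \<in> fern_up as bs L \<Longrightarrow> 0 \<le> p + 1" "p \<in> fern_down as bs z L \<Longrightarrow> 0 < p + 1"
    by force+
qed

lemma fern_const_pos:
  assumes "int (sum_list as + sum_list bs) \<le> L"
  shows "0 < fern_const as bs z L"
proof -
  have "0 < vandermonde_sq ((\<lambda>p. p + 1) ` fern_up as bs L)"
    using fern_nonneg(1)[OF assms] by (intro vandermonde_sq_pos finite_imageI finite_ferns) blast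
  moreover have "0 < vandermonde_sq ((\<lambda>p. p + 1) ` fern_down as bs z L)"
    using fern_nonneg(2)[OF assms, THEN less_imp_le] by (intro vandermonde_sq_pos finite_imageI finite_ferns) blast
  moreover have "0 < (\<Prod>q\<in>fern_down as bs z L. of_int (q + 1) :: real)"
    using fern_nonneg(2)[OF assms] by (intro prod_pos) (simp only: of_int_0_less_iff)
  ultimately show ?thesis unfolding fern_const_def by (intro mult_pos_pos)
qed

context N_setup
begin

text \<open>Pairs within \<open>S\<close> occur in both halves and give a square; a pair of an
  element of \<open>S\<close> and a fern position occurs in one half only. As the fern positions of
  the halves are complementary, the mixed pairs make up \<open>selberg_weight\<close>.\<close>

lemma MN_sel:
  "MN x y z as bs = 2 ^ entry as 1 * fern_const as bs z L / norm_const as bs z y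
     * selberg_sum (sum_list as) (sum_list as + x + y) (sum_list as + x + y + (sum_list bs + z)) y"
proof -
  let ?s = "\<lambda>p :: int. p + 1"
  let ?a = "sum_list as"
  let ?N = "?a + x + y"
  let ?K = "?N + (sum_list bs + z)"
  let ?F = "?s ` fern_up as bs L" and ?D = "?s ` fern_down as bs z L"
  let ?c = "2 ^ entry as 1 * fern_const as bs z L / norm_const as bs z y"
  have inj: "inj_on ?s X" for X by (auto simp: inj_on_def)
  have FD: "?F \<union> ?D = {0..int ?a} \<union> {int ?N<..int ?K}" "?F \<inter> ?D = {}"
  proof -
    have "?F \<union> ?D = ?s ` ({- 1..<int ?a} \<union> {L - int (sum_list bs)..<L + int z})"
      unfolding image_Un[symmetric] fern_disjoint_parts(2)[OF L_ge] ..
    also have "\<dots> = {0..int ?a} \<union> {int ?N<..int ?K}"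
      unfolding image_Un image_add_atLeastLessThan' L_eq by auto
    finally show "?F \<union> ?D = {0..int ?a} \<union> {int ?N<..int ?K}" .
    show "?F \<inter> ?D = {}"
      using fern_disjoint_parts(1)[OF L_ge, of z] by auto
  qed
  have nonneg: "0 \<le> q" if "q \<in> ?F \<union> ?D" for q
    using that unfolding FD by auto
  have fin: "finite ?F" "finite ?D" by (simp_all add: finite_ferns)
  have "MN x y z as bs = (\<Sum>S | S \<subseteq> {int ?a<..int ?N} \<and> card S = y. ?c * (vandermonde_sq S * vandermonde_sq S * (\<Prod>x\<in>S. selberg_weight ?a ?N ?K x)))"
    unfolding MN_sum
  \<comment> \<open>Adding 1 turns positions on \<ell> into distances from the axis.\<close>
  proof (rule sum.reindex_bij_witness[of _ "\<lambda>S. (\<lambda>p. p - 1) ` S" "\<lambda>S. ?s ` S"], goal_cases)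
    case (1 S)
    then show ?case by (simp add: image_image)
  next
    case (2 S)
    then show ?case by (auto simp: card_image[OF inj] G_def)
  next
    case (3 S)
    then show ?case by (simp add: image_image)
  next
    case (4 S)
    moreover have "inj_on (\<lambda>p :: int. p - 1) S" by (auto simp: inj_on_def)
    ultimately show ?case by (auto simp: card_image G_def)
  next
    case (5 S)
    then have S: "S \<subseteq> G" "card S = y" by auto
    let ?S = "?s ` S"
    have fS: "finite S" using S finite_G finite_subset by blast
    have dis: "?F \<inter> ?S = {}" "?D \<inter> ?S = {}"
      using G_disjoint[OF S(1)] by auto
    have nS: "0 \<le> q" if "q \<in> ?S" for q using that S(1) by (auto simp: G_def)
    let ?f = "\<lambda>x q. \<bar>of_int (x\<^sup>2 - q\<^sup>2)\<bar> :: real"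
    have vU: "vandermonde_sq (?s ` (fern_up as bs L \<union> S)) = vandermonde_sq ?F * vandermonde_sq ?S * (\<Prod>x\<in>?S. \<Prod>q\<in>?F. ?f x q)"
      unfolding image_Un using fin fS dis nonneg nS by (intro vandermonde_sq_Un) auto
    have vD: "vandermonde_sq (?s ` (fern_down as bs z L \<union> S)) = vandermonde_sq ?D * vandermonde_sq ?S * (\<Prod>x\<in>?S. \<Prod>q\<in>?D. ?f x q)"
      unfolding image_Un using fin fS dis nonneg nS by (intro vandermonde_sq_Un) auto
    have pD: "(\<Prod>p\<in>fern_down as bs z L \<union> S. of_int (p + 1)) = (\<Prod>p\<in>fern_down as bs z L. of_int (p + 1)) * (\<Prod>x\<in>?S. of_int x :: real)"
      using prod.union_disjoint[OF finite_ferns(2) fS G_disjoint(2)[OF S(1)]]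
      by (simp add: prod.reindex[OF inj] del: of_int_add)
    have "(\<Prod>x\<in>?S. selberg_weight ?a ?N ?K x) = (\<Prod>x\<in>?S. of_int x) * (\<Prod>x\<in>?S. \<Prod>q\<in>?F. ?f x q) * (\<Prod>x\<in>?S. \<Prod>q\<in>?D. ?f x q)"
    proof -
      have "selberg_weight ?a ?N ?K x = of_int x * (\<Prod>q\<in>?F. ?f x q) * (\<Prod>q\<in>?D. ?f x q)" for x
        unfolding selberg_weight_def FD(1)[symmetric] prod.union_disjoint[OF fin FD(2)] by (simp only: mult.assoc)
      then show ?thesis by (simp add: prod.distrib)
    qed
    then show ?case
      unfolding M_up[OF S(1)] M_down[OF S] vU vD pD fern_const_def norm_const_def
      using S(2) by simp
  qed
  also have "\<dots> = ?c * selberg_sum ?a ?N ?K y"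
    unfolding selberg_sum_def by (rule sum_distrib_left[symmetric])
  finally show ?thesis .
qed

end

section \<open>Assembly of the two formulas\<close>

lemma selberg_sum_zero: "selberg_sum a N K 0 = 1"
proof -
  have "{S. S \<subseteq> {int a<..int N} \<and> card S = 0} = {{}}"
    by (auto dest: finite_subset)
  then show ?thesis by (simp add: selberg_sum_def)
qed

text \<open>The dents of the two quartered hexagons are the fern bases alone, with an empty gap of
  width \<open>x + y\<close>. So their product has the fern constant of the region and the
  normalisation for \<open>y = 0\<close>.\<close>

lemma K'_Q_value:
  "2 ^ entry as 1 * fern_const as bs z (int (N_len x y as bs)) / norm_const as bs z 0
    = 2 ^ entry as 1 * K' (t_plus x y as bs) * real (Q (t_minus x y z as bs))"
proof -
  let ?L = "int (N_len x y as bs)"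
  have L: "int (sum_list as + sum_list bs) \<le> ?L" by (simp add: N_len_def)
  have up: "base (fern_cells False 0 (t_plus x y as bs)) = (\<lambda>p. p + 1) ` fern_up as bs ?L"
  proof (rule Set.set_eqI)
    fix i
    have "i \<in> (\<lambda>p. p + 1) ` X \<longleftrightarrow> i - 1 \<in> X" for X :: "int set"
      by (metis (no_types, lifting) add_diff_cancel diff_add_cancel imageE image_eqI)
    then show "i \<in> base (fern_cells False 0 (t_plus x y as bs)) \<longleftrightarrow> i \<in> (\<lambda>p. p + 1) ` fern_up as bs ?L"
      unfolding t_plus_base fern_up_def by simp
  qed
  have down: "base (fern_cells False 0 (t_minus x y z as bs)) = fern_down as bs z ?L"
    unfolding t_minus_tris fern_down_def by (simp only: base_Un base_tri)
  have "card ((\<lambda>p. p + 1) ` fern_up as bs ?L) = card (fern_up as bs ?L)"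
    by (rule card_image) (auto simp: inj_on_def)
  then have ev: "even_sum (t_plus x y as bs) = Suc (odd_sum as + odd_sum bs)"
    "even_sum (t_minus x y z as bs) = even_sum as + even_sum bs + z"
    using card_ferns[OF L] card_base_tris[of False 0 "t_plus x y as bs"] card_base_tris[of False 0 "t_minus x y z as bs"]
    by (simp_all add: up down even_sum_alt)
  have "K' (t_plus x y as bs) * real (Q (t_minus x y z as bs)) = fern_const as bs z ?L / norm_const as bs z 0"
    using K'_value[of "t_plus x y as bs"] Q_value[of "t_minus x y z as bs"]
    by (simp add: up down ev fern_const_def norm_const_def del: of_int_add)
  then show ?thesis by (simp only: mult.assoc times_divide_eq_right)
qed

lemma H2_even: "H2 (2 * n) = (\<Prod>j<n. fact (2 * j))"
  unfolding H2_def
  by (rule prod.reindex_bij_witness[of _ "\<lambda>j. n - j" "\<lambda>i. n - i"]) (auto simp: diff_mult_distrib2)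

lemma H2_odd: "H2 (2 * n + 1) = (\<Prod>j<n. fact (2 * j + 1))"
  unfolding H2_def
  by (rule prod.reindex_bij_witness[of _ "\<lambda>j. n - j" "\<lambda>i. n - i"])
     (auto simp: diff_mult_distrib2 Suc_diff_le)

lemma norm_const_H2:
  "norm_const as bs z y = H2 (2 * odd_sum as + 2 * odd_sum bs + 2 * y + 2) * H2 (2 * even_sum as + 2 * even_sum bs + 2 * y + 2 * z + 1)"
proof -
  have "2 * odd_sum as + 2 * odd_sum bs + 2 * y + 2 = 2 * Suc (odd_sum as + odd_sum bs + y)"
    "2 * even_sum as + 2 * even_sum bs + 2 * y + 2 * z + 1 = 2 * (even_sum as + even_sum bs + z + y) + 1"
    by simp_all
  then show ?thesis by (simp only: norm_const_def H2_even H2_odd)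
qed

lemma T_pos: "0 < m \<Longrightarrow> 0 < T m n k"
  unfolding T_def by (intro prod_pos ballI pochhammer_pos) simp

theorem theorem2p12:
  fixes x y z :: nat and as bs :: "nat list"
  defines "a \<equiv> sum_list as" and "b \<equiv> sum_list bs"
    and "oa \<equiv> odd_sum as" and "ea \<equiv> even_sum as"
    and "ob \<equiv> odd_sum bs" and "eb \<equiv> even_sum bs"
  shows "MN x y z as bs =
           MN (x + y) 0 z as bs * MN 0 y z as bs / MN y 0 z as bs
           * (T (x + 1) (2 * a + b + 2 * y + z) y * T (x + a + 1) (b + 2 * y + z) y
              / (T 1 (2 * a + b + 2 * y + z) y * T (a + 1) (b + 2 * y + z) y))
         \<and> MN (x + y) 0 z as bs * MN 0 y z as bs / MN y 0 z as bs
           * (T (x + 1) (2 * a + b + 2 * y + z) y * T (x + a + 1) (b + 2 * y + z) y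
              / (T 1 (2 * a + b + 2 * y + z) y * T (a + 1) (b + 2 * y + z) y))
         = 2 powi (int (entry as 1) - int y)
           * K' (t_plus x y as bs) * real (Q (t_minus x y z as bs))
           * (fact (a + y) / fact a)
           * (H2 (2 * oa + 2 * ob + 2) * H2 (2 * ea + 2 * eb + 2 * z + 1)
              / (H2 (2 * oa + 2 * ob + 2 * y + 2) * H2 (2 * ea + 2 * eb + 2 * y + 2 * z + 1)))
           * (H (2 * a + b + 2 * y + z + 1) * H (b + y + z)
              / (H (2 * a + b + y + z + 1) * H (b + z)))
           * (T (x + 1) (2 * a + b + 2 * y + z) y * T (x + a + 1) (b + 2 * y + z) y
              / (T 1 (2 * a + b + 2 * y + z) y * T (a + 1) (b + 2 * y + z) y))"
proof -
  define d where "d = b + z"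
  define Tx where "Tx = T (x + 1) (2 * a + b + 2 * y + z) y * T (x + a + 1) (b + 2 * y + z) y"
  define T0 where "T0 = T 1 (2 * a + b + 2 * y + z) y * T (a + 1) (b + 2 * y + z) y"
  define p where "p = (2 :: real) ^ entry as 1"
  define C1 where "C1 = fern_const as bs z (int (N_len x y as bs))"
  define C2 where "C2 = fern_const as bs z (int (N_len 0 y as bs))"
  define k where "k n = norm_const as bs z n" for n
  define s where "s n = selberg_sum a (a + n + y) (a + n + y + d) y" for n
  have pos: "p \<noteq> 0" "C2 \<noteq> 0" "k 0 \<noteq> 0" "k y \<noteq> 0" "T0 \<noteq> 0"
    using norm_const_pos[of as bs z] fern_const_pos[of as bs "int (N_len 0 y as bs)" z]
      T_pos[of 1 "2 * a + b + 2 * y + z" y] T_pos[of "a + 1" "b + 2 * y + z" y]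
    by (auto simp: p_def C2_def k_def T0_def N_len_def less_imp_neq[symmetric])
  have s: "s x = s 0 * (Tx / T0)"
  proof -
    obtain c where c: "\<And>x. selberg_sum a (a + x + y) (a + x + y + d) y = c * T (x + 1) (2 * a + 2 * y + d) y * T (x + a + 1) (2 * y + d) y"
      using selberg_sum_eq_T[of a y d] by metis
    have e: "2 * a + 2 * y + d = 2 * a + b + 2 * y + z" "2 * y + d = b + 2 * y + z"
      by (simp_all add: d_def)
    have "s x = c * Tx" "s 0 = c * T0"
      unfolding s_def c e Tx_def T0_def by simp_all
    then show ?thesis using pos by simp
  qed
  have m1: "MN x y z as bs = p * C1 / k y * s x"
    and m3: "MN 0 y z as bs = p * C2 / k y * s 0"
    using N_setup.MN_sel[of x y z as bs] N_setup.MN_sel[of 0 y z as bs]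
    by (simp_all add: N_setup.L_def p_def C1_def C2_def k_def s_def a_def b_def d_def)
  \<comment> \<open>With \<open>y = 0\<close> the Selberg sum is 1, and the length is the same as
    for \<open>(x, y)\<close>, respectively \<open>(0, y)\<close>; so \<open>C1\<close> and
    \<open>C2\<close> occur again and will cancel.\<close>
  have m2: "MN (x + y) 0 z as bs = p * C1 / k 0" and m4: "MN y 0 z as bs = p * C2 / k 0"
    using N_setup.MN_sel[of "x + y" 0 z as bs] N_setup.MN_sel[of y 0 z as bs]
    by (simp_all add: N_setup.L_def p_def C1_def C2_def k_def selberg_sum_zero N_len_def)
  have ratio: "MN (x + y) 0 z as bs * MN 0 y z as bs / MN y 0 z as bs = p * C1 / k y * s 0"
    unfolding m2 m3 m4 using pos by (simp add: field_simps)
  have first: "MN x y z as bs = MN (x + y) 0 z as bs * MN 0 y z as bs / MN y 0 z as bs * (Tx / T0)"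
    unfolding ratio m1 s by simp
  have s0: "s 0 = 2 powi (- int y) * (fact (a + y) / fact a)
     * (H (2 * a + b + 2 * y + z + 1) * H (b + y + z) / (H (2 * a + b + y + z + 1) * H (b + z)))"
  proof -
    have e: "2 * a + 2 * y + d + 1 = 2 * a + b + 2 * y + z + 1" "y + d = b + y + z"
      "2 * a + y + d + 1 = 2 * a + b + y + z + 1" by (simp_all add: d_def)
    show ?thesis
      using selberg_sum_full[of a y d] unfolding e by (simp add: s_def d_def)
  qed
  have k: "k n = H2 (2 * oa + 2 * ob + 2 * n + 2) * H2 (2 * ea + 2 * eb + 2 * n + 2 * z + 1)" for n
    by (simp only: k_def norm_const_H2 oa_def ob_def ea_def eb_def)
  have kq: "p * C1 / k 0 = p * K' (t_plus x y as bs) * real (Q (t_minus x y z as bs))"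
    unfolding p_def C1_def k_def by (rule K'_Q_value)
  \<comment> \<open>The exponent has two sources: \<open>entry as 1\<close> from the half triangle,
    \<open>- y\<close> from \<open>selberg_sum_full\<close>.\<close>
  have central_prod: "2 powi (int (entry as 1) - int y) = p * (2 powi (- int y) :: real)"
    by (simp add: p_def power_int_diff power_int_minus divide_inverse)
  \<comment> \<open>Passing to the normalisation for \<open>y = 0\<close>, where \<open>kq\<close>
    identifies the first factor; the quotient of the normalisations is the quotient of the
    \<open>H2\<close>.\<close>
  have "p * C1 / k y * s 0 = (p * C1 / k 0) * (k 0 / k y) * s 0"
    using pos by simp
  also have "\<dots> = 2 powi (int (entry as 1) - int y)
           * K' (t_plus x y as bs) * real (Q (t_minus x y z as bs))
           * (fact (a + y) / fact a) * (k 0 / k y)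
           * (H (2 * a + b + 2 * y + z + 1) * H (b + y + z) / (H (2 * a + b + y + z + 1) * H (b + z)))"
    unfolding kq s0 central_prod by (simp only: mult_ac)
  finally have second: "MN (x + y) 0 z as bs * MN 0 y z as bs / MN y 0 z as bs = 2 powi (int (entry as 1) - int y)
           * K' (t_plus x y as bs) * real (Q (t_minus x y z as bs))
           * (fact (a + y) / fact a)
           * (H2 (2 * oa + 2 * ob + 2) * H2 (2 * ea + 2 * eb + 2 * z + 1)
              / (H2 (2 * oa + 2 * ob + 2 * y + 2) * H2 (2 * ea + 2 * eb + 2 * y + 2 * z + 1)))
           * (H (2 * a + b + 2 * y + z + 1) * H (b + y + z)
              / (H (2 * a + b + y + z + 1) * H (b + z)))"
    unfolding ratio k by simp
  show ?thesis
    using first unfolding second[symmetric] Tx_def T0_def by simp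
qed

end
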